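(* Let $\mathcal F$ be a filtration of a smooth vector bundle $E\to M$. The space $\mathcal D_{\mathcal F}(M)$ is locally compact and Hausdorff. Moreover, for every generating family $\mathbb X=(U,(X_i)_{i\in I},k)$ of $\mathcal F$, the map $\iota^{\mathbb X}:\beta^{-1}(U\times\mathbb R_+)\to U\times\mathrm{Grass}(\mathbb R^I)\times\mathbb R_+$ is a topological embedding with closed image in $U\times\mathrm{Grass}(\mathbb R^I)\times\mathbb R_+$, and the map $\beta:\mathcal D_{\mathcal F}(M)\to M\times\mathbb R_+$ is a continuous surjection.
   Context: Conventions: manifolds are Hausdorff; $\mathbb R_+=[0,\infty)$, $\mathbb R_+^*=(0,\infty)$, $\mathbb N=\{0,1,2,\dots\}$; $(e_i)_{i\in I}$ is the canonical basis of $\mathbb R^I$; $\mathrm{Grass}(V)$ is the manifold of all linear subspaces of a finite-dimensional real vector space $V$ (all dimensions). Filtrations. Let $E\to M$ be a smooth real vector bundle. A submodule $\mathcal E\subseteq C^\infty(M,E)$ over $C^\infty(M,\mathbb R)$ is generated on an open $U\subseteq M$ by sections $(X_i)_{i\in I}$ of $E$ if every $X\in\mathcal E$ satisfies $X|_U=\sum_i f_iX_i|_U$ for some $f_i\in C^\infty(U,\mathbb R)$; it is locally finitely generated if each point has an open neighbourhood on which it is generated by a finite family. A filtration $\mathcal F$ of $E$ of depth $N$ is a sequence $\{0\}=\mathcal F^0\subseteq\mathcal F^1\subseteq\dots\subseteq\mathcal F^N=C^\infty(M,E)$ of locally finitely generated submodules; $\mathcal F^k=C^\infty(M,E)$ for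 $k\ge N$. For $p\in M$, $I_p$ is the ideal of functions vanishing at $p$, $\mathfrak{gr}(\mathcal F)_p=\bigoplus_{k=1}^N \mathcal F^k/(\mathcal F^{k-1}+I_p\mathcal F^k)$ (finite-dimensional), and $[X]_{p,k}$ is the class of $X\in\mathcal F^k$ (zero if $k=0$ or $k>N$). A generating family $\mathbb X=(U,(X_i)_{i\in I},k)$ consists of an open $U\subseteq M$, a finite family of sections $X_i$ and degrees $k(i)\in\mathbb N$ with $X_i\in\mathcal F^{k(i)}$, such that for all $l=1,\dots,N$ the family $\{X_i: k(i)\le l\}$ generates $\mathcal F^l$ on $U$. It defines linear maps $\natural_{p,t}:\mathbb R^I\to E_p$, $e_i\mapsto t^{k(i)}X_i(p)$ for $t>0$, and $\natural_{p,0}:\mathbb R^I\to\mathfrak{gr}(\mathcal F)_p$, $e_i\mapsto[X_i]_{p,k(i)}$ (surjective for $p\in U$). Deformation of the base. For $p\in U$, $\mathcal B_{\mathcal F}(M)_p$ is the set of $L\in\mathrm{Grass}(\mathfrak{gr}(\mathcal F)_p)$ for which there is a sequence $(p_n,t_n)\in M\times\mathbb R_+^*$ with $(p_n,t_n)\to(p,0)$ and $\ker\natural_{p_n,t_n}\to\natural_{p,0}^{-1}(L)$ in $\mathrm{Grass}(\mathbb R^I)$ (independent of $\mathbb X$). $\mathcal B_{\mathcal F}(M)=\bigsqcup_p\mathcal B_{\mathcal F}(M)_p$, $\mathcal D_{\mathcal F}(M)=M\times\mathbb R_+^*\sqcup\mathcal B_{\mathcal F}(M)\times\{0\}$, and $\beta:\mathcal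 D_{\mathcal F}(M)\to M\times\mathbb R_+$ is $\beta(p,t)=(p,t)$, $\beta(p,L,0)=(p,0)$. For a generating family $\mathbb X$ the injective map $\iota^{\mathbb X}:\beta^{-1}(U\times\mathbb R_+)\to U\times\mathrm{Grass}(\mathbb R^I)\times\mathbb R_+$ is $(p,t)\mapsto(p,\ker\natural_{p,t},t)$ for $t>0$ and $(p,L,0)\mapsto(p,\natural_{p,0}^{-1}(L),0)$. The topology on $\mathcal D_{\mathcal F}(M)$ is the coarsest such that $M\times\mathbb R_+^*$ is open with its usual topology and, for every generating family $\mathbb X$, the set $\beta^{-1}(U\times\mathbb R_+)$ is open and $\iota^{\mathbb X}$ is continuous. *)

theory Defs
  imports "HOL-Analysis.Analysis" "HOL-Analysis.Finite_Function_Topology"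
begin

section \<open>Coordinate spaces and smooth maps between open sets of them\<close>

text \<open>
  For a set \<open>I\<close> of indices, \<open>\<real>\<^sup>I\<close> is the subspace of the normed space of finitely supported
  functions (only finite \<open>I\<close> are used below); its canonical basis is \<open>Poly_Mapping.single i 1\<close>.
  In this way dimensions are terms, and dimension 0 is included.
\<close>

definition coord_space :: "'i set \<Rightarrow> ('i \<Rightarrow>\<^sub>0 real) set"
  where "coord_space I = {v. Poly_Mapping.keys v \<subseteq> I}"

abbreviation Rn :: "nat \<Rightarrow> (nat \<Rightarrow>\<^sub>0 real) set"
  where "Rn n \<equiv> coord_space {..<n}"

text \<open>
  \<open>C\<^sup>k\<close> maps on a relatively open subset \<open>W\<close> of a linear subspace \<open>V\<close>.  The derivative \<open>D x\<close> is
  determined by \<open>f\<close> on \<open>V\<close> only, which is why only directions \<open>v \<in> V\<close> occur.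
\<close>

primrec Ck_on ::
    "nat \<Rightarrow> 'a::real_normed_vector set \<Rightarrow> 'a set \<Rightarrow> ('a \<Rightarrow> 'b::real_normed_vector) \<Rightarrow> bool"
  where
    "Ck_on 0 V W f \<longleftrightarrow> continuous_on W f"
  | "Ck_on (Suc k) V W f \<longleftrightarrow>
      (\<exists>D. (\<forall>x\<in>W. (f has_derivative D x) (at x within V)) \<and> (\<forall>v\<in>V. Ck_on k V W (\<lambda>x. D x v)))"

definition smooth_on ::
    "'a::real_normed_vector set \<Rightarrow> 'a set \<Rightarrow> ('a \<Rightarrow> 'b::real_normed_vector) \<Rightarrow> bool"
  where "smooth_on V W f \<longleftrightarrow> (\<forall>k. Ck_on k V W f)"


section \<open>Smooth manifolds\<close>

text \<open>
  Manifolds are Hausdorff; they are assumed neither second countable nor of pure dimension.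
  The smooth structure is given by an atlas, not necessarily maximal.
\<close>

record 'p chart =
  chart_dom :: "'p set"
  chart_dim :: nat
  chart_map :: "'p \<Rightarrow> (nat \<Rightarrow>\<^sub>0 real)"

record 'p manifold =
  mtop :: "'p topology"
  atlas :: "'p chart set"

definition is_chart :: "'p topology \<Rightarrow> 'p chart \<Rightarrow> bool"
  where "is_chart T c \<longleftrightarrow>
    openin T (chart_dom c) \<and>
    openin (top_of_set (Rn (chart_dim c))) (chart_map c ` chart_dom c) \<and>
    homeomorphic_map (subtopology T (chart_dom c)) (top_of_set (chart_map c ` chart_dom c))
      (chart_map c)"

definition chart_inv :: "'p chart \<Rightarrow> (nat \<Rightarrow>\<^sub>0 real) \<Rightarrow> 'p"
  where "chart_inv c = inv_into (chart_dom c) (chart_map c)"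

definition compatible_charts :: "'p chart \<Rightarrow> 'p chart \<Rightarrow> bool"
  where "compatible_charts c c' \<longleftrightarrow>
    smooth_on (Rn (chart_dim c)) (chart_map c ` (chart_dom c \<inter> chart_dom c'))
      (chart_map c' \<circ> chart_inv c)"

definition smooth_manifold :: "'p manifold \<Rightarrow> bool"
  where "smooth_manifold M \<longleftrightarrow>
    Hausdorff_space (mtop M) \<and>
    (\<forall>c\<in>atlas M. is_chart (mtop M) c) \<and>
    topspace (mtop M) = (\<Union>c\<in>atlas M. chart_dom c) \<and>
    (\<forall>c\<in>atlas M. \<forall>c'\<in>atlas M. compatible_charts c c')"

definition smooth_map :: "'p manifold \<Rightarrow> 'p set \<Rightarrow> ('p \<Rightarrow> 'b::real_normed_vector) \<Rightarrow> bool"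
  where "smooth_map M W f \<longleftrightarrow>
    (\<forall>c\<in>atlas M. smooth_on (Rn (chart_dim c)) (chart_map c ` (chart_dom c \<inter> W)) (f \<circ> chart_inv c))"


section \<open>Smooth vector bundles and their sections\<close>

text \<open>
  A bundle is a family of real vector spaces \<open>E\<^sub>p\<close> together with fibrewise linear local
  trivializations whose transition functions are smooth.  The fibres are linear subspaces of a real
  vector space \<open>'v\<close>, which serves only as a common carrier for the fibre operations: it has no
  topology, and the fibres over different points are related by the trivializations alone.
\<close>

record ('p, 'v) triv =
  triv_dom :: "'p set"
  triv_rank :: nat
  triv_map :: "'p \<Rightarrow> 'v \<Rightarrow> (nat \<Rightarrow>\<^sub>0 real)"

record ('p, 'v) vbundle =
  base :: "'p manifold"
  fibre :: "'p \<Rightarrow> 'v set"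
  trivs :: "('p, 'v) triv set"

abbreviation basetop :: "('p, 'v) vbundle \<Rightarrow> 'p topology"
  where "basetop E \<equiv> mtop (base E)"

abbreviation pts :: "('p, 'v) vbundle \<Rightarrow> 'p set"
  where "pts E \<equiv> topspace (basetop E)"

definition is_triv :: "('p, 'v::real_vector) vbundle \<Rightarrow> ('p, 'v) triv \<Rightarrow> bool"
  where "is_triv E \<tau> \<longleftrightarrow>
    openin (basetop E) (triv_dom \<tau>) \<and>
    (\<forall>p\<in>triv_dom \<tau>.
      bij_betw (triv_map \<tau> p) (fibre E p) (Rn (triv_rank \<tau>)) \<and>
      (\<forall>v\<in>fibre E p. \<forall>w\<in>fibre E p. triv_map \<tau> p (v + w) = triv_map \<tau> p v + triv_map \<tau> p w) \<and>
      (\<forall>v\<in>fibre E p. \<forall>a. triv_map \<tau> p (a *\<^sub>R v) = a *\<^sub>R triv_map \<tau> p v))"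

text \<open>
  A transition function \<open>g\<close> takes values in linear maps of \<open>\<real>\<^sup>r\<close>, so that its smoothness is the
  smoothness of \<open>p \<mapsto> g(p) v\<close> for every fixed \<open>v\<close>.
\<close>

definition smooth_transition ::
    "('p, 'v::real_vector) vbundle \<Rightarrow> ('p, 'v) triv \<Rightarrow> ('p, 'v) triv \<Rightarrow> bool"
  where "smooth_transition E \<tau> \<tau>' \<longleftrightarrow>
    (\<forall>v\<in>Rn (triv_rank \<tau>). smooth_map (base E) (triv_dom \<tau> \<inter> triv_dom \<tau>')
      (\<lambda>p. triv_map \<tau>' p (inv_into (fibre E p) (triv_map \<tau> p) v)))"

definition smooth_bundle :: "('p, 'v::real_vector) vbundle \<Rightarrow> bool"
  where "smooth_bundle E \<longleftrightarrow>
    smooth_manifold (base E) \<and>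
    (\<forall>p\<in>pts E. subspace (fibre E p)) \<and>
    (\<forall>\<tau>\<in>trivs E. is_triv E \<tau>) \<and>
    pts E = (\<Union>\<tau>\<in>trivs E. triv_dom \<tau>) \<and>
    (\<forall>\<tau>\<in>trivs E. \<forall>\<tau>'\<in>trivs E. smooth_transition E \<tau> \<tau>')"

text \<open>
  \<open>C\<^sup>\<infinity>(M, E)\<close>.  Sections are set to 0 outside \<open>M\<close>, so that they are determined by their values
  on \<open>M\<close> and so that the module operations are the pointwise ones.
\<close>

definition sections :: "('p, 'v::real_vector) vbundle \<Rightarrow> ('p \<Rightarrow> 'v) set"
  where "sections E = {X.
    (\<forall>p\<in>pts E. X p \<in> fibre E p) \<and>
    (\<forall>p. p \<notin> pts E \<longrightarrow> X p = 0) \<and>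
    (\<forall>\<tau>\<in>trivs E. smooth_map (base E) (triv_dom \<tau>) (\<lambda>p. triv_map \<tau> p (X p)))}"

definition submodule :: "('p, 'v::real_vector) vbundle \<Rightarrow> ('p \<Rightarrow> 'v) set \<Rightarrow> bool"
  where "submodule E S \<longleftrightarrow>
    S \<subseteq> sections E \<and>
    (\<lambda>_. 0) \<in> S \<and>
    (\<forall>X\<in>S. \<forall>Y\<in>S. (\<lambda>p. X p + Y p) \<in> S) \<and>
    (\<forall>f::'p \<Rightarrow> real. \<forall>X\<in>S. smooth_map (base E) (pts E) f \<longrightarrow> (\<lambda>p. f p *\<^sub>R X p) \<in> S)"


section \<open>Filtrations\<close>

definition generated_on ::
    "('p, 'v::real_vector) vbundle \<Rightarrow> ('p \<Rightarrow> 'v) set \<Rightarrow> 'p set \<Rightarrow> 'i set \<Rightarrow> ('i \<Rightarrow> 'p \<Rightarrow> 'v) \<Rightarrow> bool"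
  where "generated_on E S U I X \<longleftrightarrow>
    (\<forall>i\<in>I. X i \<in> S) \<and>
    (\<forall>Y\<in>S. \<exists>f::'i \<Rightarrow> 'p \<Rightarrow> real.
      (\<forall>i\<in>I. smooth_map (base E) U (f i)) \<and> (\<forall>p\<in>U. Y p = (\<Sum>i\<in>I. f i p *\<^sub>R X i p)))"

definition locally_finitely_generated ::
    "('p, 'v::real_vector) vbundle \<Rightarrow> ('p \<Rightarrow> 'v) set \<Rightarrow> bool"
  where "locally_finitely_generated E S \<longleftrightarrow>
    (\<forall>p\<in>pts E. \<exists>U (I::nat set) X.
      openin (basetop E) U \<and> p \<in> U \<and> finite I \<and> generated_on E S U I X)"

definition filtration ::
    "('p, 'v::real_vector) vbundle \<Rightarrow> (nat \<Rightarrow> ('p \<Rightarrow> 'v) set) \<Rightarrow> nat \<Rightarrow> bool"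
  where "filtration E F N \<longleftrightarrow>
    F 0 = {\<lambda>_. 0} \<and>
    (\<forall>k. F k \<subseteq> F (Suc k)) \<and>
    (\<forall>k\<ge>N. F k = sections E) \<and>
    (\<forall>k. submodule E (F k) \<and> locally_finitely_generated E (F k))"

definition generating_family ::
    "('p, 'v::real_vector) vbundle \<Rightarrow> (nat \<Rightarrow> ('p \<Rightarrow> 'v) set) \<Rightarrow> nat \<Rightarrow>
      'p set \<Rightarrow> 'i set \<Rightarrow> ('i \<Rightarrow> 'p \<Rightarrow> 'v) \<Rightarrow> ('i \<Rightarrow> nat) \<Rightarrow> bool"
  where "generating_family E F N U I X k \<longleftrightarrow>
    openin (basetop E) U \<and> finite I \<and>
    (\<forall>i\<in>I. X i \<in> F (k i)) \<and>
    (\<forall>l\<in>{1..N}. generated_on E (F l) U {i\<in>I. k i \<le> l} X)"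


section \<open>The graded space at a point\<close>

text \<open>The submodule \<open>I\<^sub>p S\<close>.\<close>

definition vanishing_mult :: "('p, 'v::real_vector) vbundle \<Rightarrow> 'p \<Rightarrow> ('p \<Rightarrow> 'v) set \<Rightarrow> ('p \<Rightarrow> 'v) set"
  where "vanishing_mult E p S =
    {\<lambda>q. \<Sum>j<m. f j q *\<^sub>R X j q | (m::nat) (f::nat \<Rightarrow> 'p \<Rightarrow> real) X.
      \<forall>j<m. smooth_map (base E) (pts E) (f j) \<and> f j p = 0 \<and> X j \<in> S}"

text \<open>The denominator \<open>F\<^sup>k\<^sup>-\<^sup>1 + I\<^sub>p F\<^sup>k\<close>, for \<open>k \<ge> 1\<close>.\<close>

definition gr_denom ::
    "('p, 'v::real_vector) vbundle \<Rightarrow> (nat \<Rightarrow> ('p \<Rightarrow> 'v) set) \<Rightarrow> 'p \<Rightarrow> nat \<Rightarrow> ('p \<Rightarrow> 'v) set"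
  where "gr_denom E F p k =
    {\<lambda>q. Y q + Z q | Y Z. Y \<in> F (k - 1) \<and> Z \<in> vanishing_mult E p (F k)}"

definition gr_coset ::
    "('p, 'v::real_vector) vbundle \<Rightarrow> (nat \<Rightarrow> ('p \<Rightarrow> 'v) set) \<Rightarrow> 'p \<Rightarrow> nat \<Rightarrow> ('p \<Rightarrow> 'v) \<Rightarrow> ('p \<Rightarrow> 'v) set"
  where "gr_coset E F p k X = {\<lambda>q. X q + Z q | Z. Z \<in> gr_denom E F p k}"

text \<open>
  An element of the direct sum is the function assigning to \<open>k \<in> {1..N}\<close> its \<open>k\<close>-th component, a
  coset.
\<close>

type_synonym ('p, 'v) gr = "nat \<Rightarrow> ('p \<Rightarrow> 'v) set"

definition gr_space ::
    "('p, 'v::real_vector) vbundle \<Rightarrow> (nat \<Rightarrow> ('p \<Rightarrow> 'v) set) \<Rightarrow> nat \<Rightarrow> 'p \<Rightarrow> ('p, 'v) gr set"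
  where "gr_space E F N p = (\<Pi>\<^sub>E k\<in>{1..N}. gr_coset E F p k ` F k)"

definition gr_zero ::
    "('p, 'v::real_vector) vbundle \<Rightarrow> (nat \<Rightarrow> ('p \<Rightarrow> 'v) set) \<Rightarrow> nat \<Rightarrow> 'p \<Rightarrow> ('p, 'v) gr"
  where "gr_zero E F N p = (\<lambda>k\<in>{1..N}. gr_denom E F p k)"

definition gr_add :: "nat \<Rightarrow> ('p, 'v::real_vector) gr \<Rightarrow> ('p, 'v) gr \<Rightarrow> ('p, 'v) gr"
  where "gr_add N \<xi> \<eta> = (\<lambda>k\<in>{1..N}. {\<lambda>q. X q + Y q | X Y. X \<in> \<xi> k \<and> Y \<in> \<eta> k})"

text \<open>Adding the denominator makes this correct also for \<open>a = 0\<close>.\<close>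

definition gr_scale ::
    "('p, 'v::real_vector) vbundle \<Rightarrow> (nat \<Rightarrow> ('p \<Rightarrow> 'v) set) \<Rightarrow> nat \<Rightarrow> 'p \<Rightarrow>
      real \<Rightarrow> ('p, 'v) gr \<Rightarrow> ('p, 'v) gr"
  where "gr_scale E F N p a \<xi> =
    (\<lambda>k\<in>{1..N}. {\<lambda>q. a *\<^sub>R X q + Z q | X Z. X \<in> \<xi> k \<and> Z \<in> gr_denom E F p k})"

text \<open>The class \<open>[X]\<^bsub>p,k\<^esub>\<close>, which is zero if \<open>k = 0\<close> or \<open>k > N\<close>.\<close>

definition gr_class ::
    "('p, 'v::real_vector) vbundle \<Rightarrow> (nat \<Rightarrow> ('p \<Rightarrow> 'v) set) \<Rightarrow> nat \<Rightarrow> 'p \<Rightarrow>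
      nat \<Rightarrow> ('p \<Rightarrow> 'v) \<Rightarrow> ('p, 'v) gr"
  where "gr_class E F N p k X =
    (\<lambda>l\<in>{1..N}. if l = k then gr_coset E F p k X else gr_denom E F p l)"

definition Grass_gr ::
    "('p, 'v::real_vector) vbundle \<Rightarrow> (nat \<Rightarrow> ('p \<Rightarrow> 'v) set) \<Rightarrow> nat \<Rightarrow> 'p \<Rightarrow> ('p, 'v) gr set set"
  where "Grass_gr E F N p = {L.
    L \<subseteq> gr_space E F N p \<and> gr_zero E F N p \<in> L \<and>
    (\<forall>\<xi>\<in>L. \<forall>\<eta>\<in>L. gr_add N \<xi> \<eta> \<in> L) \<and> (\<forall>a. \<forall>\<xi>\<in>L. gr_scale E F N p a \<xi> \<in> L)}"


section \<open>Grassmannians\<close>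

text \<open>
  All linear subspaces of \<open>V\<close>, with the usual topology: the \<open>d\<close>-dimensional subspaces carry the
  quotient topology from the Stiefel space of \<open>d\<close>-frames, and different dimensions form a
  disjoint union.
\<close>

definition Grass :: "'a::real_normed_vector set \<Rightarrow> 'a set set"
  where "Grass V = {L. subspace L \<and> L \<subseteq> V}"

definition frames :: "'a::real_normed_vector set \<Rightarrow> nat \<Rightarrow> (nat \<Rightarrow> 'a) set"
  where "frames V d =
    {f \<in> {..<d} \<rightarrow>\<^sub>E V. inj_on f {..<d} \<and> independent (f ` {..<d})}"

definition frame_topology :: "'a::real_normed_vector set \<Rightarrow> nat \<Rightarrow> (nat \<Rightarrow> 'a) topology"
  where "frame_topology V d =
    subtopology (product_topology (\<lambda>_. top_of_set V) {..<d}) (frames V d)"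

definition Grass_topology :: "'a::real_normed_vector set \<Rightarrow> 'a set topology"
  where "Grass_topology V = topology (\<lambda>W. W \<subseteq> Grass V \<and>
    (\<forall>d. openin (frame_topology V d) {f \<in> frames V d. span (f ` {..<d}) \<in> W}))"

lemma openin_Grass_topology:
  "openin (Grass_topology V) W \<longleftrightarrow>
    W \<subseteq> Grass V \<and> (\<forall>d. openin (frame_topology V d) {f \<in> frames V d. span (f ` {..<d}) \<in> W})"
proof -
  let ?P = "\<lambda>W d. {f \<in> frames V d. span (f ` {..<d}) \<in> W}"
  have "istopology (\<lambda>W. W \<subseteq> Grass V \<and> (\<forall>d. openin (frame_topology V d) (?P W d)))"
    unfolding istopology_def
  proof (intro conjI allI impI)
    fix S T d
    assume S: "S \<subseteq> Grass V \<and> (\<forall>d. openin (frame_topology V d) (?P S d))"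
      and T: "T \<subseteq> Grass V \<and> (\<forall>d. openin (frame_topology V d) (?P T d))"
    have "?P (S \<inter> T) d = ?P S d \<inter> ?P T d" by auto
    then show "openin (frame_topology V d) (?P (S \<inter> T) d)" using S T by auto
    show "S \<inter> T \<subseteq> Grass V" using S by auto
  next
    fix K d
    assume K: "\<forall>S\<in>K. S \<subseteq> Grass V \<and> (\<forall>d. openin (frame_topology V d) (?P S d))"
    have "?P (\<Union>K) d = (\<Union>S\<in>K. ?P S d)" by auto
    then show "openin (frame_topology V d) (?P (\<Union>K) d)" using K by (auto intro: openin_Union)
    show "\<Union>K \<subseteq> Grass V" using K by auto
  qed
  then show ?thesis unfolding Grass_topology_def by (simp add: topology_inverse')
qed


section \<open>The deformation space\<close>

text \<open>
  The map \<open>\<natural>\<^bsub>p,t\<^esub>\<close> for \<open>t > 0\<close> and, as the linear extension of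
  \<open>e\<^sub>i \<mapsto> [X\<^sub>i]\<^bsub>p,k(i)\<^esub>\<close> written componentwise, the map \<open>\<natural>\<^bsub>p,0\<^esub>\<close>.
\<close>

definition nat_map ::
    "'i set \<Rightarrow> ('i \<Rightarrow> 'p \<Rightarrow> 'v::real_vector) \<Rightarrow> ('i \<Rightarrow> nat) \<Rightarrow> 'p \<Rightarrow> real \<Rightarrow> ('i \<Rightarrow>\<^sub>0 real) \<Rightarrow> 'v"
  where "nat_map I X k p t v = (\<Sum>i\<in>I. Poly_Mapping.lookup v i *\<^sub>R (t ^ k i *\<^sub>R X i p))"

definition nat_ker ::
    "'i set \<Rightarrow> ('i \<Rightarrow> 'p \<Rightarrow> 'v::real_vector) \<Rightarrow> ('i \<Rightarrow> nat) \<Rightarrow> 'p \<Rightarrow> real \<Rightarrow> ('i \<Rightarrow>\<^sub>0 real) set"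
  where "nat_ker I X k p t = {v \<in> coord_space I. nat_map I X k p t v = 0}"

definition nat_map0 ::
    "('p, 'v::real_vector) vbundle \<Rightarrow> (nat \<Rightarrow> ('p \<Rightarrow> 'v) set) \<Rightarrow> nat \<Rightarrow>
      'i set \<Rightarrow> ('i \<Rightarrow> 'p \<Rightarrow> 'v) \<Rightarrow> ('i \<Rightarrow> nat) \<Rightarrow> 'p \<Rightarrow> ('i \<Rightarrow>\<^sub>0 real) \<Rightarrow> ('p, 'v) gr"
  where "nat_map0 E F N I X k p v =
    (\<lambda>l\<in>{1..N}. gr_coset E F p l (\<lambda>q. \<Sum>i\<in>{i\<in>I. k i = l}. Poly_Mapping.lookup v i *\<^sub>R X i q))"

lemma nat_map0_single:
  assumes "finite I" and "i \<in> I"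
  shows "nat_map0 E F N I X k p (Poly_Mapping.single i 1) = gr_class E F N p (k i) (X i)"
proof -
  have "(\<Sum>j\<in>{j\<in>I. k j = l}. Poly_Mapping.lookup (Poly_Mapping.single i 1) j *\<^sub>R X j q)
      = (if l = k i then X i q else 0)" for l q
  proof -
    have "(\<Sum>j\<in>{j\<in>I. k j = l}. Poly_Mapping.lookup (Poly_Mapping.single i 1) j *\<^sub>R X j q)
      = (\<Sum>j\<in>{j\<in>I. k j = l}. if j = i then X i q else 0)"
      by (rule sum.cong) (auto simp: lookup_single when_def)
    also have "\<dots> = (if l = k i then X i q else 0)"
      using assms by (subst sum.delta) auto
    finally show ?thesis .
  qed
  moreover have "gr_coset E F p l (\<lambda>_. 0) = gr_denom E F p l" for l
    by (simp add: gr_coset_def)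
  ultimately show ?thesis
    unfolding nat_map0_def gr_class_def by (auto simp: restrict_def fun_eq_iff)
qed

definition nat_preimage ::
    "('p, 'v::real_vector) vbundle \<Rightarrow> (nat \<Rightarrow> ('p \<Rightarrow> 'v) set) \<Rightarrow> nat \<Rightarrow>
      'i set \<Rightarrow> ('i \<Rightarrow> 'p \<Rightarrow> 'v) \<Rightarrow> ('i \<Rightarrow> nat) \<Rightarrow> 'p \<Rightarrow> ('p, 'v) gr set \<Rightarrow> ('i \<Rightarrow>\<^sub>0 real) set"
  where "nat_preimage E F N I X k p L = {v \<in> coord_space I. nat_map0 E F N I X k p v \<in> L}"

text \<open>
  The condition on \<open>L\<close> does not depend on the generating family, so that one generating family
  around \<open>p\<close> (these always exist) is asked for.  Here and below, finite index sets are taken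
  inside \<open>nat\<close> when they are quantified over within a definition.
\<close>

definition B_fibre ::
    "('p, 'v::real_vector) vbundle \<Rightarrow> (nat \<Rightarrow> ('p \<Rightarrow> 'v) set) \<Rightarrow> nat \<Rightarrow> 'p \<Rightarrow> ('p, 'v) gr set set"
  where "B_fibre E F N p = {L \<in> Grass_gr E F N p.
    \<exists>U (I::nat set) X k. generating_family E F N U I X k \<and> p \<in> U \<and>
      (\<exists>(pn::nat \<Rightarrow> 'p) (tn::nat \<Rightarrow> real).
        (\<forall>n. pn n \<in> pts E \<and> tn n > 0) \<and>
        limitin (basetop E) pn p sequentially \<and> tn \<longlonglongrightarrow> 0 \<and>
        limitin (Grass_topology (coord_space I)) (\<lambda>n. nat_ker I X k (pn n) (tn n))
          (nat_preimage E F N I X k p L) sequentially)}"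

text \<open>A point \<open>(p, L, 0)\<close> of the zero fibre is encoded as \<open>Inr (p, L)\<close>.\<close>

type_synonym ('p, 'v) dpoint = "('p \<times> real) + ('p \<times> ('p, 'v) gr set)"

definition D_space ::
    "('p, 'v::real_vector) vbundle \<Rightarrow> (nat \<Rightarrow> ('p \<Rightarrow> 'v) set) \<Rightarrow> nat \<Rightarrow> ('p, 'v) dpoint set"
  where "D_space E F N = (pts E \<times> {0<..}) <+> (SIGMA p:pts E. B_fibre E F N p)"

fun beta :: "('p, 'v) dpoint \<Rightarrow> 'p \<times> real"
  where
    "beta (Inl (p, t)) = (p, t)"
  | "beta (Inr (p, L)) = (p, 0)"

definition D_over ::
    "('p, 'v::real_vector) vbundle \<Rightarrow> (nat \<Rightarrow> ('p \<Rightarrow> 'v) set) \<Rightarrow> nat \<Rightarrow> 'p set \<Rightarrow> ('p, 'v) dpoint set"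
  where "D_over E F N U = {z \<in> D_space E F N. beta z \<in> U \<times> {0..}}"

fun iota ::
    "('p, 'v::real_vector) vbundle \<Rightarrow> (nat \<Rightarrow> ('p \<Rightarrow> 'v) set) \<Rightarrow> nat \<Rightarrow>
      'i set \<Rightarrow> ('i \<Rightarrow> 'p \<Rightarrow> 'v) \<Rightarrow> ('i \<Rightarrow> nat) \<Rightarrow>
      ('p, 'v) dpoint \<Rightarrow> 'p \<times> ('i \<Rightarrow>\<^sub>0 real) set \<times> real"
  where
    "iota E F N I X k (Inl (p, t)) = (p, nat_ker I X k p t, t)"
  | "iota E F N I X k (Inr (p, L)) = (p, nat_preimage E F N I X k p L, 0)"

definition iota_codomain ::
    "('p, 'v) vbundle \<Rightarrow> 'p set \<Rightarrow> 'i set \<Rightarrow> ('p \<times> ('i \<Rightarrow>\<^sub>0 real) set \<times> real) topology"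
  where "iota_codomain E U I =
    prod_topology (subtopology (basetop E) U)
      (prod_topology (Grass_topology (coord_space I)) (top_of_set {0..}))"

text \<open>
  \<open>homeomorphic_map\<close> below says that the subspace topology on \<open>M \<times> \<real>\<^sub>+\<^sup>*\<close> is the usual one.
\<close>

definition D_admissible ::
    "('p, 'v::real_vector) vbundle \<Rightarrow> (nat \<Rightarrow> ('p \<Rightarrow> 'v) set) \<Rightarrow> nat \<Rightarrow> ('p, 'v) dpoint topology \<Rightarrow> bool"
  where "D_admissible E F N T \<longleftrightarrow>
    topspace T = D_space E F N \<and>
    openin T (Inl ` (pts E \<times> {0<..})) \<and>
    homeomorphic_map (prod_topology (basetop E) (top_of_set {0<..}))
      (subtopology T (Inl ` (pts E \<times> {0<..}))) Inl \<and>
    (\<forall>U (I::nat set) X k. generating_family E F N U I X k \<longrightarrow>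
      openin T (D_over E F N U) \<and>
      continuous_map (subtopology T (D_over E F N U)) (iota_codomain E U I) (iota E F N I X k))"

text \<open>The coarsest admissible topology, as the intersection of all admissible ones.\<close>

definition D_topology ::
    "('p, 'v::real_vector) vbundle \<Rightarrow> (nat \<Rightarrow> ('p \<Rightarrow> 'v) set) \<Rightarrow> nat \<Rightarrow> ('p, 'v) dpoint topology"
  where "D_topology E F N = topology (\<lambda>S. \<forall>T. D_admissible E F N T \<longrightarrow> openin T S)"

lemma openin_D_topology:
  "openin (D_topology E F N) S \<longleftrightarrow> (\<forall>T. D_admissible E F N T \<longrightarrow> openin T S)"
proof -
  have "istopology (\<lambda>S. \<forall>T. D_admissible E F N T \<longrightarrow> openin T S)"
    unfolding istopology_def by blast
  then show ?thesis unfolding D_topology_def by (simp add: topology_inverse')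
qed

end

(*
  Choose a generating family X. Limits of the kernels of the maps natural_{p,t} as t -> 0 contain
  the kernel of natural_{p,0}: an element of the latter extends to a continuous family of elements
  of the former. As Grassmannians are compact, Hausdorff and first countable, the image of iota^X
  is therefore the closure of its part with t > 0. Two generating families are related by linear
  maps phi_{p,t}, continuous up to t = 0, with natural^Y = natural^X o phi, so that the Y-kernels
  are preimages of the X-kernels under phi. These preimages are transversal, also at t = 0, and
  transversal preimages depend continuously on the map and on the subspace. Hence every iota^X
  induces the same topology on overlaps, each iota^X is an embedding, and the space is locally a
  closed subset of a locally compact Hausdorff space.
*)

theory Submission
  imports Defs
begin

section \<open>Linear independence of families of vectors\<close>

text \<open>The obstacle is that the target of the natural map changes at t = 0, from a fibre of E
  to the graded space, and that the kernel may become smaller there. Hence nothing is compared in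
  the target: everything is pulled back to the fixed space R^I, where a subspace of the graded space
  becomes a subspace containing the kernel. Continuity of phi at t = 0 rests on degrees: Y_j is a
  combination of those X_i with k(i) \<le> k'(j) only, so phi has the entries t^(k'(j)-k(i)) f_ji
  with nonnegative exponents. Transversality holds because the two natural maps are onto the same
  space. Generators are local while the graded space consists of classes of global sections, which
  is why bump functions appear. Convergence is phrased along arbitrary filters, so that the same
  lemma serves sequences and continuity; sequences return where the definition of the zero fibre
  asks for them, and there first countability enters. An intersection of admissible topologies need
  not look admissible; an explicit subbasis that is admissible and contained in all of them settles
  this.\<close>

definition lin_comb :: "nat \<Rightarrow> (nat \<Rightarrow> 'a::real_vector) \<Rightarrow> (nat \<Rightarrow> real) \<Rightarrow> 'a"
  where "lin_comb d f c = (\<Sum>i<d. c i *\<^sub>R f i)"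

text \<open>A property of the indexed family, not of its image: closeness of two families is
  measured index by index, and a perturbed family is not known to be injective beforehand.\<close>

definition lin_indep :: "nat \<Rightarrow> (nat \<Rightarrow> 'a::real_vector) \<Rightarrow> bool"
  where "lin_indep d f \<longleftrightarrow> (\<forall>c. lin_comb d f c = 0 \<longrightarrow> (\<forall>i<d. c i = 0))"

lemma lin_indep_inj:
  assumes "lin_indep d f"
  shows "inj_on f {..<d}"
proof (rule inj_onI, rule ccontr)
  fix i j assume ij: "i \<in> {..<d}" "j \<in> {..<d}" "f i = f j" "i \<noteq> j"
  define c where "c = (\<lambda>k. if k = i then 1 else if k = j then -1 else (0::real))"
  have "lin_comb d f c = (\<Sum>k\<in>{i,j}. c k *\<^sub>R f k)"
    unfolding lin_comb_def by (rule sum.mono_neutral_right) (use ij in \<open>auto simp: c_def\<close>)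
  also have "\<dots> = 0" using ij by (simp add: c_def)
  finally have "c i = 0" using assms ij by (auto simp: lin_indep_def)
  then show False by (simp add: c_def)
qed

lemma lin_indep_iff: "lin_indep d f \<longleftrightarrow> inj_on f {..<d} \<and> independent (f ` {..<d})"
proof
  assume L: "lin_indep d f"
  have inj: "inj_on f {..<d}" by (rule lin_indep_inj[OF L])
  have "independent (f ` {..<d})"
  proof (rule independent_if_scalars_zero)
    fix u x assume s: "(\<Sum>x\<in>f ` {..<d}. u x *\<^sub>R x) = 0" and x: "x \<in> f ` {..<d}"
    have "lin_comb d f (u \<circ> f) = 0"
      using s by (simp add: lin_comb_def sum.reindex[OF inj])
    then show "u x = 0" using L x by (auto simp: lin_indep_def)
  qed simp
  then show "inj_on f {..<d} \<and> independent (f ` {..<d})" using inj by simp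
next
  assume a: "inj_on f {..<d} \<and> independent (f ` {..<d})"
  show "lin_indep d f"
    unfolding lin_indep_def
  proof (intro allI impI)
    fix c i assume c: "lin_comb d f c = 0" and i: "i < d"
    let ?u = "\<lambda>x. c (inv_into {..<d} f x)"
    have "(\<Sum>x\<in>f ` {..<d}. ?u x *\<^sub>R x) = lin_comb d f c"
      using a by (simp add: lin_comb_def sum.reindex)
    then have "?u (f i) = 0"
      using independentD[of "f ` {..<d}" "f ` {..<d}" ?u "f i"] a c i by simp
    then show "c i = 0" using a i by simp
  qed
qed

lemma span_lin_comb: "span (f ` {..<d}) = range (lin_comb d f)"
proof -
  have "lin_comb d f c \<in> span (f ` {..<d})" for c
    unfolding lin_comb_def by (intro span_sum span_scale span_base) auto
  moreover have "\<exists>c. x = lin_comb d f c" if "x \<in> span (f ` {..<d})" for x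
    using that
  proof (induction rule: span_induct_alt)
    case base
    have "lin_comb d f (\<lambda>_. 0) = 0" by (simp add: lin_comb_def)
    then show ?case by metis
  next
    case (step a x y)
    then obtain i c where i: "i < d" "x = f i" "y = lin_comb d f c" by auto
    have "a *\<^sub>R x + y = lin_comb d f (\<lambda>k. (if k = i then a else 0) + c k)"
      using i by (simp add: lin_comb_def scaleR_add_left sum.distrib if_distrib[of "\<lambda>r. r *\<^sub>R _"] sum.delta cong: if_cong)
    then show ?case by metis
  qed
  ultimately show ?thesis by blast
qed

text \<open>Coefficients from \<open>d\<close> onwards are pinned to 0, which makes the set a
  product of compact sets, so that Tychonoff's theorem applies to functions on all of
  \<open>nat\<close>.\<close>

lemma compact_coeffs: "compact {c :: nat \<Rightarrow> real. \<forall>i. c i \<in> (if i < d then {-R..R} else {0})}"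
proof -
  have "compactin (product_topology (\<lambda>_. euclidean) UNIV)
      (PiE UNIV (\<lambda>i::nat. if i < d then {-R..R} else {0::real}))"
    by (auto simp: compactin_PiE)
  moreover have "PiE UNIV (\<lambda>i::nat. if i < d then {-R..R} else {0::real})
      = {c. \<forall>i. c i \<in> (if i < d then {-R..R} else {0})}"
    by (auto simp: PiE_def Pi_iff extensional_def split: if_splits)
  ultimately show ?thesis by (simp add: euclidean_product_topology)
qed

lemma continuous_on_lin_comb:
  fixes f :: "nat \<Rightarrow> 'a::real_normed_vector"
  shows "continuous_on S (lin_comb d f)"
  unfolding lin_comb_def by (intro continuous_intros continuous_on_subset[OF continuous_on_product_coordinates]) auto

text \<open>Independence made quantitative, with the l1 norm on the coefficients: unlike
  independence itself, the inequality visibly survives small perturbations.\<close>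

definition bounded_below :: "real \<Rightarrow> nat \<Rightarrow> (nat \<Rightarrow> 'a::real_normed_vector) \<Rightarrow> bool"
  where "bounded_below m d f \<longleftrightarrow> m > 0 \<and> (\<forall>c. m * (\<Sum>i<d. \<bar>c i\<bar>) \<le> norm (lin_comb d f c))"

text \<open>The norm of the combination attains a minimum on the compact l1 unit sphere of
  coefficients; independence makes it positive, and homogeneity spreads the bound to all
  coefficients.\<close>

lemma lin_indep_bounded_below:
  fixes f :: "nat \<Rightarrow> 'a::real_normed_vector"
  assumes "lin_indep d f"
  obtains m where "bounded_below m d f"
proof -
  define S where "S = {c :: nat \<Rightarrow> real. \<forall>i. c i \<in> (if i < d then {-1..1} else {0})}
    \<inter> {c. (\<Sum>i<d. \<bar>c i\<bar>) = 1}"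
  have "compact S" unfolding S_def
    by (intro compact_Int_closed compact_coeffs closed_Collect_eq continuous_intros
      continuous_on_subset[OF continuous_on_product_coordinates]) auto
  moreover have cont: "continuous_on S (\<lambda>c. norm (lin_comb d f c))"
    by (intro continuous_on_norm continuous_on_lin_comb)
  have pos: "norm (lin_comb d f c) > 0" if "c \<in> S" for c
  proof -
    have "lin_comb d f c \<noteq> 0"
    proof
      assume "lin_comb d f c = 0"
      then have "\<forall>i<d. c i = 0" using assms by (simp add: lin_indep_def)
      then have "(\<Sum>i<d. \<bar>c i\<bar>) = 0" by simp
      then show False using that by (simp add: S_def)
    qed
    then show ?thesis by simp
  qed
  have "\<exists>m>0. \<forall>c\<in>S. m \<le> norm (lin_comb d f c)"
  proof (cases "S = {}")
    \<comment> \<open>The sphere is empty for \<open>d = 0\<close>, and any positive constant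
      serves.\<close>
    case True then show ?thesis by (intro exI[of _ 1]) auto
  next
    case False
    then obtain c0 where "c0 \<in> S" "\<forall>c\<in>S. norm (lin_comb d f c0) \<le> norm (lin_comb d f c)"
      using continuous_attains_inf[OF \<open>compact S\<close> _ cont] by auto
    then show ?thesis using pos[OF \<open>c0 \<in> S\<close>] by blast
  qed
  then obtain m where m: "m > 0" "\<And>c. c \<in> S \<Longrightarrow> m \<le> norm (lin_comb d f c)" by auto
  have "m * (\<Sum>i<d. \<bar>c i\<bar>) \<le> norm (lin_comb d f c)" for c
  proof (cases "(\<Sum>i<d. \<bar>c i\<bar>) = 0")
    case True then show ?thesis by simp
  next
    case False
    define s where "s = (\<Sum>i<d. \<bar>c i\<bar>)"
    have "s \<ge> 0" unfolding s_def by (rule sum_nonneg) simp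
    with False have s: "s > 0" unfolding s_def by linarith
    define c' where "c' = (\<lambda>i. if i < d then c i / s else 0)"
    have le: "\<bar>c i\<bar> \<le> s" if "i < d" for i
      unfolding s_def using that by (intro member_le_sum) auto
    have "(\<Sum>i<d. \<bar>c' i\<bar>) = (\<Sum>i<d. \<bar>c i\<bar>) / s"
      using s by (simp add: c'_def sum_divide_distrib)
    also have "\<dots> = 1" using s by (simp add: s_def[symmetric])
    finally have "(\<Sum>i<d. \<bar>c' i\<bar>) = 1" .
    then have "c' \<in> S"
      using s le unfolding S_def by (fastforce simp: c'_def abs_le_iff field_simps)
    then have "m \<le> norm (lin_comb d f c')" by (rule m)
    also have "lin_comb d f c' = (1/s) *\<^sub>R lin_comb d f c"
      by (simp add: lin_comb_def c'_def scaleR_sum_right)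
    finally show ?thesis using s by (simp add: s_def[symmetric] field_simps)
  qed
  then show ?thesis using m(1) that unfolding bounded_below_def by blast
qed

lemma bounded_below_lin_indep: "bounded_below m d f \<Longrightarrow> lin_indep d f"
  unfolding lin_indep_def
proof (intro allI impI)
  fix c i assume b: "bounded_below m d f" and c: "lin_comb d f c = 0" and i: "i < d"
  then have "m * (\<Sum>i<d. \<bar>c i\<bar>) \<le> 0" "m > 0" unfolding bounded_below_def by (metis norm_zero)+
  then have "(\<Sum>i<d. \<bar>c i\<bar>) \<le> 0" by (simp add: mult_le_0_iff)
  then show "c i = 0" using i member_le_sum[of i "{..<d}" "\<lambda>i. \<bar>c i\<bar>"] by simp
qed

lemma norm_lin_comb_diff:
  fixes f g :: "nat \<Rightarrow> 'a::real_normed_vector"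
  assumes "\<And>i. i < d \<Longrightarrow> norm (g i - f i) \<le> e"
  shows "norm (lin_comb d g c - lin_comb d f c) \<le> (\<Sum>i<d. \<bar>c i\<bar>) * e"
proof -
  have "lin_comb d g c - lin_comb d f c = (\<Sum>i<d. c i *\<^sub>R (g i - f i))"
    by (simp add: lin_comb_def sum_subtractf scaleR_diff_right)
  also have "norm \<dots> \<le> (\<Sum>i<d. \<bar>c i\<bar> * e)"
    by (rule sum_norm_le) (use assms in \<open>auto intro: mult_left_mono\<close>)
  finally show ?thesis by (simp add: sum_distrib_right)
qed

text \<open>The perturbation costs at most \<open>m/2\<close> times the l1 norm of the coefficients,
  half of what the lower bound provides.\<close>

lemma bounded_below_perturb:
  fixes f g :: "nat \<Rightarrow> 'a::real_normed_vector"
  assumes "bounded_below m d f" "\<And>i. i < d \<Longrightarrow> norm (g i - f i) \<le> m/2"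
  shows "bounded_below (m/2) d g"
  unfolding bounded_below_def
proof (intro conjI allI)
  show "m/2 > 0" using assms by (simp add: bounded_below_def)
  fix c
  have "m * (\<Sum>i<d. \<bar>c i\<bar>) \<le> norm (lin_comb d f c)"
    using assms by (simp add: bounded_below_def)
  also have "\<dots> \<le> norm (lin_comb d g c) + norm (lin_comb d g c - lin_comb d f c)"
    by (metis norm_minus_commute norm_triangle_sub)
  also have "\<dots> \<le> norm (lin_comb d g c) + (\<Sum>i<d. \<bar>c i\<bar>) * (m/2)"
    using norm_lin_comb_diff[OF assms(2)] by simp
  finally show "m/2 * (\<Sum>i<d. \<bar>c i\<bar>) \<le> norm (lin_comb d g c)" by (simp add: field_simps)
qed

lemma lin_indep_perturb:
  fixes f :: "nat \<Rightarrow> 'a::real_normed_vector"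
  assumes "lin_indep d f"
  obtains e m where "e > 0" "\<And>g. (\<And>i. i < d \<Longrightarrow> norm (g i - f i) < e) \<Longrightarrow> bounded_below m d g"
proof -
  obtain m where m: "bounded_below m d f" using lin_indep_bounded_below[OF assms] .
  then have "m/2 > 0" by (simp add: bounded_below_def)
  moreover have "bounded_below (m/2) d g" if "\<And>i. i < d \<Longrightarrow> norm (g i - f i) < m/2" for g
    by (rule bounded_below_perturb[OF m]) (use that in \<open>auto intro: less_imp_le\<close>)
  ultimately show ?thesis using that by blast
qed

lemma lin_indep_snoc:
  assumes f: "lin_indep d f" and w: "w \<notin> span (f ` {..<d})"
  shows "lin_indep (Suc d) (f(d := w))"
  unfolding lin_indep_def
proof (intro allI impI)
  fix c i assume c: "lin_comb (Suc d) (f(d := w)) c = 0" and i: "i < Suc d"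
  have "lin_comb (Suc d) (f(d := w)) c = lin_comb d f c + c d *\<^sub>R w"
    by (simp add: lin_comb_def)
  then have eq: "lin_comb d f c + c d *\<^sub>R w = 0" using c by simp
  have "c d = 0"
  proof (rule ccontr)
    assume "c d \<noteq> 0"
    then have "w = (- 1 / c d) *\<^sub>R lin_comb d f c"
      using eq by (simp add: eq_neg_iff_add_eq_0[symmetric])
    moreover have "\<dots> \<in> span (f ` {..<d})"
      by (intro span_scale) (simp add: span_lin_comb)
    ultimately show False using w by simp
  qed
  then have "lin_comb d f c = 0" using eq by simp
  then show "c i = 0" using f \<open>c d = 0\<close> i by (auto simp: lin_indep_def less_Suc_eq)
qed

text \<open>Perturbing the independent family obtained by adding \<open>w\<close> keeps \<open>w\<close> away from the span.\<close>

lemma span_avoids_ball: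
  fixes f :: "nat \<Rightarrow> 'a::real_normed_vector"
  assumes f: "lin_indep d f" and w: "w \<notin> span (f ` {..<d})"
  obtains e where "e > 0"
    "\<And>g. (\<And>i. i < d \<Longrightarrow> norm (g i - f i) < e) \<Longrightarrow> span (g ` {..<d}) \<inter> ball w e = {}"
proof -
  obtain e m where e: "e > 0"
    and b: "\<And>g. (\<And>i. i < Suc d \<Longrightarrow> norm (g i - (f(d := w)) i) < e) \<Longrightarrow> bounded_below m (Suc d) g"
    using lin_indep_perturb[OF lin_indep_snoc[OF f w]] by metis
  have "span (g ` {..<d}) \<inter> ball w e = {}" if g: "\<And>i. i < d \<Longrightarrow> norm (g i - f i) < e" for g
  proof (rule ccontr)
    assume "span (g ` {..<d}) \<inter> ball w e \<noteq> {}"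
    then obtain c where c: "lin_comb d g c \<in> ball w e" by (auto simp: span_lin_comb)
    \<comment> \<open>Appending the offending vector keeps the family near \<open>f(d := w)\<close>,
      hence independent, although the vector is a combination of the others by choice.\<close>
    let ?h = "g(d := lin_comb d g c)"
    have "bounded_below m (Suc d) ?h"
      by (rule b) (use g c in \<open>auto simp: less_Suc_eq dist_norm norm_minus_commute\<close>)
    then have "lin_indep (Suc d) ?h" by (rule bounded_below_lin_indep)
    moreover have "lin_comb (Suc d) ?h (c(d := -1)) = 0"
      by (simp add: lin_comb_def)
    ultimately have "(c(d := -1)) d = 0" unfolding lin_indep_def by blast
    then show False by simp
  qed
  then show ?thesis using that e by blast
qed

text \<open>Taking the family as its own perturbation in \<open>span_avoids_ball\<close> gives a
  ball around each vector of the complement.\<close>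

lemma closed_span_lin_indep:
  fixes f :: "nat \<Rightarrow> 'a::real_normed_vector"
  assumes "lin_indep d f"
  shows "closed (span (f ` {..<d}))"
proof -
  have "\<exists>e>0. ball w e \<subseteq> - span (f ` {..<d})" if w: "w \<notin> span (f ` {..<d})" for w
  proof -
    obtain e where "e > 0" and e: "\<And>g. (\<And>i. i < d \<Longrightarrow> norm (g i - f i) < e) \<Longrightarrow> span (g ` {..<d}) \<inter> ball w e = {}"
      using span_avoids_ball[OF assms w] by blast
    have "span (f ` {..<d}) \<inter> ball w e = {}" by (rule e) (use \<open>e > 0\<close> in simp)
    then show ?thesis using \<open>e > 0\<close> by blast
  qed
  then have "open (- span (f ` {..<d}))"
    by (intro openI) auto
  then show ?thesis by (simp add: closed_def)
qed

text \<open>A dimension count by Steinitz exchange: a vector of the larger span outside the smaller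
  one would give \<open>d + 1\<close> independent vectors in a space spanned by
  \<open>d\<close>.\<close>

lemma span_eq_of_lin_indep:
  assumes f: "lin_indep d f" and g: "lin_indep d g" and sub: "\<And>i. i < d \<Longrightarrow> g i \<in> span (f ` {..<d})"
  shows "span (g ` {..<d}) = span (f ` {..<d})"
proof
  show "span (g ` {..<d}) \<subseteq> span (f ` {..<d})"
    using sub by (intro span_minimal) auto
  show "span (f ` {..<d}) \<subseteq> span (g ` {..<d})"
  proof (rule ccontr)
    assume "\<not> span (f ` {..<d}) \<subseteq> span (g ` {..<d})"
    then obtain w where w: "w \<in> span (f ` {..<d})" "w \<notin> span (g ` {..<d})" by auto
    let ?h = "g(d := w)"
    have h: "lin_indep (Suc d) ?h" by (rule lin_indep_snoc[OF g w(2)])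
    have "card (?h ` {..<Suc d}) \<le> card (f ` {..<d})"
    proof -
      have "?h ` {..<Suc d} \<subseteq> span (f ` {..<d})" using sub w(1) by (auto simp: less_Suc_eq)
      moreover have "independent (?h ` {..<Suc d})" using h lin_indep_iff by blast
      ultimately show ?thesis using independent_span_bound[of "f ` {..<d}" "?h ` {..<Suc d}"] by blast
    qed
    moreover have "card (?h ` {..<Suc d}) = Suc d"
      using card_image[OF lin_indep_inj[OF h]] by simp
    moreover have "card (f ` {..<d}) \<le> d" using card_image_le[of "{..<d}" f] by simp
    ultimately show False by simp
  qed
qed


section \<open>Grassmannians\<close>

lemma in_frames_iff:
  "f \<in> frames V d \<longleftrightarrow> f \<in> {..<d} \<rightarrow>\<^sub>E V \<and> lin_indep d f"
  by (auto simp: frames_def lin_indep_iff)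

lemma lin_comb_cong: "(\<And>i. i < d \<Longrightarrow> f i = g i) \<Longrightarrow> lin_comb d f = lin_comb d g"
  by (auto simp: lin_comb_def intro!: ext sum.cong)

lemma lin_indep_cong: "(\<And>i. i < d \<Longrightarrow> f i = g i) \<Longrightarrow> lin_indep d f \<longleftrightarrow> lin_indep d g"
  using lin_comb_cong[of d f g] by (simp add: lin_indep_def)

lemma restrict_in_frames:
  assumes "lin_indep d f" "\<And>i. i < d \<Longrightarrow> f i \<in> V"
  shows "restrict f {..<d} \<in> frames V d"
  using assms lin_indep_cong[of d f "restrict f {..<d}"] by (auto simp: in_frames_iff)

lemma frame_topology_basis:
  fixes V :: "'a::real_normed_vector set"
  assumes "f \<in> frames V d" "e > 0"
  shows "openin (frame_topology V d) {g \<in> frames V d. \<forall>i<d. norm (g i - f i) < e}"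
proof -
  have "openin (product_topology (\<lambda>_. top_of_set V) {..<d}) (PiE {..<d} (\<lambda>i. V \<inter> ball (f i) e))"
    by (rule openin_PiE_gen[THEN iffD2]) auto
  moreover have "{g \<in> frames V d. \<forall>i<d. norm (g i - f i) < e}
      = PiE {..<d} (\<lambda>i. V \<inter> ball (f i) e) \<inter> frames V d"
    by (auto simp: in_frames_iff PiE_def Pi_iff dist_norm norm_minus_commute)
  ultimately show ?thesis unfolding frame_topology_def openin_subtopology by blast
qed

text \<open>Only \<open>d\<close> coordinates matter, so the product topology is that of uniform
  closeness.\<close>

lemma openin_frame_topology:
  fixes V :: "'a::real_normed_vector set"
  shows "openin (frame_topology V d) S \<longleftrightarrow> S \<subseteq> frames V d \<and>
    (\<forall>f\<in>S. \<exists>e>0. \<forall>g\<in>frames V d. (\<forall>i<d. norm (g i - f i) < e) \<longrightarrow> g \<in> S)"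
proof
  assume S: "openin (frame_topology V d) S"
  then obtain T where T: "openin (product_topology (\<lambda>_. top_of_set V) {..<d}) T" "S = T \<inter> frames V d"
    unfolding frame_topology_def openin_subtopology by blast
  have "\<exists>e>0. \<forall>g\<in>frames V d. (\<forall>i<d. norm (g i - f i) < e) \<longrightarrow> g \<in> S" if f: "f \<in> S" for f
  proof -
    obtain O' where O': "\<And>i. i < d \<Longrightarrow> openin (top_of_set V) (O' i)" "f \<in> PiE {..<d} O'" "PiE {..<d} O' \<subseteq> T"
      using T f unfolding openin_product_topology_alt by (metis IntD1 lessThan_iff)
    have "\<exists>e>0. \<forall>v\<in>V. norm (v - f i) < e \<longrightarrow> v \<in> O' i" if "i < d" for i
      using O'(1)[OF that] O'(2) that unfolding openin_euclidean_subtopology_iff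
      by (auto simp: dist_norm PiE_def Pi_iff)
    then obtain e where e: "\<And>i. i < d \<Longrightarrow> e i > 0 \<and> (\<forall>v\<in>V. norm (v - f i) < e i \<longrightarrow> v \<in> O' i)"
      by metis
    \<comment> \<open>The element 1 keeps the minimum defined when \<open>d = 0\<close>.\<close>
    define e' where "e' = Min (insert 1 (e ` {..<d}))"
    have e': "e' > 0" "\<And>i. i < d \<Longrightarrow> e' \<le> e i"
      using e by (auto simp: e'_def)
    have "g \<in> S" if g: "g \<in> frames V d" "\<forall>i<d. norm (g i - f i) < e'" for g
    proof -
      have "g i \<in> O' i" if "i < d" for i
      proof -
        have "norm (g i - f i) < e i" using g(2) e'(2)[OF that] that by force
        moreover have "g i \<in> V" using g(1) that by (auto simp: in_frames_iff PiE_def)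
        ultimately show ?thesis using e that by blast
      qed
      then have "g \<in> PiE {..<d} O'" using g(1) by (auto simp: in_frames_iff PiE_def)
      then show ?thesis using O'(3) T g(1) by blast
    qed
    then show ?thesis using e'(1) by blast
  qed
  then show "S \<subseteq> frames V d \<and> (\<forall>f\<in>S. \<exists>e>0. \<forall>g\<in>frames V d. (\<forall>i<d. norm (g i - f i) < e) \<longrightarrow> g \<in> S)"
    using T(2) by blast
next
  assume S: "S \<subseteq> frames V d \<and> (\<forall>f\<in>S. \<exists>e>0. \<forall>g\<in>frames V d. (\<forall>i<d. norm (g i - f i) < e) \<longrightarrow> g \<in> S)"
  show "openin (frame_topology V d) S"
    unfolding openin_subopen[of _ S]
  proof
    fix f assume f: "f \<in> S"
    then obtain e where e: "e > 0" "\<forall>g\<in>frames V d. (\<forall>i<d. norm (g i - f i) < e) \<longrightarrow> g \<in> S"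
      using S by blast
    have fV: "f \<in> frames V d" using S f by blast
    have "openin (frame_topology V d) {g \<in> frames V d. \<forall>i<d. norm (g i - f i) < e}"
      by (rule frame_topology_basis[OF fV e(1)])
    moreover have "f \<in> {g \<in> frames V d. \<forall>i<d. norm (g i - f i) < e}" using fV e(1) by simp
    moreover have "{g \<in> frames V d. \<forall>i<d. norm (g i - f i) < e} \<subseteq> S" using e(2) by blast
    ultimately show "\<exists>T. openin (frame_topology V d) T \<and> f \<in> T \<and> T \<subseteq> S" by blast
  qed
qed

lemma frames_span_Grass: "subspace V \<Longrightarrow> f \<in> frames V d \<Longrightarrow> span (f ` {..<d}) \<in> Grass V"
  using span_minimal[of "f ` {..<d}" V] by (auto simp: Grass_def in_frames_iff PiE_def Pi_iff)

lemma frame_dim: "f \<in> frames V d \<Longrightarrow> dim (span (f ` {..<d})) = d"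
  using dim_span_eq_card_independent[of "f ` {..<d}"]
  by (auto simp: frames_def card_image)

text \<open>The ambient normed space may be infinite-dimensional, as a space of finitely supported
  functions can be; the finite spanning set records the finite dimension of
  \<open>V\<close>.\<close>

locale fin_dim_space =
  fixes V :: "'a::real_normed_vector set" and B :: "'a set"
  assumes finite_B: "finite B" and V_span: "V = span B"
begin

lemma subspace_V: "subspace V" by (simp add: V_span)

text \<open>The bound by \<open>card B\<close> is kept because compactness of the Grassmannian needs
  finitely many dimensions.\<close>

lemma Grass_frame:
  assumes "L \<in> Grass V"
  obtains d f where "f \<in> frames V d" "span (f ` {..<d}) = L" "d \<le> card B"
proof -
  obtain C where C: "C \<subseteq> L" "independent C" "L \<subseteq> span C" using basis_exists[of L] by metis
  have "finite C \<and> card C \<le> card B"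
    using independent_span_bound[OF finite_B C(2)] C(1) assms by (auto simp: Grass_def V_span)
  then obtain g where g: "bij_betw g {..<card C} C" and le: "card C \<le> card B"
    by (metis ex_bij_betw_nat_finite lessThan_atLeast0)
  let ?f = "restrict g {..<card C}"
  have "?f \<in> frames V (card C)"
  proof -
    have "g i \<in> V" if "i < card C" for i
      using g C(1) assms bij_betwE[OF g] that by (auto simp: Grass_def)
    moreover have "inj_on ?f {..<card C}" "?f ` {..<card C} = C"
      using g by (auto simp: bij_betw_def inj_on_def)
    ultimately show ?thesis using C(2) by (auto simp: frames_def)
  qed
  moreover have "span (?f ` {..<card C}) = L"
    using g C assms span_minimal[of C L] by (auto simp: bij_betw_def Grass_def)
  ultimately show ?thesis using le that by blast
qed

lemma topspace_Grass [simp]: "topspace (Grass_topology V) = Grass V"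
proof -
  have "openin (Grass_topology V) (Grass V)"
    using frames_span_Grass[OF subspace_V]
    by (auto simp: openin_Grass_topology openin_frame_topology intro!: exI[of _ 1])
  then show ?thesis
    by (metis openin_Grass_topology openin_subset openin_topspace subset_antisym)
qed

section \<open>Semicontinuity and neighbourhood bases in the Grassmannian\<close>

lemma openin_Grass:
  "openin (Grass_topology V) W \<longleftrightarrow> W \<subseteq> Grass V \<and>
    (\<forall>d. \<forall>f\<in>frames V d. span (f ` {..<d}) \<in> W \<longrightarrow>
      (\<exists>e>0. \<forall>g\<in>frames V d. (\<forall>i<d. norm (g i - f i) < e) \<longrightarrow> span (g ` {..<d}) \<in> W))"
  unfolding openin_Grass_topology openin_frame_topology by (auto; blast)

text \<open>Lower semicontinuity: a vector of the subspace, written in a frame, moves by little when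
  the coefficients are kept and the frame is moved.\<close>

lemma openin_Grass_meets:
  assumes "open O'"
  shows "openin (Grass_topology V) {L \<in> Grass V. L \<inter> O' \<noteq> {}}"
  unfolding openin_Grass
proof (intro conjI allI ballI impI)
  fix d f assume f: "f \<in> frames V d" "span (f ` {..<d}) \<in> {L \<in> Grass V. L \<inter> O' \<noteq> {}}"
  then obtain c where "lin_comb d f c \<in> O'" by (auto simp: span_lin_comb)
  then obtain e where e: "e > 0" "ball (lin_comb d f c) e \<subseteq> O'" using assms openE by blast
  \<comment> \<open>The added 1 makes \<open>s\<close> positive and the estimate below
    strict.\<close>
  define s where "s = (\<Sum>i<d. \<bar>c i\<bar>) + 1"
  have s: "s > 0" unfolding s_def by (rule add_nonneg_pos) (auto intro: sum_nonneg)
  show "\<exists>e>0. \<forall>g\<in>frames V d. (\<forall>i<d. norm (g i - f i) < e) \<longrightarrow>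
      span (g ` {..<d}) \<in> {L \<in> Grass V. L \<inter> O' \<noteq> {}}"
  proof (intro exI[of _ "e / s"] conjI ballI impI)
    show "e / s > 0" using e s by simp
    fix g assume g: "g \<in> frames V d" "\<forall>i<d. norm (g i - f i) < e / s"
    have "norm (lin_comb d g c - lin_comb d f c) \<le> (\<Sum>i<d. \<bar>c i\<bar>) * (e / s)"
      by (rule norm_lin_comb_diff) (use g in \<open>auto intro: less_imp_le\<close>)
    also have "\<dots> < s * (e / s)" using e s by (intro mult_strict_right_mono) (auto simp: s_def)
    also have "\<dots> = e" using s by simp
    finally have "lin_comb d g c \<in> O'" using e(2) by (auto simp: dist_norm norm_minus_commute)
    moreover have "lin_comb d g c \<in> span (g ` {..<d})" by (simp add: span_lin_comb)
    ultimately show "span (g ` {..<d}) \<in> {L \<in> Grass V. L \<inter> O' \<noteq> {}}"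
      using frames_span_Grass[OF subspace_V g(1)] by blast
  qed
qed auto

lemma openin_Grass_dim: "openin (Grass_topology V) {L \<in> Grass V. dim L = d}"
  unfolding openin_Grass
  using frames_span_Grass[OF subspace_V] frame_dim[of _ V] by (auto intro!: exI[of _ 1])

text \<open>Meeting small balls only bounds a subspace from below; fixing the dimension as well
  rules out larger subspaces, and these sets become a neighbourhood base.\<close>

definition Grass_nbhd :: "nat \<Rightarrow> (nat \<Rightarrow> 'a) \<Rightarrow> real \<Rightarrow> 'a set set"
  where "Grass_nbhd d f e = {L \<in> Grass V. dim L = d \<and> (\<forall>i<d. L \<inter> ball (f i) e \<noteq> {})}"

lemma openin_Grass_nbhd: "openin (Grass_topology V) (Grass_nbhd d f e)"
proof -
  have "Grass_nbhd d f e = {L \<in> Grass V. dim L = d} \<inter>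
      (\<Inter>i\<in>{..<d}. {L \<in> Grass V. L \<inter> ball (f i) e \<noteq> {}}) \<inter> topspace (Grass_topology V)"
    by (auto simp: Grass_nbhd_def)
  also have "\<dots> = {L \<in> Grass V. dim L = d} \<inter>
      (\<Inter>(insert (topspace (Grass_topology V)) ((\<lambda>i. {L \<in> Grass V. L \<inter> ball (f i) e \<noteq> {}}) ` {..<d})))"
    by auto
  also have "openin (Grass_topology V) \<dots>"
    by (intro openin_Int openin_Inter openin_Grass_dim) (auto intro: openin_Grass_meets simp del: topspace_Grass)
  finally show ?thesis .
qed

lemma span_in_Grass_nbhd:
  assumes f: "f \<in> frames V d" and e: "e > 0"
  shows "span (f ` {..<d}) \<in> Grass_nbhd d f e"
proof -
  have "f i \<in> span (f ` {..<d}) \<inter> ball (f i) e" if "i < d" for i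
    using that e by (auto intro: span_base)
  then show ?thesis
    using frames_span_Grass[OF subspace_V f] frame_dim[OF f] unfolding Grass_nbhd_def by blast
qed

text \<open>Vectors of \<open>L\<close> chosen in the balls are still independent, and since
  \<open>L\<close> has dimension \<open>d\<close> they form a frame of it; thus closeness of
  subspaces yields closeness of frames.\<close>

lemma Grass_nbhd_frame:
  assumes f: "f \<in> frames V d"
  obtains e0 where "e0 > 0" "\<And>e L. e \<le> e0 \<Longrightarrow> L \<in> Grass_nbhd d f e \<Longrightarrow>
    \<exists>g\<in>frames V d. (\<forall>i<d. norm (g i - f i) < e) \<and> span (g ` {..<d}) = L"
proof -
  have "lin_indep d f" using f by (simp add: in_frames_iff)
  then obtain e0 m where e0: "e0 > 0"
    "\<And>g. (\<And>i. i < d \<Longrightarrow> norm (g i - f i) < e0) \<Longrightarrow> bounded_below m d g"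
    by (rule lin_indep_perturb) blast
  have "\<exists>g\<in>frames V d. (\<forall>i<d. norm (g i - f i) < e) \<and> span (g ` {..<d}) = L"
    if e: "e \<le> e0" and L: "L \<in> Grass_nbhd d f e" for e L
  proof -
    have "\<forall>i<d. \<exists>v\<in>L. norm (v - f i) < e"
      using L by (force simp: Grass_nbhd_def dist_norm norm_minus_commute)
    then obtain h where h: "\<And>i. i < d \<Longrightarrow> h i \<in> L \<and> norm (h i - f i) < e" by metis
    have "bounded_below m d h" by (rule e0(2)) (use h e in force)
    then have hi: "lin_indep d h" by (rule bounded_below_lin_indep)
    have LG: "L \<in> Grass V" "dim L = d" using L by (auto simp: Grass_nbhd_def)
    obtain d' f' where f': "f' \<in> frames V d'" "span (f' ` {..<d'}) = L" using Grass_frame[OF LG(1)] .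
    have [simp]: "d' = d" using frame_dim[OF f'(1)] f'(2) LG(2) by simp
    have "span (h ` {..<d}) = L"
      using span_eq_of_lin_indep[of d f' h] hi f' h by (auto simp: in_frames_iff)
    moreover have "restrict h {..<d} \<in> frames V d"
      using restrict_in_frames[OF hi] h LG(1) by (auto simp: Grass_def)
    ultimately show ?thesis using h by (intro bexI[of _ "restrict h {..<d}"]) auto
  qed
  then show ?thesis using e0(1) that by blast
qed

lemma Grass_nbhd_base:
  assumes f: "f \<in> frames V d" and W: "openin (Grass_topology V) W" "span (f ` {..<d}) \<in> W"
  obtains e where "e > 0" "Grass_nbhd d f e \<subseteq> W"
proof -
  obtain e0 where e0: "e0 > 0" "\<And>e L. e \<le> e0 \<Longrightarrow> L \<in> Grass_nbhd d f e \<Longrightarrow>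
    \<exists>g\<in>frames V d. (\<forall>i<d. norm (g i - f i) < e) \<and> span (g ` {..<d}) = L"
    using Grass_nbhd_frame[OF f] by blast
  obtain e where e: "e > 0"
    "\<And>g. g \<in> frames V d \<Longrightarrow> (\<forall>i<d. norm (g i - f i) < e) \<Longrightarrow> span (g ` {..<d}) \<in> W"
    using W f unfolding openin_Grass by blast
  have "Grass_nbhd d f (min e e0) \<subseteq> W"
  proof
    fix L assume L: "L \<in> Grass_nbhd d f (min e e0)"
    obtain g where "g \<in> frames V d" "\<forall>i<d. norm (g i - f i) < min e e0" "span (g ` {..<d}) = L"
      using e0(2)[OF _ L] by auto
    then show "L \<in> W" using e(2)[of g] by auto
  qed
  then show ?thesis using e(1) e0(1) that[of "min e e0"] by auto
qed

text \<open>Upper semicontinuity: subspaces near \<open>K\<close> have frames near a frame of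
  \<open>K\<close>, and \<open>span_avoids_ball\<close> applies to these.\<close>

lemma Grass_avoids_ball:
  assumes K: "K \<in> Grass V" and w: "w \<notin> K"
  obtains W e where "openin (Grass_topology V) W" "K \<in> W" "e > 0" "\<And>L. L \<in> W \<Longrightarrow> L \<inter> ball w e = {}"
proof -
  obtain d f where f: "f \<in> frames V d" "span (f ` {..<d}) = K" using Grass_frame[OF K] .
  have fi: "lin_indep d f" using f by (simp add: in_frames_iff)
  obtain e where e: "e > 0"
    "\<And>g. (\<And>i. i < d \<Longrightarrow> norm (g i - f i) < e) \<Longrightarrow> span (g ` {..<d}) \<inter> ball w e = {}"
    using span_avoids_ball[OF fi] w f(2) by metis
  obtain e0 where e0: "e0 > 0" "\<And>e L. e \<le> e0 \<Longrightarrow> L \<in> Grass_nbhd d f e \<Longrightarrow>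
    \<exists>g\<in>frames V d. (\<forall>i<d. norm (g i - f i) < e) \<and> span (g ` {..<d}) = L"
    using Grass_nbhd_frame[OF f(1)] by blast
  have "L \<inter> ball w e = {}" if L: "L \<in> Grass_nbhd d f (min e e0)" for L
  proof -
    obtain g where "g \<in> frames V d" "\<forall>i<d. norm (g i - f i) < min e e0" "span (g ` {..<d}) = L"
      using e0(2)[OF _ L] by auto
    then show ?thesis using e(2)[of g] by auto
  qed
  moreover have "K \<in> Grass_nbhd d f (min e e0)"
    using span_in_Grass_nbhd[OF f(1), of "min e e0"] f(2) e e0 by simp
  ultimately show ?thesis using that[OF openin_Grass_nbhd _ e(1)] by blast
qed

lemma first_countable_Grass: "first_countable (Grass_topology V)"
  unfolding first_countable_def
proof
  fix K assume "K \<in> topspace (Grass_topology V)"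
  then have "K \<in> Grass V" by simp
  then obtain d f where f: "f \<in> frames V d" "span (f ` {..<d}) = K" using Grass_frame by metis
  show "\<exists>\<B>. countable \<B> \<and> (\<forall>V'\<in>\<B>. openin (Grass_topology V) V') \<and>
      (\<forall>U. openin (Grass_topology V) U \<and> K \<in> U \<longrightarrow> (\<exists>V'\<in>\<B>. K \<in> V' \<and> V' \<subseteq> U))"
  proof (intro exI[of _ "range (\<lambda>n. Grass_nbhd d f (1 / Suc n))"] conjI ballI allI impI)
    fix W assume W: "openin (Grass_topology V) W \<and> K \<in> W"
    obtain e where e: "e > 0" "Grass_nbhd d f e \<subseteq> W"
      using Grass_nbhd_base[OF f(1)] W f(2) by metis
    obtain n where n: "1 / Suc n < e" using e(1) nat_approx_posE by blast
    have "Grass_nbhd d f (1 / Suc n) \<subseteq> Grass_nbhd d f e"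
      using n by (force simp: Grass_nbhd_def)
    then show "\<exists>V'\<in>range (\<lambda>n. Grass_nbhd d f (1 / Suc n)). K \<in> V' \<and> V' \<subseteq> W"
      using e(2) span_in_Grass_nbhd[OF f(1), of "1 / Suc n"] f(2) by auto
  qed (auto intro: openin_Grass_nbhd)
qed

text \<open>A vector in one subspace but not in the other gives disjoint open conditions: meeting a
  small ball around it, and avoiding that ball.\<close>

lemma Hausdorff_Grass: "Hausdorff_space (Grass_topology V)"
proof -
  have sep: "\<exists>U W. openin (Grass_topology V) U \<and> openin (Grass_topology V) W \<and> K \<in> U \<and> K' \<in> W \<and> disjnt U W"
    if K: "K \<in> Grass V" "K' \<in> Grass V" and w: "w \<in> K" "w \<notin> K'" for K K' w
  proof -
    obtain W e where W: "openin (Grass_topology V) W" "K' \<in> W" "e > 0" "\<And>L. L \<in> W \<Longrightarrow> L \<inter> ball w e = {}"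
      using Grass_avoids_ball[OF K(2) w(2)] by metis
    have "K \<in> {L \<in> Grass V. L \<inter> ball w e \<noteq> {}}" using K w W(3) by auto
    moreover have "disjnt {L \<in> Grass V. L \<inter> ball w e \<noteq> {}} W" using W(4) by (auto simp: disjnt_def)
    ultimately show ?thesis using W(1,2) openin_Grass_meets[of "ball w e"] by blast
  qed
  show ?thesis
    unfolding Hausdorff_space_def topspace_Grass
  proof (intro allI impI)
    fix K K' assume K: "K \<in> Grass V \<and> K' \<in> Grass V \<and> K \<noteq> K'"
    then consider w where "w \<in> K" "w \<notin> K'" | w where "w \<in> K'" "w \<notin> K" by blast
    then show "\<exists>U W. openin (Grass_topology V) U \<and> openin (Grass_topology V) W \<and> K \<in> U \<and> K' \<in> W \<and> disjnt U W"
    proof cases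
      case 1 then show ?thesis using sep K by blast
    next
      case 2
      then obtain U W where "openin (Grass_topology V) U" "openin (Grass_topology V) W" "K' \<in> U" "K \<in> W" "disjnt U W"
        using sep[of K' K] K by blast
      then show ?thesis by (meson disjnt_sym)
    qed
  qed
qed

section \<open>Compactness of the Grassmannian and Kuratowski convergence\<close>

text \<open>In a frame with lower bound \<open>m\<close>, vectors of norm at most \<open>R\<close>
  have coefficients at most \<open>R/m\<close>, so the set is a closed subset of the image of a
  compact cube of coefficients.\<close>

lemma compact_cball_V: "compact (V \<inter> cball 0 R)"
proof -
  have "V \<in> Grass V" using subspace_V by (simp add: Grass_def)
  then obtain d f where f: "f \<in> frames V d" "span (f ` {..<d}) = V" using Grass_frame by metis
  have fi: "lin_indep d f" using f by (simp add: in_frames_iff)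
  obtain m where m: "bounded_below m d f" using lin_indep_bounded_below[OF fi] .
  then have m0: "m > 0" by (simp add: bounded_below_def)
  have "closed V" using closed_span_lin_indep[OF fi] f(2) by simp
  define C where "C = {c :: nat \<Rightarrow> real. \<forall>i. c i \<in> (if i < d then {-(R/m)..R/m} else {0})}"
  have "compact (lin_comb d f ` C)"
    unfolding C_def by (intro compact_continuous_image continuous_on_lin_comb compact_coeffs)
  moreover have "V \<inter> cball 0 R \<subseteq> lin_comb d f ` C"
  proof
    fix v assume v: "v \<in> V \<inter> cball 0 R"
    then obtain c where c: "v = lin_comb d f c" using f(2) by (auto simp: span_lin_comb)
    let ?c = "\<lambda>i. if i < d then c i else 0"
    have v': "v = lin_comb d f ?c" by (simp add: c lin_comb_def)
    have "\<bar>c i\<bar> \<le> R / m" if "i < d" for i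
    proof -
      have "\<bar>c i\<bar> \<le> (\<Sum>i<d. \<bar>c i\<bar>)" using that by (intro member_le_sum) auto
      then have "m * \<bar>c i\<bar> \<le> m * (\<Sum>i<d. \<bar>c i\<bar>)" using m0 by simp
      also have "\<dots> \<le> norm v" using m by (simp add: bounded_below_def c)
      also have "\<dots> \<le> R" using v by simp
      finally show ?thesis using m0 by (simp add: field_simps)
    qed
    then have "?c \<in> C" by (force simp: C_def abs_le_iff)
    then show "v \<in> lin_comb d f ` C" using v' by blast
  qed
  moreover have "closed (V \<inter> cball 0 R)" using \<open>closed V\<close> by blast
  ultimately show ?thesis using compact_Int_closed by (metis inf.absorb_iff2)
qed

text \<open>By Riesz's lemma every subspace has a frame all of whose vectors have norm 1 and distance at
  least \<open>1/2\<close> to the span of their predecessors; such frames form a compact set.\<close>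

definition Riesz_frames :: "nat \<Rightarrow> (nat \<Rightarrow> 'a) set"
  where "Riesz_frames d = {f. \<forall>k. f k \<in> (if k < d then V \<inter> cball 0 1 else {0}) \<and>
    (k < d \<longrightarrow> norm (f k) = 1 \<and> (\<forall>c. 1/2 \<le> norm (f k - lin_comb k f c)))}"

text \<open>All conditions are closed in the product topology; the vectors with index below
  \<open>d\<close> range over a compact ball of \<open>V\<close>, the others over a point.\<close>

lemma compact_Riesz_frames: "compact (Riesz_frames d)"
proof -
  have "compactin (product_topology (\<lambda>_. euclidean) UNIV)
      (PiE UNIV (\<lambda>k::nat. if k < d then V \<inter> cball 0 1 else {0}))"
    using compact_cball_V by (auto simp: compactin_PiE)
  then have "compact (PiE UNIV (\<lambda>k::nat. if k < d then V \<inter> cball 0 1 else {0}))"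
    by (simp add: euclidean_product_topology)
  moreover have "closed {f :: nat \<Rightarrow> 'a. k < d \<longrightarrow> norm (f k) = 1 \<and> (\<forall>c. 1/2 \<le> norm (f k - lin_comb k f c))}" for k
    unfolding lin_comb_def
    by (intro closed_Collect_imp closed_Collect_conj closed_Collect_all closed_Collect_eq closed_Collect_le
      continuous_intros continuous_on_subset[OF continuous_on_product_coordinates]) auto
  then have "closed (\<Inter>k. {f :: nat \<Rightarrow> 'a. k < d \<longrightarrow> norm (f k) = 1 \<and> (\<forall>c. 1/2 \<le> norm (f k - lin_comb k f c))})"
    by blast
  moreover have "Riesz_frames d = PiE UNIV (\<lambda>k::nat. if k < d then V \<inter> cball 0 1 else {0})
      \<inter> (\<Inter>k. {f :: nat \<Rightarrow> 'a. k < d \<longrightarrow> norm (f k) = 1 \<and> (\<forall>c. 1/2 \<le> norm (f k - lin_comb k f c))})"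
    unfolding Riesz_frames_def by (auto simp: PiE_def Pi_iff extensional_def split: if_splits)
  ultimately show ?thesis by (simp only: compact_Int_closed)
qed

text \<open>Keeping distance \<open>1/2\<close> from the span of the predecessors excludes
  membership in it, so independence is built up one vector at a time.\<close>

lemma Riesz_frames_lin_indep:
  assumes "f \<in> Riesz_frames d" "k \<le> d"
  shows "lin_indep k f"
  using assms(2)
proof (induction k)
  case 0 then show ?case by (simp add: lin_indep_def)
next
  case (Suc k)
  have "f k \<notin> span (f ` {..<k})"
  proof
    assume "f k \<in> span (f ` {..<k})"
    then obtain c where "f k = lin_comb k f c" by (auto simp: span_lin_comb)
    then show False using assms(1) Suc.prems unfolding Riesz_frames_def
      by (metis (mono_tags, lifting) Suc_le_lessD diff_self half_gt_zero_iff linorder_not_le mem_Collect_eq norm_zero zero_less_one)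
  qed
  then have "lin_indep (Suc k) (f(k := f k))" using Suc by (intro lin_indep_snoc) auto
  then show ?case by simp
qed

lemma Riesz_frames_exists:
  assumes L: "L \<in> Grass V" "dim L = d" and "k \<le> d"
  shows "\<exists>f\<in>Riesz_frames k. \<forall>i<k. f i \<in> L"
  using assms(3)
proof (induction k)
  case 0
  show ?case by (intro bexI[of _ "\<lambda>_. 0"]) (auto simp: Riesz_frames_def)
next
  case (Suc k)
  then obtain f where f: "f \<in> Riesz_frames k" "\<And>i. i < k \<Longrightarrow> f i \<in> L" by auto
  have LV: "subspace L" "L \<subseteq> V" using L by (auto simp: Grass_def)
  have fi: "lin_indep k f" using Riesz_frames_lin_indep[OF f(1)] by simp
  let ?S = "span (f ` {..<k})"
  have SL: "?S \<subseteq> L" using f(2) LV by (intro span_minimal) auto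
  have "dim ?S = k" using fi by (simp add: lin_indep_iff dim_eq_card_independent card_image)
  then have "?S \<noteq> L" using L(2) Suc.prems by auto
  then obtain y where y: "y \<in> L" "y \<notin> ?S" using SL by blast
  have ne: "?S \<noteq> {}" using span_zero by blast
  define \<delta> where "\<delta> = infdist y ?S"
  have "\<delta> \<noteq> 0" unfolding \<delta>_def
    using in_closed_iff_infdist_zero[OF closed_span_lin_indep[OF fi] ne] y by simp
  then have \<delta>: "\<delta> > 0" using infdist_nonneg[of y ?S] by (simp add: \<delta>_def)
  \<comment> \<open>A point of the span nearest to \<open>y\<close> up to a factor 2; this factor is
    the origin of the constant \<open>1/2\<close>.\<close>
  have "\<exists>s\<in>?S. dist y s < 2 * \<delta>"
    using \<delta> cInf_lessD[of "dist y ` ?S" "2 * \<delta>"] ne unfolding \<delta>_def infdist_def by auto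
  then obtain s where s: "s \<in> ?S" "dist y s < 2 * \<delta>" by blast
  define u where "u = norm (y - s)"
  have u: "u > 0" "u < 2 * \<delta>" using s y by (auto simp: u_def dist_norm)
  define w where "w = (1/u) *\<^sub>R (y - s)"
  have wL: "w \<in> L" unfolding w_def using y s SL LV by (intro subspace_scale subspace_diff) auto
  have far: "1/2 \<le> norm (w - x)" if "x \<in> ?S" for x
  proof -
    \<comment> \<open>Undoing the normalization: \<open>u (w - x)\<close> is
      \<open>y - (s + u x)\<close>, whose norm is at least the distance \<open>\<delta>\<close> from
      \<open>y\<close> to the span.\<close>
    have "s + u *\<^sub>R x \<in> ?S" using s that by (intro span_add span_scale)
    then have "\<delta> \<le> dist y (s + u *\<^sub>R x)" unfolding \<delta>_def by (rule infdist_le)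
    also have "\<dots> = norm (u *\<^sub>R (w - x))"
      using u by (simp add: dist_norm w_def algebra_simps)
    also have "\<dots> = u * norm (w - x)" using u by simp
    finally have "u * (1/2) \<le> u * norm (w - x)" using u(2) by linarith
    then have "1/2 \<le> norm (w - x)" using u(1) by (rule mult_left_le_imp_le)
    then show ?thesis .
  qed
  have lc: "lin_comb i (f(k := w)) = lin_comb i f" if "i \<le> k" for i
    by (rule lin_comb_cong) (use that in auto)
  have "f(k := w) \<in> Riesz_frames (Suc k)"
    unfolding Riesz_frames_def mem_Collect_eq
  proof (intro allI)
    fix i
    consider "i < k" | "i = k" | "i > k" by linarith
    then show "(f(k := w)) i \<in> (if i < Suc k then V \<inter> cball 0 1 else {0}) \<and>
      (i < Suc k \<longrightarrow> norm ((f(k := w)) i) = 1 \<and>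
        (\<forall>c. 1 / 2 \<le> norm ((f(k := w)) i - lin_comb i (f(k := w)) c)))"
    proof cases
      case 1
      then show ?thesis using f(1) lc[of i] unfolding Riesz_frames_def by auto
    next
      case 2
      have "norm w = 1" using u by (simp add: w_def u_def)
      moreover have "1/2 \<le> norm (w - lin_comb k f c)" for c
        by (rule far) (simp add: span_lin_comb)
      ultimately show ?thesis using 2 wL LV lc[of k] by auto
    next
      case 3
      then have "f i = 0" using f(1) unfolding Riesz_frames_def
        by (metis (mono_tags, lifting) mem_Collect_eq not_less_iff_gr_or_eq singletonD)
      then show ?thesis using 3 by simp
    qed
  qed
  moreover have "\<forall>i<Suc k. (f(k := w)) i \<in> L" using f(2) wL by (auto simp: less_Suc_eq)
  ultimately show ?case by blast
qed

lemma continuous_map_span_Riesz_frames: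
  "continuous_map (top_of_set (Riesz_frames d)) (Grass_topology V) (\<lambda>f. span (f ` {..<d}))"
proof -
  \<comment> \<open>A Riesz frame is 0 beyond \<open>d\<close>, whereas members of
    \<open>frames\<close> are \<open>undefined\<close> there; restriction passes between the
    conventions without changing the span.\<close>
  have fr: "restrict f {..<d} \<in> frames V d" if "f \<in> Riesz_frames d" for f
    using that Riesz_frames_lin_indep[OF that order_refl]
    by (intro restrict_in_frames) (auto simp: Riesz_frames_def split: if_splits)
  have sp: "span (restrict f {..<d} ` {..<d}) = span (f ` {..<d})" for f :: "nat \<Rightarrow> 'a" by simp
  have G: "span (f ` {..<d}) \<in> Grass V" if "f \<in> Riesz_frames d" for f
    using frames_span_Grass[OF subspace_V fr[OF that]] by simp
  show ?thesis
    unfolding continuous_map_def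
  proof (intro conjI allI impI)
    show "(\<lambda>f. span (f ` {..<d})) \<in> topspace (top_of_set (Riesz_frames d)) \<rightarrow> topspace (Grass_topology V)"
      using G by auto
    fix W assume W: "openin (Grass_topology V) W"
    show "openin (top_of_set (Riesz_frames d)) {f \<in> topspace (top_of_set (Riesz_frames d)). span (f ` {..<d}) \<in> W}"
      unfolding openin_subopen[of _ "{f \<in> topspace _. _ f}"]
    proof
      fix f assume "f \<in> {f \<in> topspace (top_of_set (Riesz_frames d)). span (f ` {..<d}) \<in> W}"
      then have f: "f \<in> Riesz_frames d" "span (f ` {..<d}) \<in> W" by auto
      obtain e where e: "e > 0" "\<And>g. g \<in> frames V d \<Longrightarrow> (\<forall>i<d. norm (g i - restrict f {..<d} i) < e) \<Longrightarrow> span (g ` {..<d}) \<in> W"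
        using W fr[OF f(1)] f(2) unfolding openin_Grass by (metis sp)
      define T where "T = (\<Inter>i\<in>{..<d}. {g :: nat \<Rightarrow> 'a. norm (g i - f i) < e})"
      have "open T" unfolding T_def
        by (intro open_INT finite_lessThan ballI open_Collect_less continuous_intros
          continuous_on_subset[OF continuous_on_product_coordinates]) auto
      have "span (g ` {..<d}) \<in> W" if "g \<in> T" "g \<in> Riesz_frames d" for g
        using e(2)[OF fr[OF that(2)]] that(1) by (simp add: T_def)
      then show "\<exists>T. openin (top_of_set (Riesz_frames d)) T \<and> f \<in> T \<and>
          T \<subseteq> {f \<in> topspace (top_of_set (Riesz_frames d)). span (f ` {..<d}) \<in> W}"
        using \<open>open T\<close> f(1) e(1)
        by (intro exI[of _ "Riesz_frames d \<inter> T"]) (auto simp: T_def intro: openin_open_Int)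
    qed
  qed
qed

text \<open>A finite union, over the possible dimensions, of continuous images of the compact sets
  of Riesz frames.\<close>

lemma compact_Grass: "compact_space (Grass_topology V)"
proof -
  have "compactin (Grass_topology V) ((\<lambda>f. span (f ` {..<d})) ` Riesz_frames d)" for d
    using image_compactin[OF _ continuous_map_span_Riesz_frames] compact_Riesz_frames
    by (metis compact_space_subtopology compactin_euclidean_iff compactin_subspace subset_refl topspace_euclidean_subtopology compact_space_def)
  then have "compactin (Grass_topology V) (\<Union>d\<in>{..card B}. (\<lambda>f. span (f ` {..<d})) ` Riesz_frames d)"
    by (intro compactin_Union) auto
  moreover have "(\<Union>d\<in>{..card B}. (\<lambda>f. span (f ` {..<d})) ` Riesz_frames d) = Grass V"
  proof
    show "(\<Union>d\<in>{..card B}. (\<lambda>f. span (f ` {..<d})) ` Riesz_frames d) \<subseteq> Grass V"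
      using calculation compactin_subset_topspace by fastforce
    show "Grass V \<subseteq> (\<Union>d\<in>{..card B}. (\<lambda>f. span (f ` {..<d})) ` Riesz_frames d)"
    proof
      fix L assume L: "L \<in> Grass V"
      obtain d f where f: "f \<in> frames V d" "span (f ` {..<d}) = L" "d \<le> card B" using Grass_frame[OF L] .
      have "dim L = d" using frame_dim[OF f(1)] f(2) by simp
      then obtain g where g: "g \<in> Riesz_frames d" "\<forall>i<d. g i \<in> L"
        using Riesz_frames_exists[OF L _ order_refl] by blast
      have "span (g ` {..<d}) = L"
        using span_eq_of_lin_indep[of d f g] Riesz_frames_lin_indep[OF g(1) order_refl] g f
        by (auto simp: in_frames_iff)
      then show "L \<in> (\<Union>d\<in>{..card B}. (\<lambda>f. span (f ` {..<d})) ` Riesz_frames d)"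
        using g(1) f(3) by blast
    qed
  qed
  ultimately show ?thesis by (simp add: compact_space_def)
qed

text \<open>The right-hand side is Kuratowski convergence; it suffices because the Grassmannian is compact.\<close>

lemma limitin_Grass_iff:
  "limitin (Grass_topology V) \<kappa> K \<F> \<longleftrightarrow> K \<in> Grass V \<and> eventually (\<lambda>x. \<kappa> x \<in> Grass V) \<F> \<and>
    (\<forall>w\<in>K. \<forall>e>0. eventually (\<lambda>x. \<kappa> x \<inter> ball w e \<noteq> {}) \<F>) \<and>
    (\<forall>w. w \<notin> K \<longrightarrow> (\<exists>e>0. eventually (\<lambda>x. \<kappa> x \<inter> ball w e = {}) \<F>))" (is "?L \<longleftrightarrow> ?R")
proof
  assume L: ?L
  then have K: "K \<in> Grass V" using limitin_topspace by force
  have ev: "eventually (\<lambda>x. \<kappa> x \<in> W) \<F>" if "openin (Grass_topology V) W" "K \<in> W" for W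
    using L that limitinD by fast
  have "eventually (\<lambda>x. \<kappa> x \<in> Grass V) \<F>"
    using ev[OF openin_topspace] K by simp
  moreover have "eventually (\<lambda>x. \<kappa> x \<inter> ball w e \<noteq> {}) \<F>" if "w \<in> K" "e > 0" for w e
  proof -
    have "eventually (\<lambda>x. \<kappa> x \<in> {L \<in> Grass V. L \<inter> ball w e \<noteq> {}}) \<F>"
      by (rule ev) (use that K in \<open>auto intro!: openin_Grass_meets\<close>)
    then show ?thesis by eventually_elim auto
  qed
  moreover have "\<exists>e>0. eventually (\<lambda>x. \<kappa> x \<inter> ball w e = {}) \<F>" if w: "w \<notin> K" for w
  proof -
    obtain W e where W: "openin (Grass_topology V) W" "K \<in> W" "e > 0" "\<And>L. L \<in> W \<Longrightarrow> L \<inter> ball w e = {}"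
      using Grass_avoids_ball[OF K w] by metis
    have "eventually (\<lambda>x. \<kappa> x \<inter> ball w e = {}) \<F>"
      using ev[OF W(1,2)] by eventually_elim (rule W(4))
    then show ?thesis using W(3) by blast
  qed
  ultimately show ?R using K by blast
next
  assume R: ?R
  show ?L
    unfolding limitin_def
  proof (intro conjI allI impI)
    show "K \<in> topspace (Grass_topology V)" using R by simp
    fix W assume W: "openin (Grass_topology V) W \<and> K \<in> W"
    \<comment> \<open>Each subspace outside \<open>W\<close> has a neighbourhood that
      \<open>\<kappa>\<close> eventually leaves: the subspace either misses a vector of
      \<open>K\<close> or contains a vector that is not in \<open>K\<close>.\<close>
    have "\<exists>T. openin (Grass_topology V) T \<and> K' \<in> T \<and> eventually (\<lambda>x. \<kappa> x \<notin> T) \<F>"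
      if K': "K' \<in> Grass V - W" for K'
    proof -
      have "K' \<noteq> K" using K' W by blast
      then consider w where "w \<in> K" "w \<notin> K'" | w where "w \<in> K'" "w \<notin> K" by blast
      then show ?thesis
      proof cases
        case 1
        have "K' \<in> Grass V" using K' by simp
        then obtain T e where T: "openin (Grass_topology V) T" "K' \<in> T" "e > 0" "\<And>L. L \<in> T \<Longrightarrow> L \<inter> ball w e = {}"
          using Grass_avoids_ball[of K' w] 1 by metis
        have "eventually (\<lambda>x. \<kappa> x \<inter> ball w e \<noteq> {}) \<F>" using R 1 T(3) by blast
        then have "eventually (\<lambda>x. \<kappa> x \<notin> T) \<F>" by eventually_elim (use T(4) in blast)
        then show ?thesis using T by blast
      next
        case 2
        then obtain e where e: "e > 0" "eventually (\<lambda>x. \<kappa> x \<inter> ball w e = {}) \<F>" using R by blast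
        have "eventually (\<lambda>x. \<kappa> x \<notin> {L \<in> Grass V. L \<inter> ball w e \<noteq> {}}) \<F>"
          using e(2) by eventually_elim auto
        moreover have "K' \<in> {L \<in> Grass V. L \<inter> ball w e \<noteq> {}}" using 2 e(1) K' by auto
        ultimately show ?thesis using openin_Grass_meets[of "ball w e"] by blast
      qed
    qed
    then obtain T where T: "\<And>K'. K' \<in> Grass V - W \<Longrightarrow>
        openin (Grass_topology V) (T K') \<and> K' \<in> T K' \<and> eventually (\<lambda>x. \<kappa> x \<notin> T K') \<F>"
      by metis
    \<comment> \<open>Compactness of the complement of \<open>W\<close> leaves finitely many of
      these neighbourhoods, which are then left simultaneously.\<close>
    have "closedin (Grass_topology V) (Grass V - W)"
      using W by (metis closedin_topspace closedin_diff topspace_Grass)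
    then have "compactin (Grass_topology V) (Grass V - W)"
      using compact_Grass closedin_compact_space by blast
    then have "\<exists>\<F>'. finite \<F>' \<and> \<F>' \<subseteq> T ` (Grass V - W) \<and> Grass V - W \<subseteq> \<Union>\<F>'"
      by (rule compactinD) (use T in blast)+
    then obtain \<F>' where F': "finite \<F>'" "\<F>' \<subseteq> T ` (Grass V - W)" "Grass V - W \<subseteq> \<Union>\<F>'" by blast
    have "eventually (\<lambda>x. \<forall>S\<in>\<F>'. \<kappa> x \<notin> S) \<F>"
      using F'(1,2) T by (intro eventually_ball_finite) auto
    moreover have "eventually (\<lambda>x. \<kappa> x \<in> Grass V) \<F>" using R by blast
    ultimately show "eventually (\<lambda>x. \<kappa> x \<in> W) \<F>"
      by eventually_elim (use F'(3) in blast)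
  qed
qed

text \<open>Incidence of a vector and a subspace is a closed relation: if \<open>w0\<close> were
  outside \<open>K\<close>, the subspaces would eventually avoid a ball around it.\<close>

lemma limitin_Grass_mem:
  assumes "limitin (Grass_topology V) \<kappa> K \<F>" "(w \<longlongrightarrow> w0) \<F>" "eventually (\<lambda>x. w x \<in> \<kappa> x) \<F>" "\<F> \<noteq> bot"
  shows "w0 \<in> K"
proof (rule ccontr)
  assume "w0 \<notin> K"
  then obtain e where e: "e > 0" "eventually (\<lambda>x. \<kappa> x \<inter> ball w0 e = {}) \<F>"
    using assms(1) unfolding limitin_Grass_iff by blast
  have "eventually (\<lambda>x. dist (w x) w0 < e) \<F>" using assms(2) e(1) by (rule tendstoD)
  with e(2) assms(3) have "eventually (\<lambda>x. False) \<F>"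
    by eventually_elim (auto simp: dist_commute)
  then show False using assms(4) by (simp add: eventually_False)
qed

end


section \<open>Preimages and coordinate spaces\<close>

lemma (in fin_dim_space) closed_V: "closed V"
proof -
  have "V \<in> Grass V" using subspace_V by (simp add: Grass_def)
  then obtain d f where f: "f \<in> frames V d" "span (f ` {..<d}) = V" using Grass_frame by metis
  then show ?thesis using closed_span_lin_indep[of d f] by (simp add: in_frames_iff)
qed

section \<open>Continuity of transversal preimages\<close>

lemma linear_lin_comb: "linear \<phi> \<Longrightarrow> \<phi> (lin_comb d f c) = lin_comb d (\<lambda>i. \<phi> (f i)) c"
  by (simp add: lin_comb_def linear_sum linear_scale)

lemma subspace_lin_comb: "subspace S \<Longrightarrow> (\<And>i. i < d \<Longrightarrow> f i \<in> S) \<Longrightarrow> lin_comb d f c \<in> S"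
  by (auto simp: lin_comb_def intro!: subspace_sum subspace_scale)

lemma norm_lin_comb_le: "norm (lin_comb d f c) \<le> (\<Sum>i<d. \<bar>c i\<bar>) * (\<Sum>i<d. norm (f i))"
proof -
  have "norm (lin_comb d f c) \<le> (\<Sum>i<d. \<bar>c i\<bar> * norm (f i))"
    unfolding lin_comb_def by (rule sum_norm_le) simp
  also have "\<dots> \<le> (\<Sum>i<d. \<bar>c i\<bar> * (\<Sum>i<d. norm (f i)))"
    by (intro sum_mono mult_left_mono member_le_sum) auto
  finally show ?thesis by (simp add: sum_distrib_right)
qed

text \<open>Pointwise convergence on the finitely many vectors of a frame bounds all values, the
  coefficients being controlled by the norm through the lower bound \<open>m\<close>.\<close>

lemma (in fin_dim_space) eventually_uniformly_bounded:
  fixes \<phi> :: "'x \<Rightarrow> 'a \<Rightarrow> 'b::real_normed_vector"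
  assumes lin: "\<And>x. linear (\<phi> x)"
    and lim: "\<And>v. v \<in> V \<Longrightarrow> ((\<lambda>x. \<phi> x v) \<longlongrightarrow> \<psi> v) \<F>"
  obtains C where "C > 0" "eventually (\<lambda>x. \<forall>v\<in>V. norm (\<phi> x v) \<le> C * norm v) \<F>"
proof -
  have "V \<in> Grass V" using subspace_V by (simp add: Grass_def)
  then obtain d f where f: "f \<in> frames V d" "span (f ` {..<d}) = V" using Grass_frame by metis
  have fV: "f i \<in> V" if "i < d" for i using f that by (auto simp: in_frames_iff)
  obtain m where m: "bounded_below m d f"
    using lin_indep_bounded_below f by (auto simp: in_frames_iff)
  then have m0: "m > 0" by (simp add: bounded_below_def)
  \<comment> \<open>The 1 in each summand is the slack that turns convergence into an eventual
    bound; the last 1 keeps \<open>A\<close> positive for \<open>d = 0\<close>.\<close>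
  define A where "A = (\<Sum>i<d. norm (\<psi> (f i)) + 1) + 1"
  have A: "A > 0" unfolding A_def by (rule add_nonneg_pos) (auto intro!: sum_nonneg)
  have "eventually (\<lambda>x. \<forall>i\<in>{..<d}. norm (\<phi> x (f i)) < norm (\<psi> (f i)) + 1) \<F>"
  proof (intro eventually_ball_finite ballI)
    fix i assume "i \<in> {..<d}"
    then have "((\<lambda>x. norm (\<phi> x (f i))) \<longlongrightarrow> norm (\<psi> (f i))) \<F>"
      by (intro tendsto_norm lim fV) simp
    then show "eventually (\<lambda>x. norm (\<phi> x (f i)) < norm (\<psi> (f i)) + 1) \<F>"
      by (rule order_tendstoD) simp
  qed simp
  then have "eventually (\<lambda>x. \<forall>v\<in>V. norm (\<phi> x v) \<le> (A / m) * norm v) \<F>"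
  proof eventually_elim
    case (elim x)
    show ?case
    proof
      fix v assume "v \<in> V"
      then obtain c where c: "v = lin_comb d f c" using f(2) by (auto simp: span_lin_comb)
      have "norm (\<phi> x v) \<le> (\<Sum>i<d. \<bar>c i\<bar>) * (\<Sum>i<d. norm (\<phi> x (f i)))"
        by (simp add: c linear_lin_comb[OF lin] norm_lin_comb_le)
      also have "\<dots> \<le> (\<Sum>i<d. \<bar>c i\<bar>) * A"
      proof (intro mult_left_mono)
        have "(\<Sum>i<d. norm (\<phi> x (f i))) \<le> (\<Sum>i<d. norm (\<psi> (f i)) + 1)"
          by (rule sum_mono) (use elim in force)
        then show "(\<Sum>i<d. norm (\<phi> x (f i))) \<le> A" by (simp add: A_def)
      qed (simp add: sum_nonneg)
      also have "\<dots> \<le> (norm v / m) * A"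
      proof (intro mult_right_mono)
        have "m * (\<Sum>i<d. \<bar>c i\<bar>) \<le> norm v" using m by (simp add: bounded_below_def c)
        then show "(\<Sum>i<d. \<bar>c i\<bar>) \<le> norm v / m" using m0 by (simp add: field_simps)
      qed (use A in simp)
      finally show "norm (\<phi> x v) \<le> (A / m) * norm v" by (simp add: mult_ac)
    qed
  qed
  then show ?thesis using that[of "A / m"] A m0 by simp
qed

text \<open>An element of the limit preimage is corrected with the help of a basis of \<open>W\<close> of the form
  \<open>\<psi> a\<^sub>i - k\<^sub>i\<close>, \<open>k\<^sub>i \<in> K\<close>, which persists under perturbation.\<close>

lemma limitin_Grass_preimage:
  fixes V :: "'a::real_normed_vector set" and W :: "'b::real_normed_vector set"
  assumes V: "fin_dim_space V B" and W: "fin_dim_space W C"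
    and lin: "\<And>x. linear (\<phi> x)" and lin0: "linear \<psi>"
    and into: "eventually (\<lambda>x. \<phi> x ` V \<subseteq> W) \<F>" and into0: "\<psi> ` V \<subseteq> W"
    and lim: "\<And>v. v \<in> V \<Longrightarrow> ((\<lambda>x. \<phi> x v) \<longlongrightarrow> \<psi> v) \<F>"
    and K: "limitin (Grass_topology W) \<kappa> K \<F>"
    and trans: "\<And>w. w \<in> W \<Longrightarrow> \<exists>v\<in>V. \<psi> v - w \<in> K"
  shows "limitin (Grass_topology V) (\<lambda>x. {v\<in>V. \<phi> x v \<in> \<kappa> x}) {v\<in>V. \<psi> v \<in> K} \<F>"
proof -
  interpret S: fin_dim_space V B by (rule V)
  interpret T: fin_dim_space W C by (rule W)
  have K': "K \<in> Grass W" "eventually (\<lambda>x. \<kappa> x \<in> Grass W) \<F>"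
    "\<And>w e. w \<in> K \<Longrightarrow> e > 0 \<Longrightarrow> eventually (\<lambda>x. \<kappa> x \<inter> ball w e \<noteq> {}) \<F>"
    "\<And>w. w \<notin> K \<Longrightarrow> \<exists>e>0. eventually (\<lambda>x. \<kappa> x \<inter> ball w e = {}) \<F>"
    using K unfolding T.limitin_Grass_iff by blast+
  have pre: "{v\<in>V. \<theta> v \<in> L} \<in> Grass V" if "linear \<theta>" "L \<in> Grass W" for \<theta> L
    using subspace_inter[OF S.subspace_V linear_subspace_vimage[OF that(1)], of L] that(2)
    by (auto simp: Grass_def vimage_def Int_def)
  show ?thesis
    unfolding S.limitin_Grass_iff
  proof (intro conjI ballI allI impI)
    show "{v \<in> V. \<psi> v \<in> K} \<in> Grass V" by (rule pre[OF lin0 K'(1)])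
    show "eventually (\<lambda>x. {v \<in> V. \<phi> x v \<in> \<kappa> x} \<in> Grass V) \<F>"
      using K'(2) by eventually_elim (rule pre[OF lin])
  next
    fix w and e :: real assume w: "w \<in> {v \<in> V. \<psi> v \<in> K}" and e: "e > 0"
    have "W \<in> Grass W" using T.subspace_V by (simp add: Grass_def)
    then obtain d g where g: "g \<in> frames W d" "span (g ` {..<d}) = W" using T.Grass_frame by metis
    have gi: "lin_indep d g" using g by (simp add: in_frames_iff)
    obtain \<delta> m where \<delta>: "\<delta> > 0"
      "\<And>h. (\<And>i. i < d \<Longrightarrow> norm (h i - g i) < \<delta>) \<Longrightarrow> bounded_below m d h"
      using lin_indep_perturb[OF gi] by blast
    have m: "m > 0" using \<delta>(2)[of g] \<delta>(1) by (simp add: bounded_below_def)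
    \<comment> \<open>Transversality on a basis of \<open>W\<close>: every \<open>g i\<close> is
      \<open>\<psi> (a i)\<close> minus a vector of \<open>K\<close>.\<close>
    have "\<exists>a\<in>V. \<psi> a - g i \<in> K" if "i < d" for i
      using trans g(1) that by (auto simp: in_frames_iff)
    then obtain a where a: "\<And>i. i < d \<Longrightarrow> a i \<in> V" "\<And>i. i < d \<Longrightarrow> \<psi> (a i) - g i \<in> K"
      by metis
    define A where "A = (\<Sum>i<d. norm (a i)) + 1"
    have A: "A > 0" unfolding A_def by (rule add_nonneg_pos) (auto intro!: sum_nonneg)
    \<comment> \<open>Chosen so that the correction of \<open>w\<close> below has norm at most
      \<open>(\<eta> / m) * A = e / 2\<close>.\<close>
    define \<eta> where "\<eta> = e * m / (2 * A)"
    have \<eta>: "\<eta> > 0" using e m A by (simp add: \<eta>_def)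
    have ev1: "eventually (\<lambda>x. \<forall>i\<in>{..<d}. dist (\<phi> x (a i)) (\<psi> (a i)) < \<delta>/2) \<F>"
      using a \<delta>(1) by (intro eventually_ball_finite ballI tendstoD[OF lim]) auto
    have ev2: "eventually (\<lambda>x. \<forall>i\<in>{..<d}. \<kappa> x \<inter> ball (\<psi> (a i) - g i) (\<delta>/2) \<noteq> {}) \<F>"
      using a \<delta>(1) by (intro eventually_ball_finite ballI K'(3)) auto
    have ev3: "eventually (\<lambda>x. \<kappa> x \<inter> ball (\<psi> w) (\<eta>/2) \<noteq> {}) \<F>"
      using w \<eta> by (intro K'(3)) auto
    have ev4: "eventually (\<lambda>x. dist (\<phi> x w) (\<psi> w) < \<eta>/2) \<F>"
      using w \<eta> by (intro tendstoD[OF lim]) auto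
    show "eventually (\<lambda>x. {v \<in> V. \<phi> x v \<in> \<kappa> x} \<inter> ball w e \<noteq> {}) \<F>"
      using ev1 ev2 ev3 ev4 K'(2) into
    proof eventually_elim
      case (elim x)
      have Kx: "subspace (\<kappa> x)" "\<kappa> x \<subseteq> W" using elim(5) by (auto simp: Grass_def)
      have "\<forall>i<d. \<exists>k\<in>\<kappa> x. dist (\<psi> (a i) - g i) k < \<delta>/2" using elim(2) by fastforce
      then obtain k where k: "\<And>i. i < d \<Longrightarrow> k i \<in> \<kappa> x" "\<And>i. i < d \<Longrightarrow> dist (\<psi> (a i) - g i) (k i) < \<delta>/2"
        by metis
      \<comment> \<open>The perturbed basis of \<open>W\<close>: in the expression of
        \<open>g i\<close>, \<open>\<psi>\<close> is replaced by \<open>\<phi> x\<close> and the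
        vector of \<open>K\<close> by a nearby one of \<open>\<kappa> x\<close>.\<close>
      define h where "h = (\<lambda>i. \<phi> x (a i) - k i)"
      have hW: "h i \<in> W" if "i < d" for i
        unfolding h_def using elim(6) a(1) k(1) Kx(2) that by (intro subspace_diff[OF T.subspace_V]) auto
      have bh: "bounded_below m d h"
      proof (rule \<delta>(2))
        fix i assume i: "i < d"
        have "norm (h i - g i) = norm ((\<phi> x (a i) - \<psi> (a i)) + ((\<psi> (a i) - g i) - k i))"
          by (simp add: h_def algebra_simps)
        also have "\<dots> \<le> norm (\<phi> x (a i) - \<psi> (a i)) + norm ((\<psi> (a i) - g i) - k i)"
          by (rule norm_triangle_ineq)
        also have "\<dots> < \<delta>" using bspec[OF elim(1), of i] k(2)[OF i] i by (simp add: dist_norm)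
        finally show "norm (h i - g i) < \<delta>" .
      qed
      have "span (h ` {..<d}) = W"
        using span_eq_of_lin_indep[OF gi bounded_below_lin_indep[OF bh]] hW g(2) by simp
      moreover obtain u where u: "u \<in> \<kappa> x" "dist (\<psi> w) u < \<eta>/2" using elim(3) by auto
      have "\<phi> x w - u \<in> W"
        using elim(6) w u Kx by (intro subspace_diff[OF T.subspace_V]) auto
      ultimately obtain c where c: "\<phi> x w - u = lin_comb d h c" by (auto simp: span_lin_comb)
      have "norm (\<phi> x w - u) < \<eta>"
        using elim(4) u(2) dist_triangle_half_r[of "\<psi> w" "\<phi> x w" \<eta> u] by (simp add: dist_norm norm_minus_commute)
      moreover have "m * (\<Sum>i<d. \<bar>c i\<bar>) \<le> norm (\<phi> x w - u)" using bh by (simp add: c bounded_below_def)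
      ultimately have cs: "(\<Sum>i<d. \<bar>c i\<bar>) < \<eta> / m" using m by (simp add: field_simps)
      \<comment> \<open>The combination of the \<open>a i\<close> with the same coefficients cancels
        \<open>\<phi> x w - u\<close> modulo \<open>\<kappa> x\<close>, since
        \<open>\<phi> x (a i)\<close> and \<open>h i\<close> differ by \<open>k i\<close>.\<close>
      define v where "v = w - lin_comb d a c"
      have "v \<in> V" unfolding v_def
        using w a(1) S.subspace_V by (intro subspace_diff[OF S.subspace_V] subspace_lin_comb) auto
      moreover have "\<phi> x v = u - lin_comb d k c"
      proof -
        have "lin_comb d h c = lin_comb d (\<lambda>i. \<phi> x (a i)) c - lin_comb d k c"
          by (simp add: lin_comb_def h_def scaleR_diff_right sum_subtractf)
        then show ?thesis using c
          by (simp add: v_def linear_diff[OF lin] linear_lin_comb[OF lin] algebra_simps)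
      qed
      moreover have "u - lin_comb d k c \<in> \<kappa> x"
        using u k(1) Kx by (intro subspace_diff subspace_lin_comb) auto
      moreover have "dist w v < e"
      proof -
        have "dist w v = norm (lin_comb d a c)" by (simp add: v_def dist_norm)
        also have "\<dots> \<le> (\<Sum>i<d. \<bar>c i\<bar>) * (\<Sum>i<d. norm (a i))" by (rule norm_lin_comb_le)
        also have "\<dots> \<le> (\<Sum>i<d. \<bar>c i\<bar>) * A"
          by (intro mult_left_mono) (auto simp: A_def sum_nonneg)
        also have "\<dots> \<le> (\<eta> / m) * A" using cs A by (intro mult_right_mono) auto
        also have "\<dots> = e / 2" using m A by (simp add: \<eta>_def)
        finally show ?thesis using e by simp
      qed
      ultimately have "v \<in> {v \<in> V. \<phi> x v \<in> \<kappa> x} \<inter> ball w e" by simp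
      then show ?case by blast
    qed
  next
    fix w assume w: "w \<notin> {v \<in> V. \<psi> v \<in> K}"
    show "\<exists>e>0. eventually (\<lambda>x. {v \<in> V. \<phi> x v \<in> \<kappa> x} \<inter> ball w e = {}) \<F>"
    proof (cases "w \<in> V")
      case False
      then obtain e where "e > 0" "ball w e \<subseteq> - V"
        using openE[of "- V" w] S.closed_V by (auto simp: closed_def)
      then have "{v \<in> V. \<phi> x v \<in> \<kappa> x} \<inter> ball w e = {}" for x by blast
      then show ?thesis using \<open>e > 0\<close> by auto
    next
      case True
      then obtain \<epsilon> where \<epsilon>: "\<epsilon> > 0" "eventually (\<lambda>x. \<kappa> x \<inter> ball (\<psi> w) \<epsilon> = {}) \<F>"
        using K'(4)[of "\<psi> w"] w by blast
      \<comment> \<open>The distance \<open>\<epsilon>\<close> is split: one half for moving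
        \<open>w\<close> to \<open>v\<close> under \<open>\<phi> x\<close>, uniformly in
        \<open>x\<close>, the other for moving \<open>\<psi> w\<close> to
        \<open>\<phi> x w\<close>.\<close>
      obtain C where C: "C > 0" "eventually (\<lambda>x. \<forall>v\<in>V. norm (\<phi> x v) \<le> C * norm v) \<F>"
        using S.eventually_uniformly_bounded[OF lin lim] by blast
      have ev: "eventually (\<lambda>x. dist (\<phi> x w) (\<psi> w) < \<epsilon>/2) \<F>"
        using True \<epsilon>(1) by (intro tendstoD[OF lim]) auto
      have "eventually (\<lambda>x. {v \<in> V. \<phi> x v \<in> \<kappa> x} \<inter> ball w (\<epsilon> / (2 * C)) = {}) \<F>"
        using \<epsilon>(2) C(2) ev
      proof eventually_elim
        case (elim x)
        have "\<phi> x v \<notin> \<kappa> x" if v: "v \<in> V" "dist w v < \<epsilon> / (2 * C)" for v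
        proof -
          have "norm (\<phi> x (w - v)) \<le> C * norm (w - v)"
            using elim(2) subspace_diff[OF S.subspace_V True v(1)] by blast
          also have "\<dots> < C * (\<epsilon> / (2 * C))"
            using v(2) C(1) by (intro mult_strict_left_mono) (auto simp: dist_norm)
          also have "\<dots> = \<epsilon> / 2" using C(1) by simp
          finally have "dist (\<phi> x w) (\<phi> x v) < \<epsilon> / 2"
            by (simp add: dist_norm linear_diff[OF lin])
          then have "dist (\<psi> w) (\<phi> x v) < \<epsilon>"
            using elim(3) dist_triangle_half_r[of "\<phi> x w" "\<psi> w" \<epsilon> "\<phi> x v"] by simp
          then show ?thesis using elim(1) by auto
        qed
        then show ?case by auto
      qed
      then show ?thesis using \<epsilon>(1) C(1) by (intro exI[of _ "\<epsilon> / (2 * C)"]) auto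
    qed
  qed
qed


section \<open>The coordinate spaces R^I\<close>

lemma lookup_scaleR [simp]: "Poly_Mapping.lookup (a *\<^sub>R x) i = a *\<^sub>R Poly_Mapping.lookup x i"
proof -
  have "finite {i. a *\<^sub>R Poly_Mapping.lookup x i \<noteq> 0}"
    by (rule finite_subset[OF _ finite_lookup[of x]]) auto
  then show ?thesis by (simp add: scaleR_poly_mapping_def)
qed

lemma lookup_sum': "Poly_Mapping.lookup (\<Sum>i\<in>A. f i) k = (\<Sum>i\<in>A. Poly_Mapping.lookup (f i) k)"
  by (induction A rule: infinite_finite_induct) (auto simp: lookup_add)

lemma norm_poly_mapping: "norm x = (\<Sum>i\<in>Poly_Mapping.keys x. norm (Poly_Mapping.lookup x i))"
  by (simp add: norm_poly_mapping_def dist_poly_mapping_def)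

lemma norm_lookup_le: "norm (Poly_Mapping.lookup x i) \<le> norm x"
proof (cases "i \<in> Poly_Mapping.keys x")
  case True
  then show ?thesis unfolding norm_poly_mapping by (intro member_le_sum) auto
next
  case False
  then show ?thesis by (simp add: in_keys_iff)
qed

lemma bounded_linear_lookup: "bounded_linear (\<lambda>x. Poly_Mapping.lookup x i)"
  by (rule bounded_linear_intro[of _ 1]) (auto simp: lookup_add norm_lookup_le)

lemma in_coord_space: "v \<in> coord_space I \<longleftrightarrow> (\<forall>i. i \<notin> I \<longrightarrow> Poly_Mapping.lookup v i = 0)"
  by (auto simp: coord_space_def in_keys_iff)

definition coord_vec :: "'i set \<Rightarrow> ('i \<Rightarrow> real) \<Rightarrow> 'i \<Rightarrow>\<^sub>0 real"
  where "coord_vec I a = (\<Sum>i\<in>I. a i *\<^sub>R Poly_Mapping.single i 1)"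

lemma lookup_coord_vec: "finite I \<Longrightarrow> Poly_Mapping.lookup (coord_vec I a) i = (if i \<in> I then a i else 0)"
  by (simp add: coord_vec_def lookup_sum' lookup_single when_def if_distrib sum.delta cong: if_cong)

lemma coord_vec_in: "finite I \<Longrightarrow> coord_vec I a \<in> coord_space I"
  by (simp add: in_coord_space lookup_coord_vec)

lemma coord_vec_lookup: "finite I \<Longrightarrow> v \<in> coord_space I \<Longrightarrow> coord_vec I (Poly_Mapping.lookup v) = v"
  by (rule poly_mapping_eqI) (auto simp: lookup_coord_vec in_coord_space)

lemma coord_space_fin_dim:
  assumes "finite I"
  shows "fin_dim_space (coord_space I) ((\<lambda>i. Poly_Mapping.single i (1::real)) ` I)"
proof
  show "finite ((\<lambda>i. Poly_Mapping.single i (1::real)) ` I)" using assms by simp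
  have sub: "subspace (coord_space I)"
    by (auto simp: subspace_def in_coord_space lookup_add)
  show "coord_space I = span ((\<lambda>i. Poly_Mapping.single i (1::real)) ` I)"
  proof
    show "coord_space I \<subseteq> span ((\<lambda>i. Poly_Mapping.single i (1::real)) ` I)"
    proof
      fix v :: "'a \<Rightarrow>\<^sub>0 real" assume "v \<in> coord_space I"
      then have "v = coord_vec I (Poly_Mapping.lookup v)" using coord_vec_lookup[OF assms] by simp
      also have "\<dots> \<in> span ((\<lambda>i. Poly_Mapping.single i (1::real)) ` I)"
        unfolding coord_vec_def by (intro span_sum span_scale span_base) auto
      finally show "v \<in> span ((\<lambda>i. Poly_Mapping.single i (1::real)) ` I)" .
    qed
    show "span ((\<lambda>i. Poly_Mapping.single i (1::real)) ` I) \<subseteq> coord_space I"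
      by (intro span_minimal sub) (auto simp: in_coord_space lookup_single when_def)
  qed
qed

lemma tendsto_coord_vec:
  assumes "\<And>i. i \<in> I \<Longrightarrow> ((\<lambda>x. a x i) \<longlongrightarrow> b i) F"
  shows "((\<lambda>x. coord_vec I (a x)) \<longlongrightarrow> coord_vec I b) F"
  unfolding coord_vec_def using assms by (intro tendsto_intros) auto


section \<open>Smooth maps and bump functions\<close>

lemma Ck_on_subset: "Ck_on k V W f \<Longrightarrow> W' \<subseteq> W \<Longrightarrow> Ck_on k V W' f"
proof (induction k arbitrary: f)
  case 0 then show ?case by (auto intro: continuous_on_subset)
next
  case (Suc k) then show ?case by (auto 0 4)
qed

lemma Ck_on_SucD: "W \<subseteq> V \<Longrightarrow> Ck_on (Suc k) V W f \<Longrightarrow> Ck_on k V W f"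
proof (induction k arbitrary: f)
  case 0
  then obtain D where D: "\<And>x. x \<in> W \<Longrightarrow> (f has_derivative D x) (at x within V)" by auto
  have "continuous (at x within W) f" if "x \<in> W" for x
    using continuous_within_subset[OF has_derivative_continuous[OF D[OF that]] 0(1)] .
  then show ?case by (simp add: continuous_on_eq_continuous_within)
next
  case (Suc k)
  then obtain D where D: "\<forall>x\<in>W. (f has_derivative D x) (at x within V)"
    "\<forall>v\<in>V. Ck_on (Suc k) V W (\<lambda>x. D x v)" by auto
  then show ?case using Suc.IH[OF Suc.prems(1)] by auto
qed

lemma rel_open_ball:
  assumes "openin (top_of_set V) W" "x \<in> W"
  obtains e where "e > 0" "\<And>y. y \<in> V \<Longrightarrow> dist y x < e \<Longrightarrow> y \<in> W"
  using assms unfolding openin_euclidean_subtopology_iff by metis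

text \<open>The derivative is taken within \<open>V\<close>, so equality on \<open>W\<close>
  determines it because \<open>W\<close> is relatively open in \<open>V\<close>.\<close>

lemma Ck_on_cong:
  assumes "openin (top_of_set V) W" "\<And>x. x \<in> W \<Longrightarrow> f x = g x" "Ck_on k V W f"
  shows "Ck_on k V W g"
proof (cases k)
  case 0
  then show ?thesis using assms continuous_on_cong[of W W f g] by simp
next
  case (Suc j)
  then obtain D where D: "\<And>x. x \<in> W \<Longrightarrow> (f has_derivative D x) (at x within V)"
    "\<forall>v\<in>V. Ck_on j V W (\<lambda>x. D x v)" using assms(3) by auto
  have WV: "W \<subseteq> V" using openin_imp_subset[OF assms(1)] .
  have "(g has_derivative D x) (at x within V)" if x: "x \<in> W" for x
  proof -
    obtain e where "e > 0" "\<And>y. y \<in> V \<Longrightarrow> dist y x < e \<Longrightarrow> y \<in> W"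
      using rel_open_ball[OF assms(1) x] by blast
    then show ?thesis
      using has_derivative_transform_within[OF D(1)[OF x], of e g] assms(2) WV x by auto
  qed
  then show ?thesis using D(2) Suc by auto
qed

text \<open>The line through \<open>x\<close> in direction \<open>v\<close> stays in
  \<open>V\<close>; restriction to it reduces the claim to uniqueness of derivatives of functions of
  one real variable.\<close>

lemma has_derivative_within_subspace_unique:
  assumes V: "subspace V" "x \<in> V" "v \<in> V"
    and D: "(f has_derivative D) (at x within V)" "(f has_derivative D') (at x within V)"
  shows "D v = D' v"
proof -
  let ?l = "\<lambda>t::real. x + t *\<^sub>R v"
  have l: "(?l has_derivative (\<lambda>t. t *\<^sub>R v)) (at 0)" by (auto intro!: derivative_eq_intros)
  have r: "range ?l \<subseteq> V" using V by (auto intro: subspace_add subspace_scale)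
  have "((\<lambda>t. f (?l t)) has_vector_derivative D0 v) (at 0)"
    if "(f has_derivative D0) (at x within V)" for D0
  proof -
    have "((\<lambda>t. f (?l t)) has_derivative (\<lambda>t. D0 (t *\<^sub>R v))) (at 0)"
      by (rule has_derivative_in_compose[OF l]) (use that r in \<open>auto intro: has_derivative_subset\<close>)
    moreover have "linear D0" using has_derivative_linear[OF that] .
    ultimately show ?thesis by (simp add: has_vector_derivative_def linear_scale)
  qed
  then show ?thesis using D vector_derivative_unique_at by blast
qed

text \<open>The derivatives chosen on the two sets have to agree on the overlap in directions of
  \<open>V\<close> only, and there uniqueness forces it.\<close>

lemma Ck_on_union:
  assumes V: "subspace V" and W: "openin (top_of_set V) W1" "openin (top_of_set V) W2"
    and f: "Ck_on k V W1 f" "Ck_on k V W2 f"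
  shows "Ck_on k V (W1 \<union> W2) f"
  using f
proof (induction k arbitrary: f)
  case 0
  have "openin (top_of_set (W1 \<union> W2)) W1" "openin (top_of_set (W1 \<union> W2)) W2"
    using W openin_imp_subset by (metis openin_subset_trans Un_upper1 Un_upper2 Un_least)+
  then show ?case using 0 continuous_on_Un_local_open[of W1 W2 f] by simp
next
  case (Suc k)
  obtain D1 where D1: "\<And>x. x \<in> W1 \<Longrightarrow> (f has_derivative D1 x) (at x within V)"
    "\<And>v. v \<in> V \<Longrightarrow> Ck_on k V W1 (\<lambda>x. D1 x v)" using Suc.prems(1) by auto
  obtain D2 where D2: "\<And>x. x \<in> W2 \<Longrightarrow> (f has_derivative D2 x) (at x within V)"
    "\<And>v. v \<in> V \<Longrightarrow> Ck_on k V W2 (\<lambda>x. D2 x v)" using Suc.prems(2) by auto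
  define D where "D = (\<lambda>x. if x \<in> W1 then D1 x else D2 x)"
  have "(f has_derivative D x) (at x within V)" if "x \<in> W1 \<union> W2" for x
    using that D1(1) D2(1) by (auto simp: D_def)
  moreover have "Ck_on k V (W1 \<union> W2) (\<lambda>x. D x v)" if v: "v \<in> V" for v
  proof (rule Suc.IH)
    show "Ck_on k V W1 (\<lambda>x. D x v)"
      by (rule Ck_on_cong[OF W(1) _ D1(2)[OF v]]) (simp add: D_def)
    show "Ck_on k V W2 (\<lambda>x. D x v)"
    proof (rule Ck_on_cong[OF W(2) _ D2(2)[OF v]])
      fix x assume x: "x \<in> W2"
      then have "x \<in> V" using openin_imp_subset[OF W(2)] by auto
      then show "D2 x v = D x v"
        using has_derivative_within_subspace_unique[OF V _ v D2(1)[OF x] D1(1)] by (auto simp: D_def)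
    qed
  qed
  ultimately show ?case by auto
qed

lemma Ck_on_const: "Ck_on k V W (\<lambda>x. c)"
proof (induction k arbitrary: c)
  case (Suc k)
  then show ?case by (auto intro!: exI[of _ "\<lambda>_ _. 0"])
qed simp

lemma Ck_on_add: "Ck_on k V W f \<Longrightarrow> Ck_on k V W g \<Longrightarrow> Ck_on k V W (\<lambda>x. f x + g x)"
proof (induction k arbitrary: f g)
  case 0 then show ?case by (auto intro: continuous_on_add)
next
  case (Suc k)
  obtain D1 where D1: "\<And>x. x \<in> W \<Longrightarrow> (f has_derivative D1 x) (at x within V)"
    "\<And>v. v \<in> V \<Longrightarrow> Ck_on k V W (\<lambda>x. D1 x v)" using Suc.prems(1) by auto
  obtain D2 where D2: "\<And>x. x \<in> W \<Longrightarrow> (g has_derivative D2 x) (at x within V)"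
    "\<And>v. v \<in> V \<Longrightarrow> Ck_on k V W (\<lambda>x. D2 x v)" using Suc.prems(2) by auto
  show ?case unfolding Ck_on.simps
    by (intro exI[of _ "\<lambda>x v. D1 x v + D2 x v"] conjI ballI has_derivative_add D1 D2 Suc.IH)
qed

text \<open>In the Leibniz rule the undifferentiated factors recur, so \<open>Ck_on_SucD\<close>
  lowers their order for the induction.\<close>

lemma Ck_on_scaleR:
  assumes "W \<subseteq> V"
  shows "Ck_on k V W f \<Longrightarrow> Ck_on k V W g \<Longrightarrow> Ck_on k V W (\<lambda>x. f x *\<^sub>R g x)"
proof (induction k arbitrary: f g)
  case 0 then show ?case by (auto intro: continuous_on_scaleR)
next
  case (Suc k)
  obtain D1 where D1: "\<And>x. x \<in> W \<Longrightarrow> (f has_derivative D1 x) (at x within V)"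
    "\<And>v. v \<in> V \<Longrightarrow> Ck_on k V W (\<lambda>x. D1 x v)" using Suc.prems(1) by auto
  obtain D2 where D2: "\<And>x. x \<in> W \<Longrightarrow> (g has_derivative D2 x) (at x within V)"
    "\<And>v. v \<in> V \<Longrightarrow> Ck_on k V W (\<lambda>x. D2 x v)" using Suc.prems(2) by auto
  show ?case unfolding Ck_on.simps
    by (intro exI[of _ "\<lambda>x v. f x *\<^sub>R D2 x v + D1 x v *\<^sub>R g x"] conjI ballI has_derivative_scaleR
      D1 D2 Ck_on_add Suc.IH Ck_on_SucD[OF assms Suc.prems(1)] Ck_on_SucD[OF assms Suc.prems(2)])
qed

lemma Ck_on_bounded_linear:
  assumes L: "bounded_linear L"
  shows "Ck_on k V W f \<Longrightarrow> Ck_on k V W (\<lambda>x. L (f x))"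
proof (induction k arbitrary: f)
  case 0 then show ?case using bounded_linear.continuous_on[OF L] by auto
next
  case (Suc k)
  obtain D1 where D1: "\<And>x. x \<in> W \<Longrightarrow> (f has_derivative D1 x) (at x within V)"
    "\<And>v. v \<in> V \<Longrightarrow> Ck_on k V W (\<lambda>x. D1 x v)" using Suc.prems(1) by auto
  show ?case unfolding Ck_on.simps
    by (intro exI[of _ "\<lambda>x v. L (D1 x v)"] conjI ballI bounded_linear.has_derivative[OF L] D1 Suc.IH)
qed

lemma Ck_on_prod:
  fixes f :: "'i \<Rightarrow> 'a::real_normed_vector \<Rightarrow> real"
  assumes "W \<subseteq> V" "\<And>i. i \<in> A \<Longrightarrow> Ck_on k V W (f i)"
  shows "Ck_on k V W (\<lambda>x. \<Prod>i\<in>A. f i x)"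
  using assms(2)
proof (induction A rule: infinite_finite_induct)
  case (insert i A)
  have "Ck_on k V W (\<lambda>x. f i x *\<^sub>R (\<Prod>i\<in>A. f i x))"
    using insert by (intro Ck_on_scaleR[OF assms(1)]) auto
  then show ?case using insert by simp
qed (simp_all add: Ck_on_const)

text \<open>The functions \<open>P(1/y) e\<^sup>-\<^sup>1\<^sup>/\<^sup>y\<close> extended by 0 form a class closed under derivatives.\<close>

definition flat :: "real poly \<Rightarrow> real \<Rightarrow> real"
  where "flat P y = (if y > 0 then poly P (1 / y) * exp (- (1 / y)) else 0)"

text \<open>The chain rule in the variable x = 1/y: differentiation in y multiplies by x^2 and turns
  P(x) e^(-x) into (P(x) - P'(x)) e^(-x).\<close>

definition flat_deriv :: "real poly \<Rightarrow> real poly"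
  where "flat_deriv P = [:0, 0, 1:] * (P - pderiv P)"

lemma poly_exp_tendsto_0: "((\<lambda>y::real. poly P y * exp (- y)) \<longlongrightarrow> 0) at_top"
proof -
  have "((\<lambda>y. \<Sum>i\<le>degree P. coeff P i * (y ^ i / exp y)) \<longlongrightarrow> (\<Sum>i\<le>degree P. coeff P i * 0)) at_top"
    by (intro tendsto_intros tendsto_power_div_exp_0)
  then show ?thesis
    by (simp add: poly_altdef sum_distrib_right exp_minus divide_inverse mult.assoc)
qed

lemma flat_has_derivative: "(flat P has_real_derivative flat (flat_deriv P) y) (at y)"
proof -
  consider "y > 0" | "y < 0" | "y = 0" by linarith
  then show ?thesis
  proof cases
    case 1
    have "((\<lambda>y. poly P (1 / y) * exp (- (1 / y))) has_real_derivative flat (flat_deriv P) y) (at y)"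
      using 1 by (auto intro!: derivative_eq_intros DERIV_chain'[where g = "poly P"] poly_DERIV
        simp: flat_def flat_deriv_def field_simps power2_eq_square)
    then show ?thesis
      by (rule has_field_derivative_transform_within_open[of _ _ _ "{0<..}"])
        (use 1 in \<open>auto simp: flat_def\<close>)
  next
    case 2
    have "((\<lambda>y. 0) has_real_derivative flat (flat_deriv P) y) (at y)"
      using 2 by (simp add: flat_def)
    then show ?thesis
      by (rule has_field_derivative_transform_within_open[of _ _ _ "{..<0}"])
        (use 2 in \<open>auto simp: flat_def\<close>)
  next
    case 3
    \<comment> \<open>At 0 only the right-hand difference quotient matters; with x = 1/h it becomes
      x P(x) e^(-x), which tends to 0 at infinity.\<close>
    have "((\<lambda>h. flat P h / h) \<longlongrightarrow> 0) (at 0)"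
    proof (rule filterlim_split_at)
      have "eventually (\<lambda>h::real. h < 0) (at_left 0)" by (simp add: eventually_at_filter)
      then have "eventually (\<lambda>h::real. flat P h / h = 0) (at_left 0)"
        by eventually_elim (simp add: flat_def)
      then show "((\<lambda>h. flat P h / h) \<longlongrightarrow> 0) (at_left 0)" by (rule tendsto_eventually)
      have "eventually (\<lambda>x::real. flat P (inverse x) / inverse x = poly ([:0, 1:] * P) x * exp (- x)) at_top"
        using eventually_gt_at_top[of 0] by eventually_elim (simp add: flat_def field_simps)
      then show "((\<lambda>h. flat P h / h) \<longlongrightarrow> 0) (at_right 0)"
        unfolding filterlim_at_right_to_top
        using poly_exp_tendsto_0[of "[:0, 1:] * P"] tendsto_cong by fast
    qed
    then show ?thesis using 3 by (simp add: has_field_derivative_iff flat_def)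
  qed
qed

text \<open>The derivative of \<open>flat P\<close> is of the same form with another polynomial, so
  the induction must run over all \<open>P\<close> at once.\<close>

lemma Ck_on_flat:
  assumes "W \<subseteq> V"
  shows "Ck_on k V W u \<Longrightarrow> Ck_on k V W (\<lambda>x. flat P (u x))"
proof (induction k arbitrary: P u)
  case 0
  have "continuous_on UNIV (flat P)"
    by (rule DERIV_continuous_on[of _ _ "flat (flat_deriv P)"]) (rule has_field_derivative_at_within[OF flat_has_derivative])
  then show ?case using 0 continuous_on_compose2[of UNIV "flat P" W u] by simp
next
  case (Suc k)
  obtain D where D: "\<And>x. x \<in> W \<Longrightarrow> (u has_derivative D x) (at x within V)"
    "\<And>v. v \<in> V \<Longrightarrow> Ck_on k V W (\<lambda>x. D x v)" using Suc.prems(1) by auto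
  have "((\<lambda>x. flat P (u x)) has_derivative (\<lambda>v. flat (flat_deriv P) (u x) *\<^sub>R D x v)) (at x within V)"
    if "x \<in> W" for x
    using has_derivative_compose[OF D(1)[OF that] flat_has_derivative[unfolded has_field_derivative_def]]
    by simp
  moreover have "Ck_on k V W (\<lambda>x. flat (flat_deriv P) (u x) *\<^sub>R D x v)" if "v \<in> V" for v
    by (intro Ck_on_scaleR[OF assms] Suc.IH Ck_on_SucD[OF assms Suc.prems] D(2) that)
  ultimately show ?case unfolding Ck_on.simps
    by (intro exI[of _ "\<lambda>x v. flat (flat_deriv P) (u x) *\<^sub>R D x v"]) simp
qed

text \<open>Each pair of factors is nonzero exactly where the coordinate differs from that of
  \<open>x0\<close> by less than \<open>\<delta>\<close>; the product is thus supported in a cube.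
  Normalization to 1 at \<open>x0\<close> is left to the use on manifolds.\<close>

definition coord_bump :: "nat \<Rightarrow> real \<Rightarrow> (nat \<Rightarrow>\<^sub>0 real) \<Rightarrow> (nat \<Rightarrow>\<^sub>0 real) \<Rightarrow> real"
  where "coord_bump d \<delta> x0 x = (\<Prod>i<d.
    flat 1 (\<delta> + (Poly_Mapping.lookup x i - Poly_Mapping.lookup x0 i)) *
    flat 1 (\<delta> - (Poly_Mapping.lookup x i - Poly_Mapping.lookup x0 i)))"

lemma flat_1_pos: "flat 1 y \<noteq> 0 \<longleftrightarrow> y > 0"
  by (simp add: flat_def)

text \<open>The norm is the l1 norm, so the cube of half-side \<open>\<delta>\<close> lies in the
  ball of radius \<open>d * \<delta>\<close>.\<close>

lemma coord_bump_nz: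
  assumes "coord_bump d \<delta> x0 x \<noteq> 0" "x0 \<in> Rn d" "x \<in> Rn d"
  shows "norm (x - x0) \<le> d * \<delta>"
proof -
  have "\<bar>Poly_Mapping.lookup (x - x0) i\<bar> < \<delta>" if "i < d" for i
  proof -
    have "flat 1 (\<delta> + Poly_Mapping.lookup (x - x0) i) \<noteq> 0" "flat 1 (\<delta> - Poly_Mapping.lookup (x - x0) i) \<noteq> 0"
      using assms(1) that by (auto simp: coord_bump_def lookup_minus)
    then show ?thesis unfolding flat_1_pos by linarith
  qed
  then have le: "\<bar>Poly_Mapping.lookup (x - x0) i\<bar> \<le> \<delta>" if "i < d" for i using that less_imp_le by blast
  have keys: "Poly_Mapping.keys (x - x0) \<subseteq> {..<d}"
    using assms(2,3) keys_diff[of x x0] by (auto simp: coord_space_def)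
  have "norm (x - x0) = (\<Sum>i\<in>Poly_Mapping.keys (x - x0). \<bar>Poly_Mapping.lookup (x - x0) i\<bar>)"
    by (simp add: norm_poly_mapping)
  also have "\<dots> \<le> (\<Sum>i<d. \<bar>Poly_Mapping.lookup (x - x0) i\<bar>)"
    by (rule sum_mono2) (use keys in auto)
  also have "\<dots> \<le> (\<Sum>i<d. \<delta>)" by (rule sum_mono) (use le in auto)
  finally show ?thesis by simp
qed

lemma coord_bump_pos: "\<delta> > 0 \<Longrightarrow> coord_bump d \<delta> x0 x0 \<noteq> 0"
  by (simp add: coord_bump_def flat_1_pos)

lemma Ck_on_coord_bump:
  assumes "W \<subseteq> V" "Ck_on k V W u"
  shows "Ck_on k V W (\<lambda>x. coord_bump d \<delta> x0 (u x))"
proof -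
  have l: "Ck_on k V W (\<lambda>x. Poly_Mapping.lookup (u x) i)" for i
    by (rule Ck_on_bounded_linear[OF bounded_linear_lookup assms(2)])
  \<comment> \<open>The values \<open>s = 1\<close> and \<open>s = -1\<close> give the two factors
    belonging to a coordinate.\<close>
  have "Ck_on k V W (\<lambda>x. flat 1 (\<delta> + s *\<^sub>R (Poly_Mapping.lookup (u x) i - Poly_Mapping.lookup x0 i)))" for i s
    unfolding diff_conv_add_uminus
    by (intro Ck_on_flat[OF assms(1)] Ck_on_add Ck_on_const Ck_on_scaleR[OF assms(1)] l)
  from this[of 1] this[of "-1"]
  have "Ck_on k V W (\<lambda>x. flat 1 (\<delta> + (Poly_Mapping.lookup (u x) i - Poly_Mapping.lookup x0 i)) *\<^sub>R
    flat 1 (\<delta> - (Poly_Mapping.lookup (u x) i - Poly_Mapping.lookup x0 i)))" for i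
    by (intro Ck_on_scaleR[OF assms(1)]) (simp_all add: algebra_simps)
  then show ?thesis
    unfolding coord_bump_def by (intro Ck_on_prod[OF assms(1)]) simp
qed

lemma subspace_coord_space: "subspace (coord_space I)"
  by (auto simp: subspace_def in_coord_space lookup_add)

section \<open>Manifolds: smooth functions, coordinate balls, bump functions\<close>

locale manifold =
  fixes M :: "'p manifold"
  assumes smooth_manifold: "smooth_manifold M"
begin

abbreviation T :: "'p topology" where "T \<equiv> mtop M"

lemma Hausdorff_T: "Hausdorff_space T"
  using smooth_manifold by (simp add: smooth_manifold_def)

lemma chart: "c \<in> atlas M \<Longrightarrow> is_chart T c"
  using smooth_manifold by (simp add: smooth_manifold_def)

lemma chart_open: "c \<in> atlas M \<Longrightarrow> openin T (chart_dom c)"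
  using chart by (auto simp: is_chart_def)

lemma point_chart: "p \<in> topspace T \<Longrightarrow> \<exists>c\<in>atlas M. p \<in> chart_dom c"
  using smooth_manifold by (simp add: smooth_manifold_def)

lemma chart_homeo:
  assumes "c \<in> atlas M"
  shows "homeomorphic_map (subtopology T (chart_dom c)) (top_of_set (chart_map c ` chart_dom c)) (chart_map c)"
  using chart[OF assms] by (simp add: is_chart_def)

lemma topspace_chart: "c \<in> atlas M \<Longrightarrow> topspace (subtopology T (chart_dom c)) = chart_dom c"
  using openin_subset[OF chart_open] by auto

lemma chart_inj: "c \<in> atlas M \<Longrightarrow> inj_on (chart_map c) (chart_dom c)"
  using chart_homeo[of c] topspace_chart[of c] homeomorphic_imp_injective_map by fastforce

lemma chart_inv: "c \<in> atlas M \<Longrightarrow> q \<in> chart_dom c \<Longrightarrow> chart_inv c (chart_map c q) = q"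
  using chart_inj by (simp add: chart_inv_def)

lemma chart_range: "c \<in> atlas M \<Longrightarrow> chart_map c ` chart_dom c \<subseteq> Rn (chart_dim c)"
  using chart[of c] openin_imp_subset unfolding is_chart_def by metis

lemma chart_image_open:
  assumes c: "c \<in> atlas M" and W: "openin T W"
  shows "openin (top_of_set (Rn (chart_dim c))) (chart_map c ` (chart_dom c \<inter> W))"
proof -
  have "openin (subtopology T (chart_dom c)) (chart_dom c \<inter> W)"
    using W by (metis inf_commute openin_subtopology_Int)
  then have "openin (top_of_set (chart_map c ` chart_dom c)) (chart_map c ` (chart_dom c \<inter> W))"
    using homeomorphic_imp_open_map[OF chart_homeo[OF c]] by (simp add: open_map_def)
  then show ?thesis using chart[OF c] openin_trans by (auto simp: is_chart_def)
qed

lemma smooth_map_iff: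
  "smooth_map M W f \<longleftrightarrow> (\<forall>c\<in>atlas M. \<forall>k. Ck_on k (Rn (chart_dim c)) (chart_map c ` (chart_dom c \<inter> W)) (f \<circ> chart_inv c))"
  by (simp add: smooth_map_def smooth_on_def)

lemma chart_image_subset: "c \<in> atlas M \<Longrightarrow> chart_map c ` (chart_dom c \<inter> W) \<subseteq> Rn (chart_dim c)"
  using chart_range[of c] by auto

lemma smooth_map_subset: "smooth_map M W f \<Longrightarrow> W' \<subseteq> W \<Longrightarrow> smooth_map M W' f"
  unfolding smooth_map_iff by (meson Ck_on_subset Int_mono image_mono subset_refl)

lemma smooth_map_cong:
  assumes "openin T W" "\<And>q. q \<in> W \<Longrightarrow> f q = g q" "smooth_map M W f"
  shows "smooth_map M W g"
  unfolding smooth_map_iff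
proof (intro ballI allI)
  fix c k assume c: "c \<in> atlas M"
  show "Ck_on k (Rn (chart_dim c)) (chart_map c ` (chart_dom c \<inter> W)) (g \<circ> chart_inv c)"
    by (rule Ck_on_cong[OF chart_image_open[OF c assms(1)], of "f \<circ> chart_inv c"])
      (use assms(2,3) c in \<open>auto simp: smooth_map_iff chart_inv\<close>)
qed

lemma smooth_map_union:
  assumes "openin T W1" "openin T W2" "smooth_map M W1 f" "smooth_map M W2 f"
  shows "smooth_map M (W1 \<union> W2) f"
  using assms unfolding smooth_map_iff Int_Un_distrib image_Un
  by (intro ballI allI Ck_on_union[OF subspace_coord_space] chart_image_open) auto

lemma smooth_map_const: "smooth_map M W (\<lambda>_. c)"
  by (simp add: smooth_map_iff comp_def Ck_on_const)

lemma smooth_map_add: "smooth_map M W f \<Longrightarrow> smooth_map M W g \<Longrightarrow> smooth_map M W (\<lambda>q. f q + g q)"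
  by (simp add: smooth_map_iff comp_def Ck_on_add)

lemma smooth_map_scaleR:
  "smooth_map M W f \<Longrightarrow> smooth_map M W g \<Longrightarrow> smooth_map M W (\<lambda>q. f q *\<^sub>R g q)"
  by (simp add: smooth_map_iff comp_def Ck_on_scaleR chart_image_subset)

lemma smooth_map_diff:
  fixes f :: "'p \<Rightarrow> 'b::real_normed_vector"
  assumes "smooth_map M W f" "smooth_map M W g"
  shows "smooth_map M W (\<lambda>q. f q - g q)"
  using smooth_map_add[OF assms(1) smooth_map_scaleR[OF smooth_map_const[of _ "-1"] assms(2)]] by simp

lemma smooth_map_sum:
  "(\<And>i. i \<in> A \<Longrightarrow> smooth_map M W (f i)) \<Longrightarrow> smooth_map M W (\<lambda>q. \<Sum>i\<in>A. f i q)"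
  by (induction A rule: infinite_finite_induct) (auto intro: smooth_map_const smooth_map_add)

text \<open>Smoothness gives continuity in a chart around \<open>p\<close>, and the chart map
  carries the convergence of \<open>\<pi>\<close> into that chart.\<close>

lemma smooth_map_tendsto:
  assumes U: "openin T U" "p \<in> U" and f: "smooth_map M U f" and \<pi>: "limitin T \<pi> p \<F>"
  shows "((\<lambda>x. f (\<pi> x)) \<longlongrightarrow> f p) \<F>"
proof -
  have "p \<in> topspace T" using U openin_subset by blast
  then obtain c where c: "c \<in> atlas M" "p \<in> chart_dom c" using point_chart by blast
  have ev: "eventually (\<lambda>x. \<pi> x \<in> chart_dom c \<inter> U) \<F>"
    using limitinD[OF \<pi> openin_Int[OF chart_open[OF c(1)] U(1)]] c(2) U(2) by blast
  have "limitin (subtopology T (chart_dom c)) \<pi> p \<F>"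
    using \<pi> c(2) ev by (auto simp: limitin_subtopology elim: eventually_mono)
  then have "limitin (top_of_set (chart_map c ` chart_dom c)) (chart_map c \<circ> \<pi>) (chart_map c p) \<F>"
    by (rule continuous_map_limit[OF homeomorphic_imp_continuous_map[OF chart_homeo[OF c(1)]]])
  then have lim: "((\<lambda>x. chart_map c (\<pi> x)) \<longlongrightarrow> chart_map c p) \<F>"
    by (simp add: limitin_subtopology comp_def)
  have "continuous_on (chart_map c ` (chart_dom c \<inter> U)) (f \<circ> chart_inv c)"
    using f[unfolded smooth_map_iff, rule_format, OF c(1), of 0] by simp
  then have "((\<lambda>x. (f \<circ> chart_inv c) (chart_map c (\<pi> x))) \<longlongrightarrow> (f \<circ> chart_inv c) (chart_map c p)) \<F>"
    by (rule continuous_on_tendsto_compose[OF _ lim])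
      (use c(2) U(2) ev in \<open>auto elim: eventually_mono\<close>)
  then have "((\<lambda>x. (f \<circ> chart_inv c) (chart_map c (\<pi> x))) \<longlongrightarrow> f p) \<F>"
    using c by (simp add: chart_inv)
  moreover have "eventually (\<lambda>x. (f \<circ> chart_inv c) (chart_map c (\<pi> x)) = f (\<pi> x)) \<F>"
    using ev by eventually_elim (use c(1) in \<open>simp add: chart_inv\<close>)
  ultimately show ?thesis using tendsto_cong by fast
qed

lemma chart_ball:
  assumes U: "openin T U" "p \<in> U"
  obtains c r where "c \<in> atlas M" "p \<in> chart_dom c" "r > 0"
    "compactin T {q \<in> chart_dom c. norm (chart_map c q - chart_map c p) \<le> r}"
    "{q \<in> chart_dom c. norm (chart_map c q - chart_map c p) \<le> r} \<subseteq> U"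
    "openin T {q \<in> chart_dom c. norm (chart_map c q - chart_map c p) < r}"
proof -
  have "p \<in> topspace T" using U openin_subset by blast
  then obtain c where c: "c \<in> atlas M" "p \<in> chart_dom c" using point_chart by blast
  have "openin (top_of_set (Rn (chart_dim c))) (chart_map c ` (chart_dom c \<inter> U))"
    by (rule chart_image_open[OF c(1) U(1)])
  then obtain e where e: "e > 0" "\<And>y. y \<in> Rn (chart_dim c) \<Longrightarrow> dist y (chart_map c p) < e \<Longrightarrow> y \<in> chart_map c ` (chart_dom c \<inter> U)"
    using rel_open_ball[of _ _ "chart_map c p"] c(2) U(2) by blast
  \<comment> \<open>Halved so that the closed coordinate ball stays inside the open one of radius
    \<open>e\<close>.\<close>
  define r where "r = e / 2"
  have r: "r > 0" "r < e" using e(1) by (auto simp: r_def)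
  let ?K = "{q \<in> chart_dom c. norm (chart_map c q - chart_map c p) \<le> r}"
  let ?C = "{x \<in> Rn (chart_dim c). norm (x - chart_map c p) \<le> r}"
  have img: "?C \<subseteq> chart_map c ` (chart_dom c \<inter> U)"
    using e(2) r by (auto simp: dist_norm)
  have KC: "chart_map c ` ?K = ?C"
    using img chart_range[OF c(1)] by auto
  have KU: "?K \<subseteq> U"
  proof
    fix q assume q: "q \<in> ?K"
    then have "chart_map c q \<in> chart_map c ` (chart_dom c \<inter> U)" using KC img by blast
    then obtain q' where q': "q' \<in> chart_dom c \<inter> U" "chart_map c q = chart_map c q'" by blast
    then have "q = q'" using q inj_onD[OF chart_inj[OF c(1)], of q q'] by auto
    then show "q \<in> U" using q' by simp
  qed
  interpret R: fin_dim_space "Rn (chart_dim c)" "(\<lambda>i. Poly_Mapping.single i 1) ` {..<chart_dim c}"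
    by (rule coord_space_fin_dim) simp
  \<comment> \<open>A ball around 0 in the subspace, cut by a closed ball, because
    \<open>compact_cball_V\<close> is centred at 0.\<close>
  have "?C = (Rn (chart_dim c) \<inter> cball 0 (norm (chart_map c p) + r)) \<inter> cball (chart_map c p) r"
  proof -
    have "norm x \<le> norm (chart_map c p) + r" if "norm (x - chart_map c p) \<le> r" for x
      using norm_triangle_sub[of x "chart_map c p"] that by linarith
    then show ?thesis by (auto simp: dist_norm norm_minus_commute)
  qed
  then have "compact ?C"
    using compact_Int_closed[OF R.compact_cball_V closed_cball] by metis
  then have "compactin (top_of_set (chart_map c ` chart_dom c)) (chart_map c ` ?K)"
    unfolding KC using img by (auto simp: compactin_subtopology)
  then have "compactin (subtopology T (chart_dom c)) ?K"
    using homeomorphic_map_compactness[OF chart_homeo[OF c(1)], of ?K] topspace_chart[OF c(1)] by auto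
  then have "compactin T ?K" by (simp add: compactin_subtopology)
  moreover have "openin T {q \<in> chart_dom c. norm (chart_map c q - chart_map c p) < r}"
  proof -
    have "openin (subtopology T (chart_dom c)) {q \<in> topspace (subtopology T (chart_dom c)).
        chart_map c q \<in> chart_map c ` chart_dom c \<inter> ball (chart_map c p) r}"
      by (rule openin_continuous_map_preimage[OF homeomorphic_imp_continuous_map[OF chart_homeo[OF c(1)]]])
        (simp add: openin_open_Int)
    moreover have "{q \<in> topspace (subtopology T (chart_dom c)).
        chart_map c q \<in> chart_map c ` chart_dom c \<inter> ball (chart_map c p) r}
      = {q \<in> chart_dom c. norm (chart_map c q - chart_map c p) < r}"
      unfolding topspace_chart[OF c(1)] by (auto simp: dist_norm norm_minus_commute)
    ultimately show ?thesis
      using openin_trans_full[OF _ chart_open[OF c(1)]] by metis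
  qed
  ultimately show ?thesis using that[OF c r(1)] KU by blast
qed

lemma locally_compact_T: "locally_compact_space T"
  unfolding locally_compact_space_def
proof
  fix p assume p: "p \<in> topspace T"
  obtain c r where "c \<in> atlas M" "p \<in> chart_dom c" "r > 0"
    "compactin T {q \<in> chart_dom c. norm (chart_map c q - chart_map c p) \<le> r}"
    "openin T {q \<in> chart_dom c. norm (chart_map c q - chart_map c p) < r}"
    by (rule chart_ball[OF openin_topspace p]) (rule that; assumption)
  then show "\<exists>U K. openin T U \<and> compactin T K \<and> p \<in> U \<and> U \<subseteq> K"
    by (intro exI[of _ "{q \<in> chart_dom c. norm (chart_map c q - chart_map c p) < r}"]
      exI[of _ "{q \<in> chart_dom c. norm (chart_map c q - chart_map c p) \<le> r}"]) auto
qed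

lemma first_countable_T: "first_countable T"
  unfolding first_countable_def
proof
  fix p assume "p \<in> topspace T"
  then obtain c where c: "c \<in> atlas M" "p \<in> chart_dom c" using point_chart by blast
  have "subtopology T (chart_dom c) homeomorphic_space top_of_set (chart_map c ` chart_dom c)"
    using chart_homeo[OF c(1)] homeomorphic_map_imp_homeomorphic_space by blast
  then have "first_countable (subtopology T (chart_dom c))"
    using homeomorphic_space_first_countability metrizable_imp_first_countable
      metrizable_space_subtopology metrizable_space_euclidean by blast
  then obtain B where B: "countable B" "\<forall>V\<in>B. openin (subtopology T (chart_dom c)) V"
    "\<And>U. openin (subtopology T (chart_dom c)) U \<Longrightarrow> p \<in> U \<Longrightarrow> \<exists>V\<in>B. p \<in> V \<and> V \<subseteq> U"
    unfolding first_countable_def using c topspace_chart[OF c(1)] by metis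
  have "\<exists>V\<in>B. p \<in> V \<and> V \<subseteq> U" if "openin T U" "p \<in> U" for U
  proof -
    have "openin (subtopology T (chart_dom c)) (chart_dom c \<inter> U)"
      using that(1) by (metis inf_commute openin_subtopology_Int)
    then show ?thesis using B(3)[of "chart_dom c \<inter> U"] c(2) that(2) by blast
  qed
  then show "\<exists>\<B>. countable \<B> \<and> (\<forall>V\<in>\<B>. openin T V) \<and> (\<forall>U. openin T U \<and> p \<in> U \<longrightarrow> (\<exists>V\<in>\<B>. p \<in> V \<and> V \<subseteq> U))"
    using B(1,2) openin_trans_full[OF _ chart_open[OF c(1)]] by blast
qed

text \<open>A coordinate bump extended by 0. The extension is smooth because the coordinate ball
  \<open>K\<close> is compact, hence closed in the Hausdorff space, so that the open sets
  \<open>chart_dom c\<close> and the complement of \<open>K\<close> cover the manifold.\<close>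

lemma bump_function:
  assumes U: "openin T U" "p \<in> U"
  obtains \<zeta> :: "'p \<Rightarrow> real" and K where "smooth_map M (topspace T) \<zeta>" "\<zeta> p = 1"
    "closedin T K" "K \<subseteq> U" "\<And>q. q \<notin> K \<Longrightarrow> \<zeta> q = 0"
proof -
  obtain c r where c: "c \<in> atlas M" "p \<in> chart_dom c" "r > 0"
    "compactin T {q \<in> chart_dom c. norm (chart_map c q - chart_map c p) \<le> r}"
    "{q \<in> chart_dom c. norm (chart_map c q - chart_map c p) \<le> r} \<subseteq> U"
    by (rule chart_ball[OF U]) (rule that; assumption)
  define K where "K = {q \<in> chart_dom c. norm (chart_map c q - chart_map c p) \<le> r}"
  \<comment> \<open>A cube of this half-side lies in the l1 ball of radius \<open>r\<close>; the
    added 1 covers dimension 0.\<close>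
  define \<delta> where "\<delta> = r / (real (chart_dim c) + 1)"
  have \<delta>: "\<delta> > 0" "real (chart_dim c) * \<delta> \<le> r" using c(3) by (auto simp: \<delta>_def field_simps)
  define \<psi> where "\<psi> = (\<lambda>x. coord_bump (chart_dim c) \<delta> (chart_map c p) x)"
  have \<psi>p: "\<psi> (chart_map c p) \<noteq> 0" using coord_bump_pos[OF \<delta>(1)] by (simp add: \<psi>_def)
  define \<zeta> where "\<zeta> = (\<lambda>q. if q \<in> chart_dom c then (1 / \<psi> (chart_map c p)) *\<^sub>R \<psi> (chart_map c q) else 0)"
  have K: "closedin T K" using c(4) compactin_imp_closedin[OF Hausdorff_T] by (simp add: K_def)
  have z: "\<zeta> q = 0" if "q \<notin> K" for q
  proof (rule ccontr)
    assume "\<zeta> q \<noteq> 0"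
    then have q: "q \<in> chart_dom c" "\<psi> (chart_map c q) \<noteq> 0" by (auto simp: \<zeta>_def split: if_splits)
    have "norm (chart_map c q - chart_map c p) \<le> real (chart_dim c) * \<delta>"
      using coord_bump_nz q chart_range[OF c(1)] c(2) unfolding \<psi>_def by blast
    then show False using that q \<delta>(2) by (auto simp: K_def)
  qed
  have s1: "smooth_map M (chart_dom c) \<zeta>"
    unfolding smooth_map_iff
  proof (intro ballI allI)
    fix c' k assume c': "c' \<in> atlas M"
    let ?W = "chart_map c' ` (chart_dom c' \<inter> chart_dom c)"
    have "Ck_on k (Rn (chart_dim c')) ?W (chart_map c \<circ> chart_inv c')"
      using smooth_manifold c' c(1) by (auto simp: smooth_manifold_def compatible_charts_def smooth_on_def)
    then have "Ck_on k (Rn (chart_dim c')) ?W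
        (\<lambda>x. (1 / \<psi> (chart_map c p)) *\<^sub>R \<psi> ((chart_map c \<circ> chart_inv c') x))"
      unfolding \<psi>_def
      by (intro Ck_on_scaleR Ck_on_const Ck_on_coord_bump chart_image_subset c')
    then show "Ck_on k (Rn (chart_dim c')) ?W (\<zeta> \<circ> chart_inv c')"
      by (rule Ck_on_cong[OF chart_image_open[OF c' chart_open[OF c(1)]], rotated])
        (auto simp: \<zeta>_def chart_inv[OF c'])
  qed
  have o2: "openin T (topspace T - K)" using K by blast
  have s2: "smooth_map M (topspace T - K) \<zeta>"
    by (rule smooth_map_cong[OF o2 _ smooth_map_const[of _ 0]]) (use z in auto)
  have "smooth_map M (chart_dom c \<union> (topspace T - K)) \<zeta>"
    by (rule smooth_map_union[OF chart_open[OF c(1)] o2 s1 s2])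
  moreover have "chart_dom c \<union> (topspace T - K) = topspace T"
    using openin_subset[OF chart_open[OF c(1)]] by (auto simp: K_def)
  ultimately have "smooth_map M (topspace T) \<zeta>" by simp
  moreover have "\<zeta> p = 1" using c(2) \<psi>p by (simp add: \<zeta>_def)
  ultimately show ?thesis using that K c(5) z unfolding K_def by blast
qed

text \<open>\<open>W\<close> is covered by the open sets \<open>W \<inter> U\<close> and
  \<open>W - K\<close>; the function is a product of smooth functions on the first and zero on the
  second.\<close>

lemma smooth_map_extend:
  fixes f :: "'p \<Rightarrow> 'b::real_normed_vector"
  assumes \<zeta>: "smooth_map M (topspace T) \<zeta>" "closedin T K" "K \<subseteq> U" "\<And>q. q \<notin> K \<Longrightarrow> \<zeta> q = 0"
    and U: "openin T U" and W: "openin T W" and f: "smooth_map M (W \<inter> U) f"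
  shows "smooth_map M W (\<lambda>q. if q \<in> U then \<zeta> q *\<^sub>R f q else 0)"
proof -
  let ?g = "\<lambda>q. if q \<in> U then \<zeta> q *\<^sub>R f q else 0"
  have sub: "W \<subseteq> topspace T" using W openin_subset by blast
  have o1: "openin T (W \<inter> U)" using W U by blast
  have o2: "openin T (W - K)" using W \<zeta>(2) by blast
  have "smooth_map M (W \<inter> U) (\<lambda>q. \<zeta> q *\<^sub>R f q)"
    using sub by (intro smooth_map_scaleR f smooth_map_subset[OF \<zeta>(1)]) auto
  then have s1: "smooth_map M (W \<inter> U) ?g" by (rule smooth_map_cong[OF o1, rotated]) auto
  have s2: "smooth_map M (W - K) ?g"
    by (rule smooth_map_cong[OF o2 _ smooth_map_const[of _ 0]]) (use \<zeta>(4) in auto)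
  have "W = (W \<inter> U) \<union> (W - K)" using \<zeta>(3) by auto
  then show ?thesis using smooth_map_union[OF o1 o2 s1 s2] by simp
qed

end


section \<open>Filtrations\<close>

locale filtered_bundle =
  fixes E :: "('p, 'v::real_vector) vbundle"
    and F :: "nat \<Rightarrow> ('p \<Rightarrow> 'v) set"
    and N :: nat
  assumes bundle_E: "smooth_bundle E" and filt: "filtration E F N"
begin

sublocale manifold "base E"
  using bundle_E by unfold_locales (simp add: smooth_bundle_def)

lemma F_0: "F 0 = {\<lambda>_. 0}"
  and F_Suc: "F k \<subseteq> F (Suc k)"
  and F_ge: "N \<le> k \<Longrightarrow> F k = sections E"
  and F_submodule: "submodule E (F k)"
  and F_lfg: "locally_finitely_generated E (F k)"
  using filt by (auto simp: filtration_def)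

lemma F_mono: "j \<le> k \<Longrightarrow> F j \<subseteq> F k"
  using lift_Suc_mono_le[of F j k] F_Suc by blast

lemma F_sections: "X \<in> F k \<Longrightarrow> X \<in> sections E"
  and F_zero: "(\<lambda>_. 0) \<in> F k"
  and F_add: "X \<in> F k \<Longrightarrow> Y \<in> F k \<Longrightarrow> (\<lambda>p. X p + Y p) \<in> F k"
  and F_scale: "smooth_map (base E) (pts E) f \<Longrightarrow> X \<in> F k \<Longrightarrow> (\<lambda>p. f p *\<^sub>R X p) \<in> F k"
  using F_submodule[of k] unfolding submodule_def by blast+

lemma F_sum: "(\<And>i. i \<in> A \<Longrightarrow> X i \<in> F k) \<Longrightarrow> (\<lambda>p. \<Sum>i\<in>A. X i p) \<in> F k"
  by (induction A rule: infinite_finite_induct) (auto intro: F_zero F_add)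

lemma F_sum_scale:
  assumes "\<And>i. i \<in> A \<Longrightarrow> X i \<in> F k"
  shows "(\<lambda>p. \<Sum>i\<in>A. c i *\<^sub>R X i p) \<in> F k"
  by (intro F_sum F_scale smooth_map_const assms)

lemma section_fibre: "X \<in> sections E \<Longrightarrow> p \<in> pts E \<Longrightarrow> X p \<in> fibre E p"
  by (auto simp: sections_def)

lemma subspace_fibre: "p \<in> pts E \<Longrightarrow> subspace (fibre E p)"
  using bundle_E by (auto simp: smooth_bundle_def)

lemma triv: "\<tau> \<in> trivs E \<Longrightarrow> is_triv E \<tau>"
  using bundle_E by (auto simp: smooth_bundle_def)

lemma triv_open: "\<tau> \<in> trivs E \<Longrightarrow> openin T (triv_dom \<tau>)"
  using triv by (auto simp: is_triv_def)

lemma point_triv: "p \<in> pts E \<Longrightarrow> \<exists>\<tau>\<in>trivs E. p \<in> triv_dom \<tau>"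
  using bundle_E by (auto simp: smooth_bundle_def)

lemma triv_pts: "\<tau> \<in> trivs E \<Longrightarrow> p \<in> triv_dom \<tau> \<Longrightarrow> p \<in> pts E"
  using triv_open openin_subset by blast

lemma triv_bij: "\<tau> \<in> trivs E \<Longrightarrow> p \<in> triv_dom \<tau> \<Longrightarrow> bij_betw (triv_map \<tau> p) (fibre E p) (Rn (triv_rank \<tau>))"
  and triv_add: "\<tau> \<in> trivs E \<Longrightarrow> p \<in> triv_dom \<tau> \<Longrightarrow> v \<in> fibre E p \<Longrightarrow> w \<in> fibre E p \<Longrightarrow>
    triv_map \<tau> p (v + w) = triv_map \<tau> p v + triv_map \<tau> p w"
  and triv_scale: "\<tau> \<in> trivs E \<Longrightarrow> p \<in> triv_dom \<tau> \<Longrightarrow> v \<in> fibre E p \<Longrightarrow>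
    triv_map \<tau> p (a *\<^sub>R v) = a *\<^sub>R triv_map \<tau> p v"
  using triv by (auto simp: is_triv_def)

lemma triv_zero: "\<tau> \<in> trivs E \<Longrightarrow> p \<in> triv_dom \<tau> \<Longrightarrow> triv_map \<tau> p 0 = 0"
  using triv_scale[of \<tau> p 0 0] subspace_0[OF subspace_fibre[OF triv_pts]] by simp

lemma triv_sum:
  assumes "\<tau> \<in> trivs E" "p \<in> triv_dom \<tau>" "\<And>i. i \<in> A \<Longrightarrow> v i \<in> fibre E p"
  shows "triv_map \<tau> p (\<Sum>i\<in>A. v i) = (\<Sum>i\<in>A. triv_map \<tau> p (v i))"
  using assms(3)
proof (induction A rule: infinite_finite_induct)
  case (insert x A)
  then show ?case
    using triv_add[OF assms(1,2)] subspace_sum[OF subspace_fibre[OF triv_pts[OF assms(1,2)]], of A v] by simp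
qed (use triv_zero[OF assms(1,2)] in auto)

lemma triv_eq_0_iff:
  assumes "\<tau> \<in> trivs E" "p \<in> triv_dom \<tau>" "v \<in> fibre E p"
  shows "triv_map \<tau> p v = 0 \<longleftrightarrow> v = 0"
  using triv_bij[OF assms(1,2)] triv_zero[OF assms(1,2)] assms(3)
    subspace_0[OF subspace_fibre[OF triv_pts[OF assms(1,2)]]]
  by (metis bij_betw_imp_inj_on inj_onD)

text \<open>Generation speaks of global sections only, so a vector of a fibre has to be reached by
  one: constant in a trivialization and cut off by a bump function.\<close>

lemma section_through:
  assumes p: "p \<in> pts E" and e: "e \<in> fibre E p"
  obtains Y where "Y \<in> sections E" "Y p = e"
proof -
  obtain \<tau> where \<tau>: "\<tau> \<in> trivs E" "p \<in> triv_dom \<tau>" using point_triv[OF p] by blast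
  obtain \<zeta> :: "'p \<Rightarrow> real" and K where z: "smooth_map (base E) (topspace T) \<zeta>" "\<zeta> p = 1"
    "closedin T K" "K \<subseteq> triv_dom \<tau>" "\<And>q. q \<notin> K \<Longrightarrow> \<zeta> q = 0"
    using bump_function[OF triv_open[OF \<tau>(1)] \<tau>(2)] by blast
  define w where "w = triv_map \<tau> p e"
  define s where "s = (\<lambda>q. inv_into (fibre E q) (triv_map \<tau> q) w)"
  define Y where "Y = (\<lambda>q. if q \<in> triv_dom \<tau> then \<zeta> q *\<^sub>R s q else 0)"
  have w: "w \<in> Rn (triv_rank \<tau>)" using triv_bij[OF \<tau>] e by (auto simp: w_def bij_betw_def)
  have s: "s q \<in> fibre E q" if "q \<in> triv_dom \<tau>" for q
    unfolding s_def using triv_bij[OF \<tau>(1) that] w by (metis bij_betw_def inv_into_into)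
  have "Y \<in> sections E"
    unfolding sections_def mem_Collect_eq
  proof (intro conjI ballI allI impI)
    fix q assume q: "q \<in> pts E"
    show "Y q \<in> fibre E q"
      using s subspace_fibre[OF q] by (auto simp: Y_def subspace_scale subspace_0)
  next
    fix q assume "q \<notin> pts E"
    then show "Y q = 0" using triv_pts[OF \<tau>(1)] by (auto simp: Y_def)
  next
    fix \<tau>' assume \<tau>': "\<tau>' \<in> trivs E"
    have "smooth_transition E \<tau> \<tau>'" using bundle_E \<tau>(1) \<tau>' by (simp add: smooth_bundle_def)
    then have "smooth_map (base E) (triv_dom \<tau> \<inter> triv_dom \<tau>') (\<lambda>q. triv_map \<tau>' q (s q))"
      unfolding smooth_transition_def s_def using w by (rule bspec)
    then have "smooth_map (base E) (triv_dom \<tau>' \<inter> triv_dom \<tau>) (\<lambda>q. triv_map \<tau>' q (s q))"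
      by (simp only: Int_commute)
    from smooth_map_extend[OF z(1,3,4,5) triv_open[OF \<tau>(1)] triv_open[OF \<tau>'] this]
    show "smooth_map (base E) (triv_dom \<tau>') (\<lambda>q. triv_map \<tau>' q (Y q))"
      by (rule smooth_map_cong[OF triv_open[OF \<tau>'], rotated])
        (auto simp: Y_def triv_scale[OF \<tau>'] s triv_zero[OF \<tau>'])
  qed
  moreover have "Y p = e"
    using \<tau>(2) z(2) triv_bij[OF \<tau>] e by (simp add: Y_def s_def w_def bij_betw_def)
  ultimately show ?thesis using that by blast
qed

text \<open>Extends the representation to all degrees \<open>m\<close>: beyond \<open>N\<close> the
  module is that of level \<open>N\<close>, and at level 0 it is zero. Padding with zero
  coefficients allows one sum over the whole of \<open>I\<close>.\<close>

lemma gen_representation: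
  assumes gf: "generating_family E F N U I X k" and Y: "Y \<in> F m"
  obtains f where "\<And>i. i \<in> I \<Longrightarrow> smooth_map (base E) U (f i)"
    "\<And>i. i \<in> I \<Longrightarrow> min m N < k i \<Longrightarrow> f i = (\<lambda>_. 0)"
    "\<And>q. q \<in> U \<Longrightarrow> Y q = (\<Sum>i\<in>I. f i q *\<^sub>R X i q)"
proof (cases "min m N = 0")
  case True
  \<comment> \<open>Either \<open>m = 0\<close> or \<open>N = 0\<close>; in the second case all
    sections already lie in \<open>F 0\<close>.\<close>
  then have "Y = (\<lambda>_. 0)" using Y F_0 F_ge[of 0] F_ge[of m] by (cases "m = 0") auto
  then show ?thesis using that[of "\<lambda>_ _. 0"] by (simp add: smooth_map_const)
next
  case False
  define l where "l = min m N"
  have l: "l \<in> {1..N}" using False by (auto simp: l_def)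
  have "Y \<in> F l"
    using Y F_ge[of m] F_ge[of N] by (cases "m \<le> N") (auto simp: l_def min_def)
  moreover have "generated_on E (F l) U {i \<in> I. k i \<le> l} X"
    using gf l unfolding generating_family_def by blast
  ultimately obtain g where g: "\<And>i. i \<in> I \<Longrightarrow> k i \<le> l \<Longrightarrow> smooth_map (base E) U (g i)"
    "\<And>q. q \<in> U \<Longrightarrow> Y q = (\<Sum>i\<in>{i \<in> I. k i \<le> l}. g i q *\<^sub>R X i q)"
    unfolding generated_on_def by blast
  define f where "f = (\<lambda>i. if k i \<le> l then g i else (\<lambda>_. 0))"
  have fin: "finite I" using gf by (simp add: generating_family_def)
  have "(\<Sum>i\<in>{i \<in> I. k i \<le> l}. g i q *\<^sub>R X i q) = (\<Sum>i\<in>I. f i q *\<^sub>R X i q)" for q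
    by (rule sum.mono_neutral_cong_left) (use fin in \<open>auto simp: f_def\<close>)
  then show ?thesis using g
    by (intro that[of f]) (auto simp: f_def l_def[symmetric] smooth_map_const)
qed


section \<open>Algebra of the denominators and cosets of the graded space\<close>

definition vanishing_rep :: "'p \<Rightarrow> ('p \<Rightarrow> 'v) set \<Rightarrow> ('p \<Rightarrow> 'v) \<Rightarrow> nat \<Rightarrow> (nat \<Rightarrow> 'p \<Rightarrow> real) \<Rightarrow> (nat \<Rightarrow> 'p \<Rightarrow> 'v) \<Rightarrow> bool"
  where "vanishing_rep p S X m f A \<longleftrightarrow> X = (\<lambda>q. \<Sum>j<m. f j q *\<^sub>R A j q) \<and>
    (\<forall>j<m. smooth_map (base E) (pts E) (f j) \<and> f j p = 0 \<and> A j \<in> S)"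

lemma vanishing_mult_iff: "X \<in> vanishing_mult E p S \<longleftrightarrow> (\<exists>m f A. vanishing_rep p S X m f A)"
  unfolding vanishing_mult_def vanishing_rep_def mem_Collect_eq ..

definition denom_rep :: "'p \<Rightarrow> nat \<Rightarrow> ('p \<Rightarrow> 'v) \<Rightarrow> ('p \<Rightarrow> 'v) \<Rightarrow> ('p \<Rightarrow> 'v) \<Rightarrow> bool"
  where "denom_rep p k X Y Z \<longleftrightarrow> X = (\<lambda>q. Y q + Z q) \<and> Y \<in> F (k - 1) \<and> Z \<in> vanishing_mult E p (F k)"

lemma gr_denom_iff: "X \<in> gr_denom E F p k \<longleftrightarrow> (\<exists>Y Z. denom_rep p k X Y Z)"
  unfolding gr_denom_def denom_rep_def mem_Collect_eq ..

lemma gr_denomI: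
  assumes "\<And>q. X q = Y q + Z q" "Y \<in> F (k - 1)" "Z \<in> vanishing_mult E p (F k)"
  shows "X \<in> gr_denom E F p k"
  unfolding gr_denom_def mem_Collect_eq
  by (intro exI[of _ Y] exI[of _ Z]) (use assms in auto)

lemma vanishing_mult_add:
  assumes "X \<in> vanishing_mult E p S" "Y \<in> vanishing_mult E p S"
  shows "(\<lambda>q. X q + Y q) \<in> vanishing_mult E p S"
proof -
  obtain m f A where "vanishing_rep p S X m f A"
    using assms(1) unfolding vanishing_mult_iff by blast
  then have 1: "X = (\<lambda>q. \<Sum>j<m. f j q *\<^sub>R A j q)"
    "\<forall>j<m. smooth_map (base E) (pts E) (f j) \<and> f j p = 0 \<and> A j \<in> S"
    by (auto simp: vanishing_rep_def)
  obtain n g B where "vanishing_rep p S Y n g B"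
    using assms(2) unfolding vanishing_mult_iff by blast
  then have 2: "Y = (\<lambda>q. \<Sum>j<n. g j q *\<^sub>R B j q)"
    "\<forall>j<n. smooth_map (base E) (pts E) (g j) \<and> g j p = 0 \<and> B j \<in> S"
    by (auto simp: vanishing_rep_def)
  define h where "h = (\<lambda>j. if j < m then f j else g (j - m))"
  define C where "C = (\<lambda>j. if j < m then A j else B (j - m))"
  have "X q + Y q = (\<Sum>j<m+n. h j q *\<^sub>R C j q)" for q
  proof -
    have "(\<Sum>j<m+n. h j q *\<^sub>R C j q) = (\<Sum>j<m. h j q *\<^sub>R C j q) + (\<Sum>j=m..<m+n. h j q *\<^sub>R C j q)"
      by (simp add: lessThan_atLeast0 sum.atLeastLessThan_concat)
    also have "(\<Sum>j=m..<m+n. h j q *\<^sub>R C j q) = (\<Sum>j<n. h (m + j) q *\<^sub>R C (m + j) q)"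
      using sum.shift_bounds_nat_ivl[of "\<lambda>j. h j q *\<^sub>R C j q" 0 m n]
      by (simp add: lessThan_atLeast0 add.commute)
    finally show ?thesis by (simp add: 1 2 h_def C_def)
  qed
  then have "(\<lambda>q. X q + Y q) = (\<lambda>q. \<Sum>j<m+n. h j q *\<^sub>R C j q)" by blast
  moreover have "\<forall>j<m+n. smooth_map (base E) (pts E) (h j) \<and> h j p = 0 \<and> C j \<in> S"
    using 1(2) 2(2) by (auto simp: h_def C_def)
  ultimately show ?thesis unfolding vanishing_mult_def mem_Collect_eq
    by (intro exI[of _ "m + n"] exI[of _ h] exI[of _ C]) simp
qed

lemma vanishing_mult_single:
  assumes "smooth_map (base E) (pts E) h" "h p = 0" "X \<in> S"
  shows "(\<lambda>q. h q *\<^sub>R X q) \<in> vanishing_mult E p S"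
  unfolding vanishing_mult_def mem_Collect_eq
  by (rule exI[of _ 1], rule exI[of _ "\<lambda>_. h"], rule exI[of _ "\<lambda>_. X"]) (use assms in simp)

lemma vanishing_mult_zero: "(\<lambda>_. 0) \<in> vanishing_mult E p S"
  unfolding vanishing_mult_def mem_Collect_eq by (rule exI[of _ 0]) simp

lemma vanishing_mult_sum:
  "(\<And>i. i \<in> A \<Longrightarrow> X i \<in> vanishing_mult E p S) \<Longrightarrow> (\<lambda>q. \<Sum>i\<in>A. X i q) \<in> vanishing_mult E p S"
  by (induction A rule: infinite_finite_induct) (auto intro: vanishing_mult_zero vanishing_mult_add)

lemma vanishing_mult_scale:
  assumes "X \<in> vanishing_mult E p S"
  shows "(\<lambda>q. a *\<^sub>R X q) \<in> vanishing_mult E p S"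
proof -
  obtain m f A where "vanishing_rep p S X m f A"
    using assms unfolding vanishing_mult_iff by blast
  then have X: "X = (\<lambda>q. \<Sum>j<m. f j q *\<^sub>R A j q)"
    "\<forall>j<m. smooth_map (base E) (pts E) (f j) \<and> f j p = 0 \<and> A j \<in> S"
    by (auto simp: vanishing_rep_def)
  have eq: "(\<lambda>q. a *\<^sub>R X q) = (\<lambda>q. \<Sum>j<m. (a *\<^sub>R f j q) *\<^sub>R A j q)"
    by (simp add: X scaleR_sum_right)
  show ?thesis unfolding eq
    by (intro vanishing_mult_sum vanishing_mult_single smooth_map_scaleR smooth_map_const) (use X(2) in auto)
qed

lemma gr_denom_zero: "(\<lambda>_. 0) \<in> gr_denom E F p k"
  by (rule gr_denomI[of _ "\<lambda>_. 0" "\<lambda>_. 0"]) (simp_all add: F_zero vanishing_mult_zero)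

lemma gr_denom_add:
  assumes "X \<in> gr_denom E F p k" "Y \<in> gr_denom E F p k"
  shows "(\<lambda>q. X q + Y q) \<in> gr_denom E F p k"
proof -
  obtain X1 X2 where "denom_rep p k X X1 X2"
    using assms(1) unfolding gr_denom_iff by blast
  then have X: "X = (\<lambda>q. X1 q + X2 q)" "X1 \<in> F (k - 1)" "X2 \<in> vanishing_mult E p (F k)"
    by (auto simp: denom_rep_def)
  obtain Y1 Y2 where "denom_rep p k Y Y1 Y2"
    using assms(2) unfolding gr_denom_iff by blast
  then have Y: "Y = (\<lambda>q. Y1 q + Y2 q)" "Y1 \<in> F (k - 1)" "Y2 \<in> vanishing_mult E p (F k)"
    by (auto simp: denom_rep_def)
  show ?thesis
    by (rule gr_denomI[OF _ F_add[OF X(2) Y(2)] vanishing_mult_add[OF X(3) Y(3)]]) (simp add: X Y add_ac)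
qed

lemma gr_denom_scale:
  assumes "X \<in> gr_denom E F p k"
  shows "(\<lambda>q. a *\<^sub>R X q) \<in> gr_denom E F p k"
proof -
  obtain X1 X2 where X: "X = (\<lambda>q. X1 q + X2 q)" "X1 \<in> F (k - 1)" "X2 \<in> vanishing_mult E p (F k)"
    using assms(1) unfolding gr_denom_def by blast
  show ?thesis
    by (rule gr_denomI[OF _ F_scale[OF smooth_map_const X(2)] vanishing_mult_scale[OF X(3)]])
      (simp add: X scaleR_add_right)
qed

lemma gr_denom_diff:
  assumes "X \<in> gr_denom E F p k" "Y \<in> gr_denom E F p k"
  shows "(\<lambda>q. X q - Y q) \<in> gr_denom E F p k"
  using gr_denom_add[OF assms(1) gr_denom_scale[OF assms(2), of "-1"]] by simp

lemma gr_coset_self: "X \<in> gr_coset E F p k X"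
  unfolding gr_coset_def mem_Collect_eq by (rule exI[of _ "\<lambda>_. 0"]) (simp add: gr_denom_zero)

lemma in_gr_coset: "Y \<in> gr_coset E F p k X \<longleftrightarrow> (\<lambda>q. Y q - X q) \<in> gr_denom E F p k"
proof
  assume "Y \<in> gr_coset E F p k X"
  then obtain Z where "Y = (\<lambda>q. X q + Z q)" "Z \<in> gr_denom E F p k" unfolding gr_coset_def by blast
  then show "(\<lambda>q. Y q - X q) \<in> gr_denom E F p k" by simp
next
  assume a: "(\<lambda>q. Y q - X q) \<in> gr_denom E F p k"
  show "Y \<in> gr_coset E F p k X" unfolding gr_coset_def mem_Collect_eq
    by (rule exI[of _ "\<lambda>q. Y q - X q"]) (simp add: a)
qed

lemma gr_coset_eq_iff: "gr_coset E F p k X = gr_coset E F p k Y \<longleftrightarrow> (\<lambda>q. X q - Y q) \<in> gr_denom E F p k"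
proof
  assume "gr_coset E F p k X = gr_coset E F p k Y"
  then show "(\<lambda>q. X q - Y q) \<in> gr_denom E F p k" using gr_coset_self in_gr_coset by blast
next
  assume a: "(\<lambda>q. X q - Y q) \<in> gr_denom E F p k"
  have "(\<lambda>q. Z q - X q) \<in> gr_denom E F p k \<longleftrightarrow> (\<lambda>q. Z q - Y q) \<in> gr_denom E F p k" for Z
  proof
    assume "(\<lambda>q. Z q - X q) \<in> gr_denom E F p k"
    from gr_denom_add[OF this a] show "(\<lambda>q. Z q - Y q) \<in> gr_denom E F p k" by simp
  next
    assume "(\<lambda>q. Z q - Y q) \<in> gr_denom E F p k"
    from gr_denom_diff[OF this a] show "(\<lambda>q. Z q - X q) \<in> gr_denom E F p k" by simp
  qed
  then show "gr_coset E F p k X = gr_coset E F p k Y" by (auto simp: in_gr_coset)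
qed

lemma gr_coset_zero: "gr_coset E F p k (\<lambda>_. 0) = gr_denom E F p k"
  by (simp add: gr_coset_def)

lemma gr_coset_add:
  "{\<lambda>q. A q + B q | A B. A \<in> gr_coset E F p k X \<and> B \<in> gr_coset E F p k Y} =
    gr_coset E F p k (\<lambda>q. X q + Y q)"
proof (intro set_eqI iffI)
  fix C assume "C \<in> {\<lambda>q. A q + B q | A B. A \<in> gr_coset E F p k X \<and> B \<in> gr_coset E F p k Y}"
  then obtain A B where C: "C = (\<lambda>q. A q + B q)"
    "(\<lambda>q. A q - X q) \<in> gr_denom E F p k" "(\<lambda>q. B q - Y q) \<in> gr_denom E F p k"
    unfolding mem_Collect_eq in_gr_coset by blast
  from gr_denom_add[OF C(2,3)] show "C \<in> gr_coset E F p k (\<lambda>q. X q + Y q)"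
    by (simp add: in_gr_coset C(1) algebra_simps)
next
  fix C assume C: "C \<in> gr_coset E F p k (\<lambda>q. X q + Y q)"
  have "(\<lambda>q. C q - Y q) \<in> gr_coset E F p k X"
    using C by (simp add: in_gr_coset algebra_simps)
  then show "C \<in> {\<lambda>q. A q + B q | A B. A \<in> gr_coset E F p k X \<and> B \<in> gr_coset E F p k Y}"
    unfolding mem_Collect_eq
    by (intro exI[of _ "\<lambda>q. C q - Y q"] exI[of _ Y]) (simp add: gr_coset_self)
qed

lemma gr_coset_scale:
  "{\<lambda>q. a *\<^sub>R A q + Z q | A Z. A \<in> gr_coset E F p k X \<and> Z \<in> gr_denom E F p k} =
    gr_coset E F p k (\<lambda>q. a *\<^sub>R X q)"
proof (intro set_eqI iffI)
  fix C assume "C \<in> {\<lambda>q. a *\<^sub>R A q + Z q | A Z. A \<in> gr_coset E F p k X \<and> Z \<in> gr_denom E F p k}"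
  then obtain A Z where C: "C = (\<lambda>q. a *\<^sub>R A q + Z q)"
    "(\<lambda>q. A q - X q) \<in> gr_denom E F p k" "Z \<in> gr_denom E F p k"
    unfolding mem_Collect_eq in_gr_coset by blast
  from gr_denom_add[OF gr_denom_scale[OF C(2), of a] C(3)] show "C \<in> gr_coset E F p k (\<lambda>q. a *\<^sub>R X q)"
    by (simp add: in_gr_coset C(1) algebra_simps)
next
  fix C assume C: "C \<in> gr_coset E F p k (\<lambda>q. a *\<^sub>R X q)"
  then have "(\<lambda>q. C q - a *\<^sub>R X q) \<in> gr_denom E F p k" by (simp add: in_gr_coset)
  then show "C \<in> {\<lambda>q. a *\<^sub>R A q + Z q | A Z. A \<in> gr_coset E F p k X \<and> Z \<in> gr_denom E F p k}"
    \<comment> \<open>The representative \<open>X\<close> itself serves and the denominator absorbs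
      the rest, also for \<open>a = 0\<close>.\<close>
    unfolding mem_Collect_eq
    by (intro exI[of _ X] exI[of _ "\<lambda>q. C q - a *\<^sub>R X q"]) (simp add: gr_coset_self)
qed

text \<open>A local representation is globalized with a bump function \<open>\<zeta>\<close>, because \<open>(1 - \<zeta>) Y\<close>
  lies in \<open>I\<^sub>p F\<^sup>l\<close>.\<close>

lemma local_representation_gr:
  assumes fin: "finite I" and X: "\<And>i. i \<in> I \<Longrightarrow> X i \<in> F (k i)"
    and U: "openin T U" "p \<in> U" and l: "1 \<le> l" and Y: "Y \<in> F l"
    and f: "\<And>i. i \<in> I \<Longrightarrow> smooth_map (base E) U (f i)"
      "\<And>i. i \<in> I \<Longrightarrow> l < k i \<Longrightarrow> f i = (\<lambda>_. 0)"
    and eq: "\<And>q. q \<in> U \<Longrightarrow> Y q = (\<Sum>i\<in>I. f i q *\<^sub>R X i q)"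
  shows "(\<lambda>q. Y q - (\<Sum>i\<in>{i\<in>I. k i = l}. f i p *\<^sub>R X i q)) \<in> gr_denom E F p l"
proof -
  obtain \<zeta> :: "'p \<Rightarrow> real" and K where z: "smooth_map (base E) (topspace T) \<zeta>" "\<zeta> p = 1"
    "closedin T K" "K \<subseteq> U" "\<And>q. q \<notin> K \<Longrightarrow> \<zeta> q = 0"
    using bump_function[OF U] by blast
  define g where "g = (\<lambda>i q. if q \<in> U then \<zeta> q *\<^sub>R f i q else 0)"
  have UT: "pts E \<inter> U = U" using openin_subset[OF U(1)] by blast
  have g: "smooth_map (base E) (pts E) (g i)" if "i \<in> I" for i
    unfolding g_def by (rule smooth_map_extend[OF z(1,3,4,5) U(1) openin_topspace]) (use f(1)[OF that] UT in auto)
  \<comment> \<open>After globalization the combination splits by degree: what lies below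
    \<open>l\<close> belongs to \<open>F (l - 1)\<close>.\<close>
  define A where "A = (\<lambda>q. \<Sum>i\<in>{i\<in>I. k i < l}. g i q *\<^sub>R X i q)"
  \<comment> \<open>Everything here has a coefficient vanishing at \<open>p\<close>: the remainder
    of \<open>Y\<close> after the cut-off, and the variation of the coefficients of degree
    \<open>l\<close>.\<close>
  define B where "B = (\<lambda>q. (1 - \<zeta> q) *\<^sub>R Y q + (\<Sum>i\<in>{i\<in>I. k i = l}. (g i q - f i p) *\<^sub>R X i q))"
  have "A \<in> F (l - 1)"
    unfolding A_def
  proof (intro F_sum F_scale)
    fix i assume "i \<in> {i \<in> I. k i < l}"
    then have i: "i \<in> I" "k i \<le> l - 1" using l by auto
    show "smooth_map (base E) (pts E) (g i)" "X i \<in> F (l - 1)"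
      using g[OF i(1)] X[OF i(1)] F_mono[OF i(2)] by auto
  qed
  moreover have "B \<in> vanishing_mult E p (F l)"
    unfolding B_def
  proof (intro vanishing_mult_add vanishing_mult_sum vanishing_mult_single smooth_map_diff smooth_map_const)
    show "smooth_map (base E) (pts E) \<zeta>" "1 - \<zeta> p = 0" "Y \<in> F l" using z Y by auto
    fix i assume "i \<in> {i \<in> I. k i = l}"
    then show "smooth_map (base E) (pts E) (g i)" "g i p - f i p = 0" "X i \<in> F l"
      using g X U(2) z(2) by (auto simp: g_def)
  qed
  moreover have "Y q - (\<Sum>i\<in>{i\<in>I. k i = l}. f i p *\<^sub>R X i q) = A q + B q" for q
  proof -
    have "\<zeta> q *\<^sub>R Y q = (\<Sum>i\<in>I. g i q *\<^sub>R X i q)"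
    proof (cases "q \<in> U")
      case True
      then show ?thesis by (simp add: eq g_def scaleR_sum_right)
    next
      case False
      then show ?thesis using z(4,5) by (auto simp: g_def)
    qed
    also have "\<dots> = (\<Sum>i\<in>{i\<in>I. k i < l} \<union> {i\<in>I. k i = l}. g i q *\<^sub>R X i q)"
    proof (rule sum.mono_neutral_right)
      show "\<forall>i\<in>I - ({i\<in>I. k i < l} \<union> {i\<in>I. k i = l}). g i q *\<^sub>R X i q = 0"
      proof
        fix i assume "i \<in> I - ({i\<in>I. k i < l} \<union> {i\<in>I. k i = l})"
        then have "i \<in> I" "l < k i" by auto
        then show "g i q *\<^sub>R X i q = 0" using f(2) by (simp add: g_def)
      qed
    qed (use fin in auto)
    also have "\<dots> = A q + (\<Sum>i\<in>{i\<in>I. k i = l}. g i q *\<^sub>R X i q)"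
      unfolding A_def by (rule sum.union_disjoint) (use fin in auto)
    finally show ?thesis
      by (simp add: B_def scaleR_diff_left sum_subtractf algebra_simps)
  qed
  ultimately show ?thesis by (intro gr_denomI[of _ A B])
qed


section \<open>The maps to the fibre and to the graded space\<close>

lemma gf_open: "generating_family E F N U I X k \<Longrightarrow> openin T U"
  and gf_finite: "generating_family E F N U I X k \<Longrightarrow> finite I"
  and gf_mem: "generating_family E F N U I X k \<Longrightarrow> i \<in> I \<Longrightarrow> X i \<in> F (k i)"
  by (auto simp: generating_family_def)

lemma gf_pts: "generating_family E F N U I X k \<Longrightarrow> U \<subseteq> pts E"
  using gf_open openin_subset by blast

lemma restrict_eq_iff: "restrict f A = restrict g A \<longleftrightarrow> (\<forall>x\<in>A. f x = g x)"
  by (auto simp: fun_eq_iff restrict_def)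

lemma homogeneous_mem:
  assumes "generating_family E F N U I X k"
  shows "(\<lambda>q. \<Sum>i\<in>{i\<in>I. k i = l}. c i *\<^sub>R X i q) \<in> F l"
  by (rule F_sum_scale) (use gf_mem[OF assms] in auto)

lemma nat_map0_eq_iff:
  "nat_map0 E F N I X k p v = nat_map0 E F N I X k p w \<longleftrightarrow> (\<forall>l\<in>{1..N}.
    (\<lambda>q. \<Sum>i\<in>{i\<in>I. k i = l}. Poly_Mapping.lookup (v - w) i *\<^sub>R X i q) \<in> gr_denom E F p l)"
  by (simp add: nat_map0_def restrict_eq_iff gr_coset_eq_iff lookup_minus scaleR_diff_left sum_subtractf)

lemma nat_map0_eq_zero_iff:
  "nat_map0 E F N I X k p v = gr_zero E F N p \<longleftrightarrow> (\<forall>l\<in>{1..N}.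
    (\<lambda>q. \<Sum>i\<in>{i\<in>I. k i = l}. Poly_Mapping.lookup v i *\<^sub>R X i q) \<in> gr_denom E F p l)"
  unfolding nat_map0_def gr_zero_def restrict_eq_iff gr_coset_zero[symmetric] gr_coset_eq_iff by simp

text \<open>Cosets carry no subtraction, so the difference is taken in the coordinate space
  instead.\<close>

lemma nat_map0_diff_zero:
  "nat_map0 E F N I X k p v = nat_map0 E F N I X k p w \<Longrightarrow> nat_map0 E F N I X k p (v - w) = gr_zero E F N p"
  unfolding nat_map0_eq_iff nat_map0_eq_zero_iff .

lemma nat_map0_zero: "nat_map0 E F N I X k p 0 = gr_zero E F N p"
  by (simp add: nat_map0_eq_zero_iff gr_denom_zero)

lemma nat_map0_add:
  "nat_map0 E F N I X k p (v + w) = gr_add N (nat_map0 E F N I X k p v) (nat_map0 E F N I X k p w)"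
  unfolding nat_map0_def gr_add_def restrict_eq_iff
  by (auto simp: gr_coset_add lookup_add scaleR_add_left sum.distrib)

lemma nat_map0_scale:
  "nat_map0 E F N I X k p (a *\<^sub>R v) = gr_scale E F N p a (nat_map0 E F N I X k p v)"
  unfolding nat_map0_def gr_scale_def restrict_eq_iff
  by (auto simp: gr_coset_scale scaleR_sum_right)

lemma nat_map0_mem:
  assumes "generating_family E F N U I X k"
  shows "nat_map0 E F N I X k p v \<in> gr_space E F N p"
  using homogeneous_mem[OF assms] by (auto simp: nat_map0_def gr_space_def)

text \<open>Each component has a representative in \<open>F l\<close>, and
  \<open>local_representation_gr\<close> replaces it by a combination of the generators of degree
  exactly \<open>l\<close>, with coefficients evaluated at \<open>p\<close>.\<close>

lemma nat_map0_surj: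
  assumes gf: "generating_family E F N U I X k" and p: "p \<in> U" and \<xi>: "\<xi> \<in> gr_space E F N p"
  obtains v where "v \<in> coord_space I" "nat_map0 E F N I X k p v = \<xi>"
proof -
  define P where "P = (\<lambda>l Y f. Y \<in> F l \<and> \<xi> l = gr_coset E F p l Y \<and> (\<forall>i\<in>I. smooth_map (base E) U (f i)) \<and>
      (\<forall>i\<in>I. l < k i \<longrightarrow> f i = (\<lambda>_. 0)) \<and> (\<forall>q\<in>U. Y q = (\<Sum>i\<in>I. f i q *\<^sub>R X i q)))"
  have "\<exists>Y f. P l Y f" if l: "l \<in> {1..N}" for l
  proof -
    have "\<xi> l \<in> gr_coset E F p l ` F l" using \<xi> l unfolding gr_space_def by (rule PiE_mem)
    then obtain Y where Y: "Y \<in> F l" "\<xi> l = gr_coset E F p l Y" by blast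
    obtain f where "\<And>i. i \<in> I \<Longrightarrow> smooth_map (base E) U (f i)"
      "\<And>i. i \<in> I \<Longrightarrow> min l N < k i \<Longrightarrow> f i = (\<lambda>_. 0)"
      "\<And>q. q \<in> U \<Longrightarrow> Y q = (\<Sum>i\<in>I. f i q *\<^sub>R X i q)"
      using gen_representation[OF gf Y(1)] by blast
    then show ?thesis unfolding P_def using Y by (intro exI[of _ Y] exI[of _ f]) auto
  qed
  then obtain Y f where "\<And>l. l \<in> {1..N} \<Longrightarrow> P l (Y l) (f l)" by metis
  then have Yf: "\<And>l. l \<in> {1..N} \<Longrightarrow> Y l \<in> F l \<and> \<xi> l = gr_coset E F p l (Y l) \<and>
      (\<forall>i\<in>I. smooth_map (base E) U (f l i)) \<and>
      (\<forall>i\<in>I. l < k i \<longrightarrow> f l i = (\<lambda>_. 0)) \<and> (\<forall>q\<in>U. Y l q = (\<Sum>i\<in>I. f l i q *\<^sub>R X i q))"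
    unfolding P_def .
  \<comment> \<open>Index \<open>i\<close> can enter only the component of its own degree, so its
    coordinate is read off the representation at level \<open>k i\<close>.\<close>
  define v where "v = coord_vec I (\<lambda>i. f (k i) i p)"
  have fin: "finite I" using gf_finite[OF gf] .
  have "nat_map0 E F N I X k p v l = \<xi> l" if l: "l \<in> {1..N}" for l
  proof -
    have eq: "(\<Sum>i\<in>{i\<in>I. k i = l}. Poly_Mapping.lookup v i *\<^sub>R X i q) =
        (\<Sum>i\<in>{i\<in>I. k i = l}. f l i p *\<^sub>R X i q)" for q
      by (rule sum.cong) (auto simp: v_def lookup_coord_vec fin)
    have "(\<lambda>q. Y l q - (\<Sum>i\<in>{i\<in>I. k i = l}. f l i p *\<^sub>R X i q)) \<in> gr_denom E F p l"
      by (rule local_representation_gr[OF fin gf_mem[OF gf] gf_open[OF gf] p]) (use Yf[OF l] l in auto)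
    then have "gr_coset E F p l (Y l) = gr_coset E F p l (\<lambda>q. \<Sum>i\<in>{i\<in>I. k i = l}. f l i p *\<^sub>R X i q)"
      by (simp add: gr_coset_eq_iff)
    then show ?thesis using Yf[OF l] l by (simp add: nat_map0_def eq)
  qed
  moreover have "\<xi> \<in> extensional {1..N}" using \<xi> unfolding gr_space_def PiE_def by blast
  moreover have "nat_map0 E F N I X k p v \<in> extensional {1..N}" by (auto simp: nat_map0_def)
  ultimately have "nat_map0 E F N I X k p v = \<xi>" by (metis extensionalityI)
  then show ?thesis using that coord_vec_in[OF fin] by (auto simp: v_def)
qed

lemma nat_preimage_Grass:
  assumes "L \<in> Grass_gr E F N p"
  shows "nat_preimage E F N I X k p L \<in> Grass (coord_space I)"
  using assms subspace_coord_space[of I]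
  by (auto simp: nat_preimage_def Grass_def Grass_gr_def subspace_def nat_map0_zero nat_map0_add nat_map0_scale)

text \<open>Surjectivity makes a subspace recoverable from its preimage, which later gives
  injectivity of \<open>iota\<close>.\<close>

lemma nat_preimage_image:
  assumes gf: "generating_family E F N U I X k" and p: "p \<in> U" and L: "L \<in> Grass_gr E F N p"
  shows "nat_map0 E F N I X k p ` nat_preimage E F N I X k p L = L"
proof
  show "L \<subseteq> nat_map0 E F N I X k p ` nat_preimage E F N I X k p L"
  proof
    fix \<xi> assume x: "\<xi> \<in> L"
    then have "\<xi> \<in> gr_space E F N p" using L by (auto simp: Grass_gr_def)
    then obtain v where "v \<in> coord_space I" "nat_map0 E F N I X k p v = \<xi>"
      using nat_map0_surj[OF gf p] by metis
    then show "\<xi> \<in> nat_map0 E F N I X k p ` nat_preimage E F N I X k p L"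
      using x by (auto simp: nat_preimage_def)
  qed
qed (auto simp: nat_preimage_def)

text \<open>Half of the correspondence theorem for quotient spaces: a subspace containing the kernel
  is the preimage of its image.\<close>

lemma Grass_gr_of_kernel:
  assumes gf: "generating_family E F N U I X k"
    and K: "K \<in> Grass (coord_space I)"
    and ker: "\<And>v. v \<in> coord_space I \<Longrightarrow> nat_map0 E F N I X k p v = gr_zero E F N p \<Longrightarrow> v \<in> K"
  shows "nat_map0 E F N I X k p ` K \<in> Grass_gr E F N p"
    and "nat_preimage E F N I X k p (nat_map0 E F N I X k p ` K) = K"
proof -
  have sK: "subspace K" "K \<subseteq> coord_space I" using K by (auto simp: Grass_def)
  show "nat_map0 E F N I X k p ` K \<in> Grass_gr E F N p"
    unfolding Grass_gr_def mem_Collect_eq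
  proof (intro conjI ballI allI)
    show "nat_map0 E F N I X k p ` K \<subseteq> gr_space E F N p" using nat_map0_mem[OF gf] by auto
    show "gr_zero E F N p \<in> nat_map0 E F N I X k p ` K"
      using subspace_0[OF sK(1)] nat_map0_zero by (metis image_eqI)
    show "gr_add N \<xi> \<eta> \<in> nat_map0 E F N I X k p ` K"
      if "\<xi> \<in> nat_map0 E F N I X k p ` K" "\<eta> \<in> nat_map0 E F N I X k p ` K" for \<xi> \<eta>
      using that subspace_add[OF sK(1)] by (auto simp flip: nat_map0_add)
    show "gr_scale E F N p a \<xi> \<in> nat_map0 E F N I X k p ` K"
      if "\<xi> \<in> nat_map0 E F N I X k p ` K" for a \<xi>
      using that subspace_scale[OF sK(1)] by (auto simp flip: nat_map0_scale)
  qed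
  show "nat_preimage E F N I X k p (nat_map0 E F N I X k p ` K) = K"
  proof
    show "nat_preimage E F N I X k p (nat_map0 E F N I X k p ` K) \<subseteq> K"
    proof
      fix v assume "v \<in> nat_preimage E F N I X k p (nat_map0 E F N I X k p ` K)"
      then obtain w where w: "v \<in> coord_space I" "w \<in> K" "nat_map0 E F N I X k p v = nat_map0 E F N I X k p w"
        by (auto simp: nat_preimage_def)
      have "v - w \<in> K"
        using w sK by (intro ker nat_map0_diff_zero subspace_diff[OF subspace_coord_space]) auto
      then show "v \<in> K" using subspace_add[OF sK(1) _ w(2)] by fastforce
    qed
  qed (use sK in \<open>auto simp: nat_preimage_def\<close>)
qed

lemma nat_map_fibre:
  assumes gf: "generating_family E F N U I X k" and p: "p \<in> U"
  shows "nat_map I X k p t v \<in> fibre E p"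
proof -
  have "p \<in> pts E" using gf_pts[OF gf] p by blast
  then show ?thesis
    unfolding nat_map_def
    using section_fibre[OF F_sections[OF gf_mem[OF gf]]] subspace_fibre
    by (intro subspace_sum subspace_scale) auto
qed

text \<open>For positive \<open>t\<close> the weights \<open>t ^ k i\<close> are invertible, and at
  level \<open>N\<close> the generators generate all sections.\<close>

lemma nat_map_surj:
  assumes gf: "generating_family E F N U I X k" and p: "p \<in> U" and t: "t > 0" and e: "e \<in> fibre E p"
  obtains v where "v \<in> coord_space I" "nat_map I X k p t v = e"
proof -
  have "p \<in> pts E" using gf_pts[OF gf] p by blast
  then obtain Y where Y: "Y \<in> sections E" "Y p = e" using section_through e by blast
  have "Y \<in> F N" using Y(1) F_ge[of N] by simp
  then obtain f where f: "\<And>q. q \<in> U \<Longrightarrow> Y q = (\<Sum>i\<in>I. f i q *\<^sub>R X i q)"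
    using gen_representation[OF gf] by blast
  have fin: "finite I" using gf_finite[OF gf] .
  define v where "v = coord_vec I (\<lambda>i. f i p / t ^ k i)"
  have "nat_map I X k p t v = (\<Sum>i\<in>I. f i p *\<^sub>R X i p)"
    unfolding nat_map_def by (rule sum.cong) (use t fin in \<open>auto simp: v_def lookup_coord_vec\<close>)
  then show ?thesis using that[of v] f[OF p] Y(2) coord_vec_in[OF fin] by (simp add: v_def)
qed

lemma linear_nat_map: "linear (nat_map I X k p t)"
  unfolding nat_map_def
  by (rule linearI) (simp_all add: lookup_add scaleR_add_left distrib_right sum.distrib scaleR_sum_right mult.assoc)

lemma nat_ker_Grass: "nat_ker I X k p t \<in> Grass (coord_space I)"
  using subspace_inter[OF subspace_coord_space linear_subspace_vimage[OF linear_nat_map[of I X k p t] subspace_single_0], of I]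
  by (auto simp: nat_ker_def Grass_def vimage_def Int_def)

text \<open>In a trivialization the kernel is the preimage of the zero subspace under a map into a
  fixed coordinate space; surjectivity at \<open>(p, t)\<close> is transversality to zero, so
  \<open>limitin_Grass_preimage\<close> applies.\<close>

lemma nat_ker_tendsto:
  assumes gf: "generating_family E F N U I X k" and p: "p \<in> U" and t: "t > 0"
    and \<pi>: "limitin T \<pi> p \<F>" and s: "(s \<longlongrightarrow> t) \<F>"
  shows "limitin (Grass_topology (coord_space I)) (\<lambda>x. nat_ker I X k (\<pi> x) (s x)) (nat_ker I X k p t) \<F>"
proof -
  have fin: "finite I" using gf_finite[OF gf] .
  have pp: "p \<in> pts E" using gf_pts[OF gf] p by blast
  then obtain \<tau> where \<tau>: "\<tau> \<in> trivs E" "p \<in> triv_dom \<tau>" using point_triv by blast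
  define R where "R = Rn (triv_rank \<tau>)"
  \<comment> \<open>A sum of trivialized generators rather than \<open>triv_map\<close> after
    \<open>nat_map\<close>: this is linear for every \<open>q\<close>, also outside the domain of
    the trivialization.\<close>
  define \<phi> where "\<phi> = (\<lambda>q t v. \<Sum>i\<in>I. Poly_Mapping.lookup v i *\<^sub>R (t ^ k i *\<^sub>R triv_map \<tau> q (X i q)))"
  have Xf: "X i q \<in> fibre E q" if "i \<in> I" "q \<in> triv_dom \<tau>" for i q
    using section_fibre[OF F_sections[OF gf_mem[OF gf that(1)]]] triv_pts[OF \<tau>(1) that(2)] .
  have lin: "linear (\<phi> q t)" for q t
    unfolding \<phi>_def by (rule linearI)
      (simp_all add: lookup_add scaleR_add_left distrib_right sum.distrib scaleR_sum_right mult.assoc)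
  have eq: "\<phi> q t v = triv_map \<tau> q (nat_map I X k q t v)" if "q \<in> triv_dom \<tau>" for q t v
  proof -
    have sf: "subspace (fibre E q)" by (rule subspace_fibre[OF triv_pts[OF \<tau>(1) that]])
    have s: "t ^ k i *\<^sub>R X i q \<in> fibre E q" "Poly_Mapping.lookup v i *\<^sub>R (t ^ k i *\<^sub>R X i q) \<in> fibre E q"
      if i: "i \<in> I" for i
      using Xf[OF i \<open>q \<in> triv_dom \<tau>\<close>] by (auto simp: subspace_scale[OF sf])
    have "triv_map \<tau> q (nat_map I X k q t v) =
        (\<Sum>i\<in>I. triv_map \<tau> q (Poly_Mapping.lookup v i *\<^sub>R (t ^ k i *\<^sub>R X i q)))"
      unfolding nat_map_def by (rule triv_sum[OF \<tau>(1) that]) (rule s(2))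
    also have "\<dots> = \<phi> q t v"
      unfolding \<phi>_def
    proof (rule sum.cong[OF refl])
      fix i assume i: "i \<in> I"
      show "triv_map \<tau> q (Poly_Mapping.lookup v i *\<^sub>R (t ^ k i *\<^sub>R X i q)) =
          Poly_Mapping.lookup v i *\<^sub>R (t ^ k i *\<^sub>R triv_map \<tau> q (X i q))"
        using triv_scale[OF \<tau>(1) that s(1)[OF i]] triv_scale[OF \<tau>(1) that Xf[OF i that]] by metis
    qed
    finally show ?thesis by (rule sym)
  qed
  have nf: "nat_map I X k q t v \<in> fibre E q" if "q \<in> triv_dom \<tau>" for q t v
    unfolding nat_map_def using Xf that subspace_fibre[OF triv_pts[OF \<tau>(1) that]]
    by (intro subspace_sum subspace_scale) auto
  have ker: "nat_ker I X k q t = {v \<in> coord_space I. \<phi> q t v \<in> {0}}" if "q \<in> triv_dom \<tau>" for q t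
    using eq[OF that] triv_eq_0_iff[OF \<tau>(1) that nf[OF that]] by (auto simp: nat_ker_def)
  have into: "\<phi> q t ` coord_space I \<subseteq> R" if "q \<in> triv_dom \<tau>" for q t
    using eq[OF that] nf[OF that] triv_bij[OF \<tau>(1) that] by (auto simp: R_def bij_betw_def)
  have ev: "eventually (\<lambda>x. \<pi> x \<in> triv_dom \<tau>) \<F>"
    using limitinD[OF \<pi> triv_open[OF \<tau>(1)] \<tau>(2)] .
  have "limitin (Grass_topology (coord_space I))
      (\<lambda>x. {v \<in> coord_space I. \<phi> (\<pi> x) (s x) v \<in> {0}}) {v \<in> coord_space I. \<phi> p t v \<in> {0}} \<F>"
  proof (rule limitin_Grass_preimage[OF coord_space_fin_dim[OF fin] coord_space_fin_dim[of "{..<triv_rank \<tau>}"],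
      folded R_def, where \<phi> = "\<lambda>x. \<phi> (\<pi> x) (s x)" and \<psi> = "\<phi> p t" and \<kappa> = "\<lambda>_. {0}" and K = "{0}"])
    show "eventually (\<lambda>x. \<phi> (\<pi> x) (s x) ` coord_space I \<subseteq> R) \<F>"
      using ev by eventually_elim (rule into)
    show "\<phi> p t ` coord_space I \<subseteq> R" by (rule into[OF \<tau>(2)])
    show "((\<lambda>x. \<phi> (\<pi> x) (s x) v) \<longlongrightarrow> \<phi> p t v) \<F>" for v
      unfolding \<phi>_def
    proof (intro tendsto_sum tendsto_scaleR tendsto_const tendsto_power s)
      fix i assume "i \<in> I"
      then have "X i \<in> sections E" using F_sections[OF gf_mem[OF gf]] by blast
      then have "smooth_map (base E) (triv_dom \<tau>) (\<lambda>q. triv_map \<tau> q (X i q))"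
        using \<tau>(1) by (auto simp: sections_def)
      then show "((\<lambda>x. triv_map \<tau> (\<pi> x) (X i (\<pi> x))) \<longlongrightarrow> triv_map \<tau> p (X i p)) \<F>"
        using smooth_map_tendsto[OF triv_open[OF \<tau>(1)] \<tau>(2) _ \<pi>] by blast
    qed
    interpret R: fin_dim_space R "(\<lambda>i. Poly_Mapping.single i 1) ` {..<triv_rank \<tau>}"
      unfolding R_def by (rule coord_space_fin_dim) simp
    show "limitin (Grass_topology R) (\<lambda>x. {0}) {0} \<F>"
      using subspace_0[OF R.subspace_V] by (simp add: limitin_const_iff Grass_def)
    show "\<exists>v\<in>coord_space I. \<phi> p t v - w \<in> {0}" if w: "w \<in> R" for w
    proof -
      have "w \<in> triv_map \<tau> p ` fibre E p"
        using w bij_betw_imp_surj_on[OF triv_bij[OF \<tau>]] by (simp add: R_def)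
      then obtain e where e: "e \<in> fibre E p" "triv_map \<tau> p e = w" by blast
      obtain v where "v \<in> coord_space I" "nat_map I X k p t v = e" using nat_map_surj[OF gf p t e(1)] .
      then show ?thesis using eq[OF \<tau>(2)] e(2) by auto
    qed
    show "finite {..<triv_rank \<tau>}" by simp
  qed (rule lin)+
  then have lim: "limitin (Grass_topology (coord_space I))
      (\<lambda>x. {v \<in> coord_space I. \<phi> (\<pi> x) (s x) v \<in> {0}}) (nat_ker I X k p t) \<F>"
    by (simp only: ker[OF \<tau>(2)])
  have "eventually (\<lambda>x. {v \<in> coord_space I. \<phi> (\<pi> x) (s x) v \<in> {0}} = nat_ker I X k (\<pi> x) (s x)) \<F>"
    using ev by eventually_elim (simp only: ker)
  then show ?thesis using lim by (rule limitin_transform_eventually)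
qed


section \<open>Kernel vectors at time zero extend to nearby kernels\<close>

text \<open>Lying in the denominator, the degree \<open>l\<close> part of a kernel vector is a
  combination of generators of lower degree and of generators of degree \<open>l\<close> with
  coefficients vanishing at \<open>p\<close>. The levels outside \<open>1..N\<close> are added so
  that all degrees occurring in \<open>I\<close> are covered.\<close>

lemma kernel_coefficients:
  assumes gf: "generating_family E F N U I X k" and p: "p \<in> U"
    and v: "nat_map0 E F N I X k p v = gr_zero E F N p"
  obtains c where "\<And>i. i \<in> I \<Longrightarrow> smooth_map (base E) U (c i)" "\<And>i. i \<in> I \<Longrightarrow> l < k i \<Longrightarrow> c i = (\<lambda>_. 0)"
    "\<And>i. i \<in> I \<Longrightarrow> k i = l \<Longrightarrow> c i p = 0"
    "\<And>q. q \<in> U \<Longrightarrow> (\<Sum>i\<in>{i\<in>I. k i = l}. Poly_Mapping.lookup v i *\<^sub>R X i q) = (\<Sum>i\<in>I. c i q *\<^sub>R X i q)"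
proof -
  define Y where "Y = (\<lambda>q. \<Sum>i\<in>{i\<in>I. k i = l}. Poly_Mapping.lookup v i *\<^sub>R X i q)"
  have Y: "Y \<in> F l" unfolding Y_def by (rule homogeneous_mem[OF gf])
  consider "l = 0" | "l \<in> {1..N}" | "l > N" by fastforce
  then show ?thesis
  proof cases
    case 1
    then have "Y = (\<lambda>_. 0)" using Y F_0 by simp
    then have "(\<Sum>i\<in>{i\<in>I. k i = l}. Poly_Mapping.lookup v i *\<^sub>R X i q) = 0" for q
      unfolding Y_def by meson
    then show ?thesis by (intro that[of "\<lambda>_ _. 0"]) (simp_all add: smooth_map_const)
  next
    case 2
    then have "Y \<in> gr_denom E F p l" using v unfolding nat_map0_eq_zero_iff Y_def by blast
    then obtain A Z where "denom_rep p l Y A Z" unfolding gr_denom_iff by blast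
    then have AZ: "Y = (\<lambda>q. A q + Z q)" "A \<in> F (l - 1)" "Z \<in> vanishing_mult E p (F l)"
      by (auto simp: denom_rep_def)
    obtain m h B where "vanishing_rep p (F l) Z m h B" using AZ(3) unfolding vanishing_mult_iff by blast
    then have hB: "Z = (\<lambda>q. \<Sum>j<m. h j q *\<^sub>R B j q)"
      "\<And>j. j < m \<Longrightarrow> smooth_map (base E) (pts E) (h j)" "\<And>j. j < m \<Longrightarrow> h j p = 0"
      "\<And>j. j < m \<Longrightarrow> B j \<in> F l"
      by (auto simp: vanishing_rep_def)
    obtain a where a: "\<And>i. i \<in> I \<Longrightarrow> smooth_map (base E) U (a i)"
      "\<And>i. i \<in> I \<Longrightarrow> min (l - 1) N < k i \<Longrightarrow> a i = (\<lambda>_. 0)"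
      "\<And>q. q \<in> U \<Longrightarrow> A q = (\<Sum>i\<in>I. a i q *\<^sub>R X i q)"
      using gen_representation[OF gf AZ(2)] by blast
    have "\<exists>b. (\<forall>i\<in>I. smooth_map (base E) U (b i)) \<and> (\<forall>i\<in>I. min l N < k i \<longrightarrow> b i = (\<lambda>_. 0)) \<and>
        (\<forall>q\<in>U. B j q = (\<Sum>i\<in>I. b i q *\<^sub>R X i q))" if "j < m" for j
      using gen_representation[OF gf hB(4)[OF that]] by metis
    then obtain b where b: "\<And>j. j < m \<Longrightarrow> (\<forall>i\<in>I. smooth_map (base E) U (b j i)) \<and>
        (\<forall>i\<in>I. min l N < k i \<longrightarrow> b j i = (\<lambda>_. 0)) \<and> (\<forall>q\<in>U. B j q = (\<Sum>i\<in>I. b j i q *\<^sub>R X i q))"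
      by metis
    \<comment> \<open>The contribution of \<open>F (l - 1)\<close>, which has no terms of degree
      \<open>l\<close>, and that of \<open>F l\<close>, where the factors \<open>h j\<close> vanish
      at \<open>p\<close>.\<close>
    define c where "c = (\<lambda>i q. a i q + (\<Sum>j<m. h j q *\<^sub>R b j i q))"
    have "smooth_map (base E) U (c i)" if "i \<in> I" for i
      unfolding c_def using a(1) b that
      by (intro smooth_map_add smooth_map_sum smooth_map_scaleR smooth_map_subset[OF hB(2) gf_pts[OF gf]]) auto
    moreover have "c i = (\<lambda>_. 0)" if i: "i \<in> I" "l < k i" for i
    proof -
      have "a i = (\<lambda>_. 0)" using a(2)[OF i(1)] i(2) by simp
      moreover have "b j i = (\<lambda>_. 0)" if "j < m" for j using b[OF that] i by simp
      ultimately show ?thesis by (simp add: c_def fun_eq_iff)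
    qed
    moreover have "c i p = 0" if i: "i \<in> I" "k i = l" for i
    proof -
      have "min (l - 1) N < k i" using 2 i(2) by auto
      then show ?thesis using a(2)[OF i(1)] hB(3) by (simp add: c_def)
    qed
    moreover have "Y q = (\<Sum>i\<in>I. c i q *\<^sub>R X i q)" if q: "q \<in> U" for q
    proof -
      have "Z q = (\<Sum>j<m. \<Sum>i\<in>I. (h j q * b j i q) *\<^sub>R X i q)"
        unfolding hB(1) using b q by (simp add: scaleR_sum_right)
      also have "\<dots> = (\<Sum>i\<in>I. \<Sum>j<m. (h j q * b j i q) *\<^sub>R X i q)" by (rule sum.swap)
      also have "\<dots> = (\<Sum>i\<in>I. (\<Sum>j<m. h j q *\<^sub>R b j i q) *\<^sub>R X i q)" by (simp add: scaleR_sum_left)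
      finally show ?thesis using a(3)[OF q] by (simp add: AZ(1) c_def scaleR_add_left sum.distrib)
    qed
    ultimately show ?thesis unfolding Y_def by (rule that)
  next
    case 3
    \<comment> \<open>Here the kernel condition says nothing about degree \<open>l\<close>, but
      \<open>F l\<close> is already generated in degrees up to \<open>N < l\<close>, so no
      coefficient of degree \<open>l\<close> occurs.\<close>
    obtain c where c: "\<And>i. i \<in> I \<Longrightarrow> smooth_map (base E) U (c i)"
      "\<And>i. i \<in> I \<Longrightarrow> min l N < k i \<Longrightarrow> c i = (\<lambda>_. 0)"
      "\<And>q. q \<in> U \<Longrightarrow> Y q = (\<Sum>i\<in>I. c i q *\<^sub>R X i q)"
      using gen_representation[OF gf Y] by blast
    show ?thesis
    proof (rule that)
      show "smooth_map (base E) U (c i)" if "i \<in> I" for i by (rule c(1)[OF that])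
      show "c i = (\<lambda>_. 0)" if "i \<in> I" "l < k i" for i using c(2)[of i] that by simp
      show "c i p = 0" if "i \<in> I" "k i = l" for i using c(2)[of i] that 3 by simp
      show "(\<Sum>i\<in>{i\<in>I. k i = l}. Poly_Mapping.lookup v i *\<^sub>R X i q) = (\<Sum>i\<in>I. c i q *\<^sub>R X i q)"
        if "q \<in> U" for q using c(3)[OF that] unfolding Y_def .
    qed
  qed
qed

text \<open>The relation in each degree is weighted by powers of \<open>t\<close> and subtracted
  from \<open>v\<close>; in the limit only the terms with \<open>l = k i\<close> could survive, and
  their coefficients vanish at \<open>p\<close>. The choice of \<open>w\<close> precedes that of the
  filter.\<close>

lemma kernel_extension:
  assumes gf: "generating_family E F N U I X k" and p: "p \<in> U" and vI: "v \<in> coord_space I"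
    and v: "nat_map0 E F N I X k p v = gr_zero E F N p"
  obtains w where "\<And>q t. q \<in> U \<Longrightarrow> w q t \<in> nat_ker I X k q t"
    "\<And>(\<pi> :: 'x \<Rightarrow> 'p) s \<F>. limitin T \<pi> p \<F> \<Longrightarrow> (s \<longlongrightarrow> 0) \<F> \<Longrightarrow> ((\<lambda>x. w (\<pi> x) (s x)) \<longlongrightarrow> v) \<F>"
proof -
  have fin: "finite I" using gf_finite[OF gf] .
  define P where "P = (\<lambda>l c. (\<forall>i\<in>I. smooth_map (base E) U (c i)) \<and> (\<forall>i\<in>I. l < k i \<longrightarrow> c i = (\<lambda>_. 0)) \<and>
    (\<forall>i\<in>I. k i = l \<longrightarrow> c i p = 0) \<and>
    (\<forall>q\<in>U. (\<Sum>i\<in>{i\<in>I. k i = l}. Poly_Mapping.lookup v i *\<^sub>R X i q) = (\<Sum>i\<in>I. c i q *\<^sub>R X i q)))"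
  have "\<exists>c. P l c" for l
    by (rule kernel_coefficients[OF gf p v, of l]) (use P_def in blast)
  then obtain c where "\<And>l. P l (c l)" by metis
  then have c: "\<And>l. (\<forall>i\<in>I. smooth_map (base E) U (c l i)) \<and> (\<forall>i\<in>I. l < k i \<longrightarrow> c l i = (\<lambda>_. 0)) \<and>
    (\<forall>i\<in>I. k i = l \<longrightarrow> c l i p = 0) \<and>
    (\<forall>q\<in>U. (\<Sum>i\<in>{i\<in>I. k i = l}. Poly_Mapping.lookup v i *\<^sub>R X i q) = (\<Sum>i\<in>I. c l i q *\<^sub>R X i q))"
    unfolding P_def .
  \<comment> \<open>Where \<open>l < k i\<close> the exponent is truncated to 0, but there
    \<open>c l i\<close> is zero.\<close>
  define w where "w = (\<lambda>q t. coord_vec I (\<lambda>i. Poly_Mapping.lookup v i - (\<Sum>l\<in>k`I. t ^ (l - k i) * c l i q)))"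
  have "w q t \<in> nat_ker I X k q t" if q: "q \<in> U" for q t
  proof -
    have "nat_map I X k q t (w q t) = (\<Sum>i\<in>I. Poly_Mapping.lookup v i *\<^sub>R (t ^ k i *\<^sub>R X i q)) -
        (\<Sum>i\<in>I. (\<Sum>l\<in>k`I. t ^ (l - k i) * c l i q) *\<^sub>R (t ^ k i *\<^sub>R X i q))"
      unfolding nat_map_def w_def by (simp add: lookup_coord_vec[OF fin] left_diff_distrib scaleR_diff_left sum_subtractf)
    also have "(\<Sum>i\<in>I. (\<Sum>l\<in>k`I. t ^ (l - k i) * c l i q) *\<^sub>R (t ^ k i *\<^sub>R X i q)) =
        (\<Sum>i\<in>I. \<Sum>l\<in>k`I. t ^ l *\<^sub>R (c l i q *\<^sub>R X i q))"
      unfolding scaleR_sum_left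
    proof (intro sum.cong refl)
      fix i l assume i: "i \<in> I"
      show "(t ^ (l - k i) * c l i q) *\<^sub>R (t ^ k i *\<^sub>R X i q) = t ^ l *\<^sub>R (c l i q *\<^sub>R X i q)"
      proof (cases "l < k i")
        case True
        then show ?thesis using c i by simp
      next
        case False
        then have "t ^ (l - k i) * t ^ k i = t ^ l" by (simp flip: power_add)
        then show ?thesis by (simp add: mult_ac)
      qed
    qed
    also have "\<dots> = (\<Sum>l\<in>k`I. \<Sum>i\<in>I. t ^ l *\<^sub>R (c l i q *\<^sub>R X i q))" by (rule sum.swap)
    also have "\<dots> = (\<Sum>l\<in>k`I. t ^ l *\<^sub>R (\<Sum>i\<in>{i\<in>I. k i = l}. Poly_Mapping.lookup v i *\<^sub>R X i q))"
      using c q by (simp add: scaleR_sum_right)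
    also have "\<dots> = (\<Sum>l\<in>k`I. \<Sum>i\<in>{i\<in>I. k i = l}. Poly_Mapping.lookup v i *\<^sub>R (t ^ k i *\<^sub>R X i q))"
      unfolding scaleR_sum_right by (intro sum.cong refl) (auto simp: mult.commute)
    also have "\<dots> = (\<Sum>i\<in>I. Poly_Mapping.lookup v i *\<^sub>R (t ^ k i *\<^sub>R X i q))"
      by (rule sum.image_gen[OF fin, symmetric])
    finally show ?thesis by (simp add: nat_ker_def w_def coord_vec_in[OF fin])
  qed
  moreover have "((\<lambda>x. w (\<pi> x) (s x)) \<longlongrightarrow> v) \<F>"
    if \<pi>: "limitin T \<pi> p \<F>" and s: "(s \<longlongrightarrow> 0) \<F>" for \<pi> :: "'x \<Rightarrow> 'p" and s \<F>
  proof -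
    have "((\<lambda>x. w (\<pi> x) (s x)) \<longlongrightarrow> coord_vec I (\<lambda>i. Poly_Mapping.lookup v i - (\<Sum>l\<in>k`I. 0 ^ (l - k i) * c l i p))) \<F>"
      unfolding w_def
      by (intro tendsto_coord_vec tendsto_diff tendsto_const tendsto_sum tendsto_mult tendsto_power s
        smooth_map_tendsto[OF gf_open[OF gf] p _ \<pi>]) (use c in auto)
    \<comment> \<open>For \<open>l = k i\<close> the power is 1 and the coefficient vanishes at
      \<open>p\<close>; for \<open>l > k i\<close> the power vanishes; for \<open>l < k i\<close>
      the coefficient is identically zero.\<close>
    moreover have z: "0 ^ (l - k i) * c l i p = 0" if "i \<in> I" for l i
      using c[of l] that by (cases l "k i" rule: linorder_cases) auto
    have "coord_vec I (\<lambda>i. Poly_Mapping.lookup v i - (\<Sum>l\<in>k`I. 0 ^ (l - k i) * c l i p)) =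
        coord_vec I (Poly_Mapping.lookup v)"
      unfolding coord_vec_def by (rule sum.cong[OF refl]) (simp only: z sum.neutral_const diff_zero)
    then have "coord_vec I (\<lambda>i. Poly_Mapping.lookup v i - (\<Sum>l\<in>k`I. 0 ^ (l - k i) * c l i p)) = v"
      using coord_vec_lookup[OF fin vI] by simp
    ultimately show ?thesis by simp
  qed
  ultimately show ?thesis using that by blast
qed

text \<open>The extended vectors lie in the converging kernels, and incidence is a closed
  relation.\<close>

lemma kernel_subset_limit:
  fixes \<pi> :: "'x \<Rightarrow> 'p"
  assumes gf: "generating_family E F N U I X k" and p: "p \<in> U" and \<pi>: "limitin T \<pi> p \<F>" and s: "(s \<longlongrightarrow> 0) \<F>"
    and K: "limitin (Grass_topology (coord_space I)) (\<lambda>x. nat_ker I X k (\<pi> x) (s x)) K \<F>" and nt: "\<F> \<noteq> bot"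
    and v: "v \<in> coord_space I" "nat_map0 E F N I X k p v = gr_zero E F N p"
  shows "v \<in> K"
proof -
  interpret G: fin_dim_space "coord_space I" "(\<lambda>i. Poly_Mapping.single i 1) ` I"
    by (rule coord_space_fin_dim[OF gf_finite[OF gf]])
  obtain w where w: "\<And>q t. q \<in> U \<Longrightarrow> w q t \<in> nat_ker I X k q t"
    "\<And>(\<pi> :: 'x \<Rightarrow> 'p) s \<F>. limitin T \<pi> p \<F> \<Longrightarrow> (s \<longlongrightarrow> 0) \<F> \<Longrightarrow> ((\<lambda>x. w (\<pi> x) (s x)) \<longlongrightarrow> v) \<F>"
    using kernel_extension[OF gf p v] by blast
  have "eventually (\<lambda>x. \<pi> x \<in> U) \<F>" using limitinD[OF \<pi> gf_open[OF gf] p] .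
  then have "eventually (\<lambda>x. w (\<pi> x) (s x) \<in> nat_ker I X k (\<pi> x) (s x)) \<F>"
    by eventually_elim (rule w(1))
  then show ?thesis by (rule G.limitin_Grass_mem[OF K w(2)[OF \<pi> s] _ nt])
qed


section \<open>Change of generating family\<close>

text \<open>The Grassmannian component of \<open>iota\<close> over both kinds of points, so that a
  change of generating family is one statement for positive and zero time.\<close>

definition kern :: "'i set \<Rightarrow> ('i \<Rightarrow> 'p \<Rightarrow> 'v) \<Rightarrow> ('i \<Rightarrow> nat) \<Rightarrow> ('p, 'v) dpoint \<Rightarrow> ('i \<Rightarrow>\<^sub>0 real) set"
  where "kern I X k z = (case z of Inl (p, t) \<Rightarrow> nat_ker I X k p t
    | Inr (p, L) \<Rightarrow> nat_preimage E F N I X k p L)"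

lemma iota_eq: "iota E F N I X k z = (fst (beta z), kern I X k z, snd (beta z))"
  by (cases z) (auto simp: kern_def)

text \<open>The points that would lie over \<open>U \<times> \<real>\<^sub>+\<close> if \<open>B_fibre\<close> were all of \<open>Grass_gr\<close>.\<close>

definition big_over :: "'p set \<Rightarrow> ('p, 'v) dpoint set"
  where "big_over U = (U \<times> {0<..}) <+> (SIGMA p:U. Grass_gr E F N p)"

lemma big_over_cases:
  assumes "z \<in> big_over U"
  obtains (pos) p t where "z = Inl (p, t)" "p \<in> U" "t > 0"
    | (zero) p L where "z = Inr (p, L)" "p \<in> U" "L \<in> Grass_gr E F N p"
  using assms by (auto simp: big_over_def)

lemma kern_Grass: "z \<in> big_over U \<Longrightarrow> kern I X k z \<in> Grass (coord_space I)"
  by (erule big_over_cases) (auto simp: kern_def nat_ker_Grass nat_preimage_Grass)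

definition transition_coeffs ::
    "'p set \<Rightarrow> 'i set \<Rightarrow> ('i \<Rightarrow> 'p \<Rightarrow> 'v) \<Rightarrow> ('i \<Rightarrow> nat) \<Rightarrow> 'j set \<Rightarrow> ('j \<Rightarrow> 'p \<Rightarrow> 'v) \<Rightarrow> ('j \<Rightarrow> nat) \<Rightarrow>
      ('j \<Rightarrow> 'i \<Rightarrow> 'p \<Rightarrow> real) \<Rightarrow> bool"
  where "transition_coeffs U I X k J Y k' f \<longleftrightarrow> (\<forall>j\<in>J.
    (\<forall>i\<in>I. smooth_map (base E) U (f j i)) \<and>
    (\<forall>i\<in>I. k' j < k i \<longrightarrow> f j i = (\<lambda>_. 0)) \<and>
    (\<forall>q\<in>U. Y j q = (\<Sum>i\<in>I. f j i q *\<^sub>R X i q)))"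

lemma transition_coeffs_exist:
  assumes gf: "generating_family E F N U I X k" and gf': "generating_family E F N U' J Y k'"
  obtains f where "transition_coeffs U I X k J Y k' f"
proof -
  define P where "P = (\<lambda>j f. (\<forall>i\<in>I. smooth_map (base E) U (f i)) \<and>
    (\<forall>i\<in>I. k' j < k i \<longrightarrow> f i = (\<lambda>_. 0)) \<and>
    (\<forall>q\<in>U. Y j q = (\<Sum>i\<in>I. f i q *\<^sub>R X i q)))"
  have "\<exists>f. P j f" if j: "j \<in> J" for j
  proof -
    obtain f where "\<And>i. i \<in> I \<Longrightarrow> smooth_map (base E) U (f i)"
      "\<And>i. i \<in> I \<Longrightarrow> min (k' j) N < k i \<Longrightarrow> f i = (\<lambda>_. 0)"
      "\<And>q. q \<in> U \<Longrightarrow> Y j q = (\<Sum>i\<in>I. f i q *\<^sub>R X i q)"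
      using gen_representation[OF gf gf_mem[OF gf' j]] by blast
    then show ?thesis unfolding P_def by (intro exI[of _ f]) simp
  qed
  then obtain f where "\<And>j. j \<in> J \<Longrightarrow> P j (f j)" by metis
  then show ?thesis using that[of f] by (simp add: transition_coeffs_def P_def)
qed

text \<open>The matrix with entries t^(k'(j)-k(i)) f_ji(p). Subtraction is truncated only where
  \<open>f j i\<close> vanishes, so the entries are polynomial in \<open>t\<close>, and at
  \<open>t = 0\<close> the convention \<open>0 ^ 0 = 1\<close> keeps the degree-preserving
  block.\<close>

definition transition ::
    "'i set \<Rightarrow> 'j set \<Rightarrow> ('i \<Rightarrow> nat) \<Rightarrow> ('j \<Rightarrow> nat) \<Rightarrow> ('j \<Rightarrow> 'i \<Rightarrow> 'p \<Rightarrow> real) \<Rightarrow> 'p \<Rightarrow> real \<Rightarrow>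
      ('j \<Rightarrow>\<^sub>0 real) \<Rightarrow> ('i \<Rightarrow>\<^sub>0 real)"
  where "transition I J k k' f p t v =
    coord_vec I (\<lambda>i. \<Sum>j\<in>J. t ^ (k' j - k i) * f j i p * Poly_Mapping.lookup v j)"

lemma linear_transition: "linear (transition I J k k' f p t)"
  unfolding transition_def coord_vec_def
  by (rule linearI)
    (simp_all add: lookup_add distrib_left distrib_right sum.distrib scaleR_add_left scaleR_sum_right sum_distrib_left mult_ac)

text \<open>The powers combine to t^(k'(j)-k(i)) t^k(i) = t^k'(j) wherever the coefficient is
  nonzero.\<close>

lemma nat_map_transition:
  assumes fin: "finite I" and f: "transition_coeffs U I X k J Y k' f" and p: "p \<in> U"
  shows "nat_map I X k p t (transition I J k k' f p t v) = nat_map J Y k' p t v"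
proof -
  have "nat_map I X k p t (transition I J k k' f p t v) =
      (\<Sum>i\<in>I. (\<Sum>j\<in>J. t ^ (k' j - k i) * f j i p * Poly_Mapping.lookup v j) *\<^sub>R (t ^ k i *\<^sub>R X i p))"
    unfolding nat_map_def transition_def by (simp add: lookup_coord_vec[OF fin])
  also have "\<dots> = (\<Sum>i\<in>I. \<Sum>j\<in>J. Poly_Mapping.lookup v j *\<^sub>R (t ^ k' j *\<^sub>R (f j i p *\<^sub>R X i p)))"
    unfolding scaleR_sum_left
  proof (intro sum.cong refl)
    fix i j assume ij: "i \<in> I" "j \<in> J"
    show "(t ^ (k' j - k i) * f j i p * Poly_Mapping.lookup v j) *\<^sub>R (t ^ k i *\<^sub>R X i p) =
        Poly_Mapping.lookup v j *\<^sub>R (t ^ k' j *\<^sub>R (f j i p *\<^sub>R X i p))"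
    proof (cases "k' j < k i")
      case True
      then have "f j i = (\<lambda>_. 0)" using f ij by (auto simp: transition_coeffs_def)
      then show ?thesis by simp
    next
      case False
      then have "t ^ (k' j - k i) * t ^ k i = t ^ k' j" by (simp flip: power_add)
      then have "t ^ (k' j - k i) * f j i p * Poly_Mapping.lookup v j * t ^ k i =
          Poly_Mapping.lookup v j * (t ^ k' j * f j i p)"
        by (simp add: mult_ac)
      then show ?thesis by simp
    qed
  qed
  also have "\<dots> = (\<Sum>j\<in>J. \<Sum>i\<in>I. Poly_Mapping.lookup v j *\<^sub>R (t ^ k' j *\<^sub>R (f j i p *\<^sub>R X i p)))"
    by (rule sum.swap)
  also have "\<dots> = nat_map J Y k' p t v"
    unfolding nat_map_def
  proof (rule sum.cong[OF refl])
    fix j assume "j \<in> J"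
    then have "Y j p = (\<Sum>i\<in>I. f j i p *\<^sub>R X i p)" using f p by (auto simp: transition_coeffs_def)
    then show "(\<Sum>i\<in>I. Poly_Mapping.lookup v j *\<^sub>R (t ^ k' j *\<^sub>R (f j i p *\<^sub>R X i p))) =
        Poly_Mapping.lookup v j *\<^sub>R (t ^ k' j *\<^sub>R Y j p)"
      by (simp only: scaleR_sum_right)
  qed
  finally show ?thesis .
qed

text \<open>Only the degree-preserving block is left at \<open>t = 0\<close>. The lower-degree terms
  it drops are zero in the graded space, and so is the variation of the coefficients away from
  \<open>p\<close>; this is \<open>local_representation_gr\<close> applied to a homogeneous
  combination of the \<open>Y j\<close>.\<close>

lemma nat_map0_transition:
  assumes gf: "generating_family E F N U I X k" and gf': "generating_family E F N U' J Y k'"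
    and f: "transition_coeffs U I X k J Y k' f" and p: "p \<in> U"
  shows "nat_map0 E F N I X k p (transition I J k k' f p 0 v) = nat_map0 E F N J Y k' p v"
proof -
  have fin: "finite I" "finite J" using gf_finite[OF gf] gf_finite[OF gf'] by auto
  have "gr_coset E F p l (\<lambda>q. \<Sum>i\<in>{i\<in>I. k i = l}. Poly_Mapping.lookup (transition I J k k' f p 0 v) i *\<^sub>R X i q) =
      gr_coset E F p l (\<lambda>q. \<Sum>j\<in>{j\<in>J. k' j = l}. Poly_Mapping.lookup v j *\<^sub>R Y j q)"
    if l: "l \<in> {1..N}" for l
  proof -
    define W where "W = (\<lambda>q. \<Sum>j\<in>{j\<in>J. k' j = l}. Poly_Mapping.lookup v j *\<^sub>R Y j q)"
    define g where "g = (\<lambda>i q. \<Sum>j\<in>{j\<in>J. k' j = l}. Poly_Mapping.lookup v j *\<^sub>R f j i q)"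
    have "(\<lambda>q. W q - (\<Sum>i\<in>{i\<in>I. k i = l}. g i p *\<^sub>R X i q)) \<in> gr_denom E F p l"
    proof (rule local_representation_gr[OF fin(1) gf_mem[OF gf] gf_open[OF gf] p])
      show "1 \<le> l" using l by simp
      show "W \<in> F l" unfolding W_def by (rule homogeneous_mem[OF gf'])
      show "smooth_map (base E) U (g i)" if "i \<in> I" for i
        unfolding g_def using f that
        by (intro smooth_map_sum smooth_map_scaleR smooth_map_const) (auto simp: transition_coeffs_def)
      show "g i = (\<lambda>_. 0)" if "i \<in> I" "l < k i" for i
      proof -
        have "f j i = (\<lambda>_. 0)" if "j \<in> {j\<in>J. k' j = l}" for j
          using f that \<open>i \<in> I\<close> \<open>l < k i\<close> by (auto simp: transition_coeffs_def)
        then show ?thesis unfolding g_def by (intro ext sum.neutral) simp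
      qed
      show "W q = (\<Sum>i\<in>I. g i q *\<^sub>R X i q)" if q: "q \<in> U" for q
      proof -
        have "W q = (\<Sum>j\<in>{j\<in>J. k' j = l}. \<Sum>i\<in>I. (Poly_Mapping.lookup v j *\<^sub>R f j i q) *\<^sub>R X i q)"
          unfolding W_def using f q
          by (intro sum.cong refl) (auto simp: transition_coeffs_def scaleR_sum_right)
        also have "\<dots> = (\<Sum>i\<in>I. \<Sum>j\<in>{j\<in>J. k' j = l}. (Poly_Mapping.lookup v j *\<^sub>R f j i q) *\<^sub>R X i q)"
          by (rule sum.swap)
        finally show ?thesis unfolding g_def scaleR_sum_left .
      qed
    qed
    moreover have "g i p = Poly_Mapping.lookup (transition I J k k' f p 0 v) i" if i: "i \<in> {i\<in>I. k i = l}" for i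
    proof -
      have "Poly_Mapping.lookup (transition I J k k' f p 0 v) i =
          (\<Sum>j\<in>J. 0 ^ (k' j - l) * f j i p * Poly_Mapping.lookup v j)"
        using i by (simp add: transition_def lookup_coord_vec[OF fin(1)])
      also have "\<dots> = (\<Sum>j\<in>{j\<in>J. k' j = l}. Poly_Mapping.lookup v j *\<^sub>R f j i p)"
      proof (rule sum.mono_neutral_cong_right)
        show "\<forall>j\<in>J - {j\<in>J. k' j = l}. 0 ^ (k' j - l) * f j i p * Poly_Mapping.lookup v j = 0"
        proof
          fix j assume j: "j \<in> J - {j\<in>J. k' j = l}"
          then consider "k' j < l" | "k' j > l" by fastforce
          then show "0 ^ (k' j - l) * f j i p * Poly_Mapping.lookup v j = 0"
          proof cases
            case 1
            then have "f j i = (\<lambda>_. 0)" using f i j by (auto simp: transition_coeffs_def)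
            then show ?thesis by simp
          qed simp
        qed
      qed (use fin in auto)
      finally show ?thesis by (simp add: g_def)
    qed
    then have "(\<Sum>i\<in>{i\<in>I. k i = l}. g i p *\<^sub>R X i q) =
        (\<Sum>i\<in>{i\<in>I. k i = l}. Poly_Mapping.lookup (transition I J k k' f p 0 v) i *\<^sub>R X i q)" for q
      by (intro sum.cong refl) simp
    ultimately show ?thesis by (simp add: gr_coset_eq_iff W_def[symmetric] eq_commute[of _ "gr_coset E F p l W"])
  qed
  then show ?thesis unfolding nat_map0_def restrict_eq_iff by blast
qed

lemma kern_transition:
  assumes gf: "generating_family E F N U I X k" and gf': "generating_family E F N U' J Y k'"
    and f: "transition_coeffs U I X k J Y k' f" and z: "z \<in> big_over U"
  shows "kern J Y k' z =
    {v \<in> coord_space J. transition I J k k' f (fst (beta z)) (snd (beta z)) v \<in> kern I X k z}"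
proof -
  have fin: "finite I" using gf_finite[OF gf] .
  have tr: "transition I J k k' f p t v \<in> coord_space I" for p t v
    unfolding transition_def by (rule coord_vec_in[OF fin])
  from z show ?thesis
  proof (cases rule: big_over_cases)
    case (pos p t)
    then show ?thesis using nat_map_transition[OF fin f pos(2)] tr by (simp add: kern_def nat_ker_def)
  next
    case (zero p L)
    then show ?thesis using nat_map0_transition[OF gf gf' f zero(2)] tr by (simp add: kern_def nat_preimage_def)
  qed
qed

text \<open>Surjectivity of the natural map of \<open>Y\<close> gives \<open>v\<close> with the same
  image as \<open>w\<close> under that of \<open>X\<close>; then the transition of \<open>v\<close>
  differs from \<open>w\<close> by a kernel vector, and kernel vectors belong to \<open>kern\<close>
  at every time.\<close>

lemma transition_transversal:
  assumes gf: "generating_family E F N U I X k" and gf': "generating_family E F N U' J Y k'"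
    and f: "transition_coeffs U I X k J Y k' f" and z: "z \<in> big_over (U \<inter> U')" and w: "w \<in> coord_space I"
  shows "\<exists>v\<in>coord_space J. transition I J k k' f (fst (beta z)) (snd (beta z)) v - w \<in> kern I X k z"
proof -
  have fin: "finite I" using gf_finite[OF gf] .
  have tr: "transition I J k k' f p t v - w \<in> coord_space I" for p t v
    using coord_vec_in[OF fin] w unfolding transition_def by (intro subspace_diff[OF subspace_coord_space])
  from z show ?thesis
  proof (cases rule: big_over_cases)
    case (pos p t)
    then have p: "p \<in> U" "p \<in> U'" by auto
    obtain v where v: "v \<in> coord_space J" "nat_map J Y k' p t v = nat_map I X k p t w"
      using nat_map_surj[OF gf' p(2) pos(3) nat_map_fibre[OF gf p(1)]] .
    have "nat_map I X k p t (transition I J k k' f p t v - w) = 0"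
      using nat_map_transition[OF fin f p(1)] v(2) by (simp add: linear_diff[OF linear_nat_map])
    then show ?thesis using pos v(1) tr by (auto simp: kern_def nat_ker_def)
  next
    case (zero p L)
    then have p: "p \<in> U" "p \<in> U'" by auto
    obtain v where v: "v \<in> coord_space J" "nat_map0 E F N J Y k' p v = nat_map0 E F N I X k p w"
      using nat_map0_surj[OF gf' p(2) nat_map0_mem[OF gf]] .
    have "nat_map0 E F N I X k p (transition I J k k' f p 0 v - w) = gr_zero E F N p"
      using nat_map0_transition[OF gf gf' f p(1)] v(2) by (intro nat_map0_diff_zero) simp
    then have "transition I J k k' f p 0 v - w \<in> kern I X k z"
      using zero tr by (simp add: kern_def nat_preimage_def Grass_gr_def)
    then show ?thesis using zero(1) v(1) by (intro bexI[of _ v]) simp_all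
  qed
qed

text \<open>The moving points enter through the preimage formula of \<open>kern_transition\<close>,
  valid over \<open>U\<close>; transversality is asked at the limit point, which therefore lies over
  both sets. Continuity of the matrix comes from that of its smooth entries and of the powers of
  time.\<close>

lemma kern_limit:
  assumes gf: "generating_family E F N U I X k" and gf': "generating_family E F N U' J Y k'"
    and z0: "z0 \<in> big_over (U \<inter> U')" and z: "eventually (\<lambda>x. z x \<in> big_over U) \<F>"
    and base: "limitin T (\<lambda>x. fst (beta (z x))) (fst (beta z0)) \<F>"
    and time: "((\<lambda>x. snd (beta (z x))) \<longlongrightarrow> snd (beta z0)) \<F>"
    and ker: "limitin (Grass_topology (coord_space I)) (\<lambda>x. kern I X k (z x)) (kern I X k z0) \<F>"
  shows "limitin (Grass_topology (coord_space J)) (\<lambda>x. kern J Y k' (z x)) (kern J Y k' z0) \<F>"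
proof -
  have fin: "finite I" "finite J" using gf_finite[OF gf] gf_finite[OF gf'] by auto
  obtain f where f: "transition_coeffs U I X k J Y k' f" using transition_coeffs_exist[OF gf gf'] .
  have z0': "z0 \<in> big_over U" using z0 by (auto simp: big_over_def)
  have p0: "fst (beta z0) \<in> U" using z0 by (auto simp: big_over_def)
  have "limitin (Grass_topology (coord_space J))
      (\<lambda>x. {v \<in> coord_space J. transition I J k k' f (fst (beta (z x))) (snd (beta (z x))) v \<in> kern I X k (z x)})
      {v \<in> coord_space J. transition I J k k' f (fst (beta z0)) (snd (beta z0)) v \<in> kern I X k z0} \<F>"
  proof (rule limitin_Grass_preimage[OF coord_space_fin_dim[OF fin(2)] coord_space_fin_dim[OF fin(1)],
      where \<phi> = "\<lambda>x. transition I J k k' f (fst (beta (z x))) (snd (beta (z x)))"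
        and \<psi> = "transition I J k k' f (fst (beta z0)) (snd (beta z0))"
        and \<kappa> = "\<lambda>x. kern I X k (z x)" and K = "kern I X k z0"])
    have tr: "transition I J k k' f p t ` coord_space J \<subseteq> coord_space I" for p t
      using coord_vec_in[OF fin(1)] by (auto simp: transition_def)
    show "eventually (\<lambda>x. transition I J k k' f (fst (beta (z x))) (snd (beta (z x))) ` coord_space J \<subseteq> coord_space I) \<F>"
      by (rule always_eventually) (blast intro: tr[THEN subsetD])
    show "transition I J k k' f (fst (beta z0)) (snd (beta z0)) ` coord_space J \<subseteq> coord_space I" by (rule tr)
    show "((\<lambda>x. transition I J k k' f (fst (beta (z x))) (snd (beta (z x))) v) \<longlongrightarrow>
        transition I J k k' f (fst (beta z0)) (snd (beta z0)) v) \<F>" for v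
      unfolding transition_def
      by (intro tendsto_coord_vec tendsto_sum tendsto_mult tendsto_const tendsto_power time
        smooth_map_tendsto[OF gf_open[OF gf] p0 _ base]) (use f in \<open>auto simp: transition_coeffs_def\<close>)
    show "limitin (Grass_topology (coord_space I)) (\<lambda>x. kern I X k (z x)) (kern I X k z0) \<F>" by (rule ker)
    show "\<exists>v\<in>coord_space J. transition I J k k' f (fst (beta z0)) (snd (beta z0)) v - w \<in> kern I X k z0"
      if "w \<in> coord_space I" for w
      by (rule transition_transversal[OF gf gf' f z0 that])
  qed (rule linear_transition)+
  then have lim: "limitin (Grass_topology (coord_space J))
      (\<lambda>x. {v \<in> coord_space J. transition I J k k' f (fst (beta (z x))) (snd (beta (z x))) v \<in> kern I X k (z x)})
      (kern J Y k' z0) \<F>"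
    by (simp only: kern_transition[OF gf gf' f z0'])
  have "eventually (\<lambda>x. {v \<in> coord_space J. transition I J k k' f (fst (beta (z x))) (snd (beta (z x))) v \<in> kern I X k (z x)}
      = kern J Y k' (z x)) \<F>"
    using z by eventually_elim (rule kern_transition[OF gf gf' f, symmetric])
  then show ?thesis using lim by (rule limitin_transform_eventually)
qed


section \<open>Existence of generating families and independence of the choice\<close>

text \<open>Local generators of the levels \<open>1..N\<close> are put together, those of each level
  tagged with that level as degree, so that the members of degree exactly \<open>l\<close> already
  generate \<open>F l\<close>.\<close>

lemma generating_family_exists:
  assumes p: "p \<in> pts E"
  obtains U and I :: "nat set" and X k where "generating_family E F N U I X k" "p \<in> U"
proof -
  define P where "P = (\<lambda>l U (I::nat set) X. openin T U \<and> p \<in> U \<and> finite I \<and> generated_on E (F l) U I X)"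
  have "\<forall>l. \<exists>U I X. P l U I X"
    using F_lfg p unfolding locally_finitely_generated_def P_def by blast
  then obtain V J Z where VJZ: "\<And>l. P l (V l) (J l) (Z l)" by metis
  then have V: "\<And>l. openin T (V l)" "\<And>l. p \<in> V l" and J: "\<And>l. finite (J l)"
    and Z: "\<And>l. generated_on E (F l) (V l) (J l) (Z l)"
    by (auto simp: P_def)
  \<comment> \<open>Level 0 is included so that the intersection is over a nonempty set when
    \<open>N = 0\<close>.\<close>
  define U where "U = (\<Inter>l\<in>{0..N}. V l)"
  define I where "I = (\<Union>l\<in>{1..N}. (\<lambda>j. prod_encode (l, j)) ` J l)"
  define k where "k = (\<lambda>i. fst (prod_decode i))"
  define X where "X = (\<lambda>i. Z (fst (prod_decode i)) (snd (prod_decode i)))"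
  have fin: "finite I" using J by (auto simp: I_def)
  have I: "i \<in> I \<longleftrightarrow> k i \<in> {1..N} \<and> snd (prod_decode i) \<in> J (k i)" for i
  proof
    assume "i \<in> I"
    then show "k i \<in> {1..N} \<and> snd (prod_decode i) \<in> J (k i)" by (auto simp: I_def k_def)
  next
    assume a: "k i \<in> {1..N} \<and> snd (prod_decode i) \<in> J (k i)"
    have "i = prod_encode (k i, snd (prod_decode i))" by (simp add: k_def)
    then show "i \<in> I" unfolding I_def using a by blast
  qed
  have XF: "X i \<in> F (k i)" if "i \<in> I" for i
    using Z[of "k i"] that I[of i] by (auto simp: X_def k_def generated_on_def)
  have oU: "openin T U" unfolding U_def by (rule openin_INT2) (use V in auto)
  have "generating_family E F N U I X k"
    unfolding generating_family_def
  proof (intro conjI ballI oU fin XF)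
    fix l assume l: "l \<in> {1..N}"
    have UV: "U \<subseteq> V l" using l by (auto simp: U_def)
    have enc: "prod_encode (l, j) \<in> I \<and> k (prod_encode (l, j)) = l \<and> X (prod_encode (l, j)) = Z l j" if "j \<in> J l" for j
      using that l I by (simp add: k_def X_def)
    show "generated_on E (F l) U {i \<in> I. k i \<le> l} X"
      unfolding generated_on_def
    proof (intro conjI ballI)
      fix i assume "i \<in> {i \<in> I. k i \<le> l}"
      then show "X i \<in> F l" using XF F_mono[of "k i" l] by auto
    next
      fix Y assume "Y \<in> F l"
      then obtain g where g: "\<forall>j\<in>J l. smooth_map (base E) (V l) (g j)"
        "\<forall>q\<in>V l. Y q = (\<Sum>j\<in>J l. g j q *\<^sub>R Z l j q)"
        using Z[of l] unfolding generated_on_def by blast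
      \<comment> \<open>The generators of lower degree receive coefficient zero.\<close>
      define f where "f = (\<lambda>i. if k i = l then g (snd (prod_decode i)) else (\<lambda>_. 0))"
      have "smooth_map (base E) U (f i)" if "i \<in> {i \<in> I. k i \<le> l}" for i
        using g(1) that I[of i] smooth_map_subset[OF _ UV] by (auto simp: f_def smooth_map_const)
      moreover have "Y q = (\<Sum>i\<in>{i \<in> I. k i \<le> l}. f i q *\<^sub>R X i q)" if "q \<in> U" for q
      proof -
        have "(\<Sum>i\<in>{i \<in> I. k i \<le> l}. f i q *\<^sub>R X i q) =
            (\<Sum>i\<in>(\<lambda>j. prod_encode (l, j)) ` J l. f i q *\<^sub>R X i q)"
        proof (rule sum.mono_neutral_right)
          show "(\<lambda>j. prod_encode (l, j)) ` J l \<subseteq> {i \<in> I. k i \<le> l}" using enc by auto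
          show "\<forall>i\<in>{i \<in> I. k i \<le> l} - (\<lambda>j. prod_encode (l, j)) ` J l. f i q *\<^sub>R X i q = 0"
          proof
            fix i assume i: "i \<in> {i \<in> I. k i \<le> l} - (\<lambda>j. prod_encode (l, j)) ` J l"
            have "k i \<noteq> l"
            proof
              assume "k i = l"
              then have "i = prod_encode (l, snd (prod_decode i))" by (auto simp: k_def)
              moreover have "snd (prod_decode i) \<in> J l" using i I[of i] \<open>k i = l\<close> by auto
              ultimately show False using i by blast
            qed
            then show "f i q *\<^sub>R X i q = 0" by (simp add: f_def)
          qed
        qed (use fin in auto)
        also have "\<dots> = (\<Sum>j\<in>J l. f (prod_encode (l, j)) q *\<^sub>R X (prod_encode (l, j)) q)"
          by (rule sum.reindex_cong[of "\<lambda>j. prod_encode (l, j)"]) (auto simp: inj_on_def)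
        also have "\<dots> = (\<Sum>j\<in>J l. g j q *\<^sub>R Z l j q)"
          by (rule sum.cong[OF refl]) (use enc in \<open>simp add: f_def\<close>)
        finally show ?thesis using g(2) UV that by auto
      qed
      ultimately show "\<exists>f. (\<forall>i\<in>{i \<in> I. k i \<le> l}. smooth_map (base E) U (f i)) \<and>
          (\<forall>p\<in>U. Y p = (\<Sum>i\<in>{i \<in> I. k i \<le> l}. f i p *\<^sub>R X i p))" by (intro exI[of _ f]) auto
    qed
  qed
  moreover have "p \<in> U" using V by (auto simp: U_def)
  ultimately show ?thesis using that by blast
qed

definition deg_sequence :: "'i set \<Rightarrow> ('i \<Rightarrow> 'p \<Rightarrow> 'v) \<Rightarrow> ('i \<Rightarrow> nat) \<Rightarrow> 'p \<Rightarrow> ('i \<Rightarrow>\<^sub>0 real) set \<Rightarrow>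
    (nat \<Rightarrow> 'p) \<Rightarrow> (nat \<Rightarrow> real) \<Rightarrow> bool"
  where "deg_sequence I X k p K pn tn \<longleftrightarrow> (\<forall>n. pn n \<in> pts E \<and> tn n > 0) \<and>
    limitin T pn p sequentially \<and> tn \<longlonglongrightarrow> 0 \<and>
    limitin (Grass_topology (coord_space I)) (\<lambda>n. nat_ker I X k (pn n) (tn n)) K sequentially"

text \<open>\<open>kern_limit\<close> for points of positive time that converge to the point
  \<open>(p, L, 0)\<close>; this is the independence of the zero fibre from the family.\<close>

lemma deg_sequence_transfer:
  assumes gf: "generating_family E F N U I X k" and gf': "generating_family E F N U' J Y k'"
    and p: "p \<in> U" "p \<in> U'" and L: "L \<in> Grass_gr E F N p"
    and s: "deg_sequence I X k p (nat_preimage E F N I X k p L) pn tn"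
  shows "deg_sequence J Y k' p (nat_preimage E F N J Y k' p L) pn tn"
proof -
  have lim: "limitin T pn p sequentially" "tn \<longlonglongrightarrow> 0" "\<And>n. tn n > 0"
    using s by (auto simp: deg_sequence_def)
  have "limitin (Grass_topology (coord_space J)) (\<lambda>n. kern J Y k' (Inl (pn n, tn n))) (kern J Y k' (Inr (p, L))) sequentially"
  proof (rule kern_limit[OF gf gf'])
    show "Inr (p, L) \<in> big_over (U \<inter> U')" using p L by (auto simp: big_over_def)
    have "eventually (\<lambda>n. pn n \<in> U) sequentially" using limitinD[OF lim(1) gf_open[OF gf] p(1)] .
    then show "eventually (\<lambda>n. Inl (pn n, tn n) \<in> big_over U) sequentially"
      by eventually_elim (use lim(3) in \<open>auto simp: big_over_def\<close>)
  qed (use s in \<open>simp_all add: deg_sequence_def kern_def\<close>)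
  then show ?thesis using s by (simp add: deg_sequence_def kern_def)
qed

text \<open>The definition chooses a family with indices in \<open>nat\<close>; by transfer, any
  family around \<open>p\<close>, of any index type, detects the zero fibre.\<close>

lemma B_fibre_iff:
  assumes gf: "generating_family E F N U I X k" and p: "p \<in> U"
  shows "L \<in> B_fibre E F N p \<longleftrightarrow> L \<in> Grass_gr E F N p \<and>
    (\<exists>pn tn. deg_sequence I X k p (nat_preimage E F N I X k p L) pn tn)"
proof
  assume "L \<in> B_fibre E F N p"
  then obtain V and J :: "nat set" and Y k' pn tn where L: "L \<in> Grass_gr E F N p"
    and gf': "generating_family E F N V J Y k'" "p \<in> V"
    and s: "deg_sequence J Y k' p (nat_preimage E F N J Y k' p L) pn tn"
    unfolding B_fibre_def deg_sequence_def by blast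
  then show "L \<in> Grass_gr E F N p \<and> (\<exists>pn tn. deg_sequence I X k p (nat_preimage E F N I X k p L) pn tn)"
    using deg_sequence_transfer[OF gf'(1) gf gf'(2) p L s] by blast
next
  assume "L \<in> Grass_gr E F N p \<and> (\<exists>pn tn. deg_sequence I X k p (nat_preimage E F N I X k p L) pn tn)"
  then obtain pn tn where L: "L \<in> Grass_gr E F N p"
    and s: "deg_sequence I X k p (nat_preimage E F N I X k p L) pn tn" by blast
  have "p \<in> pts E" using p gf_pts[OF gf] by blast
  then obtain V and J :: "nat set" and Y k' where gf': "generating_family E F N V J Y k'" "p \<in> V"
    using generating_family_exists by metis
  have "deg_sequence J Y k' p (nat_preimage E F N J Y k' p L) pn tn"
    by (rule deg_sequence_transfer[OF gf gf'(1) p gf'(2) L s])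
  then show "L \<in> B_fibre E F N p"
    using L gf' unfolding B_fibre_def deg_sequence_def by blast
qed

end


section \<open>The deformation space\<close>

lemma first_countable_decreasing_base:
  assumes "first_countable X" "y \<in> topspace X"
  obtains O' :: "nat \<Rightarrow> 'a set" where "\<And>n. openin X (O' n)" "\<And>n. y \<in> O' n"
    "\<And>W. openin X W \<Longrightarrow> y \<in> W \<Longrightarrow> eventually (\<lambda>n. O' n \<subseteq> W) sequentially"
proof -
  obtain B where B: "countable B" "\<And>V. V \<in> B \<Longrightarrow> openin X V"
    "\<And>W. openin X W \<Longrightarrow> y \<in> W \<Longrightarrow> \<exists>V\<in>B. y \<in> V \<and> V \<subseteq> W"
    using assms unfolding first_countable_def by metis
  define C where "C = {V \<in> B. y \<in> V}"
  have C: "countable C" "C \<noteq> {}" using B(1) B(3)[OF openin_topspace assms(2)] by (auto simp: C_def)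
  define O' where "O' = (\<lambda>n. \<Inter>m\<in>{..n}. from_nat_into C m)"
  have c: "from_nat_into C m \<in> C" for m by (rule from_nat_into[OF C(2)])
  have "openin X (O' n)" for n
    unfolding O'_def by (rule openin_INT2) (use c B(2) in \<open>auto simp: C_def\<close>)
  moreover have "y \<in> O' n" for n using c by (auto simp: O'_def C_def)
  moreover have "eventually (\<lambda>n. O' n \<subseteq> W) sequentially" if W: "openin X W" "y \<in> W" for W
  proof -
    obtain V where V: "V \<in> C" "V \<subseteq> W" using B(3)[OF W] by (auto simp: C_def)
    obtain m where m: "from_nat_into C m = V" using from_nat_into_surj[OF C(1) V(1)] by blast
    have "O' n \<subseteq> W" if "m \<le> n" for n using that m V(2) by (auto simp: O'_def)
    then show ?thesis unfolding eventually_sequentially by blast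
  qed
  ultimately show ?thesis using that by blast
qed

text \<open>The zero fibre is defined by sequences, while a closure only provides points in every
  neighbourhood; a decreasing countable base mediates.\<close>

lemma first_countable_closure_sequence:
  assumes "first_countable X" "y \<in> X closure_of A"
  obtains \<sigma> :: "nat \<Rightarrow> 'a" where "\<And>n. \<sigma> n \<in> A" "limitin X \<sigma> y sequentially"
proof -
  have y: "y \<in> topspace X" using assms(2) by (simp add: in_closure_of)
  obtain O' where O': "\<And>n::nat. openin X (O' n)" "\<And>n. y \<in> O' n"
    "\<And>W. openin X W \<Longrightarrow> y \<in> W \<Longrightarrow> eventually (\<lambda>n. O' n \<subseteq> W) sequentially"
    using first_countable_decreasing_base[OF assms(1) y] by metis
  have "\<exists>a. a \<in> A \<and> a \<in> O' n" for n using assms(2) O' by (auto simp: in_closure_of)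
  then obtain \<sigma> where \<sigma>: "\<And>n. \<sigma> n \<in> A \<and> \<sigma> n \<in> O' n" by metis
  have "limitin X \<sigma> y sequentially"
    unfolding limitin_def
  proof (intro conjI y allI impI)
    fix W assume "openin X W \<and> y \<in> W"
    then have "eventually (\<lambda>n. O' n \<subseteq> W) sequentially" using O'(3) by blast
    then show "eventually (\<lambda>n. \<sigma> n \<in> W) sequentially" by eventually_elim (use \<sigma> in blast)
  qed
  then show ?thesis using \<sigma> that by blast
qed

lemma first_countable_prod_topology:
  assumes "first_countable X" "first_countable Y"
  shows "first_countable (prod_topology X Y)"
  unfolding first_countable_def
proof
  fix z assume "z \<in> topspace (prod_topology X Y)"
  then obtain x y where z: "z = (x, y)" "x \<in> topspace X" "y \<in> topspace Y" by auto
  obtain A where A: "countable A" "\<And>V. V \<in> A \<Longrightarrow> openin X V"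
    "\<And>W. openin X W \<Longrightarrow> x \<in> W \<Longrightarrow> \<exists>V\<in>A. x \<in> V \<and> V \<subseteq> W"
    using assms(1) z(2) unfolding first_countable_def by metis
  obtain B where B: "countable B" "\<And>V. V \<in> B \<Longrightarrow> openin Y V"
    "\<And>W. openin Y W \<Longrightarrow> y \<in> W \<Longrightarrow> \<exists>V\<in>B. y \<in> V \<and> V \<subseteq> W"
    using assms(2) z(3) unfolding first_countable_def by metis
  let ?C = "(\<lambda>(a, b). a \<times> b) ` (A \<times> B)"
  show "\<exists>C. countable C \<and> (\<forall>V\<in>C. openin (prod_topology X Y) V) \<and>
      (\<forall>W. openin (prod_topology X Y) W \<and> z \<in> W \<longrightarrow> (\<exists>V\<in>C. z \<in> V \<and> V \<subseteq> W))"
  proof (intro exI[of _ ?C] conjI allI impI)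
    show "countable ?C" using A(1) B(1) by blast
    show "\<forall>V\<in>?C. openin (prod_topology X Y) V" using A(2) B(2) by (auto simp: openin_prod_Times_iff)
    fix W assume "openin (prod_topology X Y) W \<and> z \<in> W"
    then obtain U V where UV: "openin X U" "openin Y V" "x \<in> U" "y \<in> V" "U \<times> V \<subseteq> W"
      unfolding openin_prod_topology_alt z(1) by blast
    obtain a b where "a \<in> A" "x \<in> a" "a \<subseteq> U" "b \<in> B" "y \<in> b" "b \<subseteq> V"
      using A(3)[OF UV(1,3)] B(3)[OF UV(2,4)] by blast
    then show "\<exists>V\<in>?C. z \<in> V \<and> V \<subseteq> W"
      using UV(5) by (intro bexI[of _ "a \<times> b"]) (auto simp: z(1))
  qed
qed

text \<open>Eventual membership passes to finite intersections and arbitrary unions, so a subbasis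
  suffices.\<close>

lemma limitin_topology_generated_by:
  assumes z0: "z0 \<in> \<Union>S" and ev: "\<And>s. s \<in> S \<Longrightarrow> z0 \<in> s \<Longrightarrow> eventually (\<lambda>x. \<zeta> x \<in> s) \<F>"
  shows "limitin (topology_generated_by S) \<zeta> z0 \<F>"
proof -
  have "z0 \<in> W \<longrightarrow> eventually (\<lambda>x. \<zeta> x \<in> W) \<F>" if "generate_topology_on S W" for W
    using that
  proof induction
    case (Int a b)
    then show ?case by (auto intro: eventually_conj)
  next
    case (UN K)
    show ?case
    proof
      assume "z0 \<in> \<Union>K"
      then obtain k where "k \<in> K" "z0 \<in> k" by blast
      then have "eventually (\<lambda>x. \<zeta> x \<in> k) \<F>" using UN.IH by blast
      then show "eventually (\<lambda>x. \<zeta> x \<in> \<Union>K) \<F>" by eventually_elim (use \<open>k \<in> K\<close> in blast)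
    qed
  qed (use ev in auto)
  then show ?thesis
    using z0 unfolding limitin_def by (auto simp: openin_topology_generated_by_iff)
qed

context filtered_bundle
begin

lemma D_over_iff: "z \<in> D_over E F N U \<longleftrightarrow> z \<in> D_space E F N \<and> fst (beta z) \<in> U"
  by (cases z) (auto simp: D_over_def D_space_def)

lemma D_over_big_over: "D_over E F N U \<subseteq> big_over U"
proof
  fix z assume "z \<in> D_over E F N U"
  then show "z \<in> big_over U"
    unfolding D_over_iff by (cases z) (auto simp: D_space_def big_over_def B_fibre_def)
qed

lemma topspace_iota_codomain:
  assumes "generating_family E F N U I X k"
  shows "topspace (iota_codomain E U I) = U \<times> Grass (coord_space I) \<times> {0..}"
proof -
  interpret G: fin_dim_space "coord_space I" "(\<lambda>i. Poly_Mapping.single i 1) ` I"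
    by (rule coord_space_fin_dim[OF gf_finite[OF assms]])
  show ?thesis using gf_pts[OF assms] by (auto simp: iota_codomain_def)
qed

lemma beta_nonneg: "z \<in> D_space E F N \<Longrightarrow> snd (beta z) \<ge> 0"
  by (cases z) (auto simp: D_space_def)

lemma beta_pts: "z \<in> D_space E F N \<Longrightarrow> fst (beta z) \<in> pts E"
  by (cases z) (auto simp: D_space_def)

lemma iota_in_codomain:
  assumes "generating_family E F N U I X k" "z \<in> D_over E F N U"
  shows "iota E F N I X k z \<in> topspace (iota_codomain E U I)"
  using assms(2) kern_Grass[OF subsetD[OF D_over_big_over assms(2)], of I X k] beta_nonneg[of z]
  by (auto simp: iota_eq topspace_iota_codomain[OF assms(1)] D_over_iff)

lemma limitin_iota_codomain:
  "limitin (iota_codomain E U I) (\<lambda>x. (a x, K x, s x)) (a0, K0, s0) \<F> \<longleftrightarrow>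
    a0 \<in> U \<and> eventually (\<lambda>x. a x \<in> U) \<F> \<and> limitin T a a0 \<F> \<and>
    limitin (Grass_topology (coord_space I)) K K0 \<F> \<and>
    s0 \<ge> 0 \<and> eventually (\<lambda>x. s x \<ge> 0) \<F> \<and> (s \<longlongrightarrow> s0) \<F>"
  by (auto simp: iota_codomain_def limitin_pairwise limitin_subtopology comp_def)

text \<open>Base point and time decide except over time zero, where
  \<open>nat_preimage_image\<close> recovers \<open>L\<close> from its preimage.\<close>

lemma inj_iota:
  assumes gf: "generating_family E F N U I X k"
  shows "inj_on (iota E F N I X k) (D_over E F N U)"
proof (rule inj_onI)
  fix z z' assume z: "z \<in> D_over E F N U" "z' \<in> D_over E F N U" "iota E F N I X k z = iota E F N I X k z'"
  have eq: "fst (beta z) = fst (beta z')" "snd (beta z) = snd (beta z')" "kern I X k z = kern I X k z'"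
    using z(3) by (auto simp: iota_eq)
  have b: "z \<in> big_over U" "z' \<in> big_over U" using z D_over_big_over by auto
  from b(1) show "z = z'"
  proof (cases rule: big_over_cases)
    case (pos p t)
    from b(2) show ?thesis by (cases rule: big_over_cases) (use pos eq in auto)
  next
    case (zero p L)
    from b(2) show ?thesis
    proof (cases rule: big_over_cases)
      case pos
      then show ?thesis using zero eq by auto
    next
      case z': (zero p' L')
      have [simp]: "p' = p" using zero z' eq by simp
      have "L = nat_map0 E F N I X k p ` nat_preimage E F N I X k p L"
        using nat_preimage_image[OF gf zero(2,3)] by simp
      also have "\<dots> = nat_map0 E F N I X k p ` nat_preimage E F N I X k p L'"
        using eq(3) zero z' by (simp add: kern_def)
      also have "\<dots> = L'" using nat_preimage_image[OF gf zero(2), of L'] z' by simp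
      finally show ?thesis using zero z' by simp
    qed
  qed
qed

section \<open>An explicit subbasis and convergence in the deformation space\<close>

text \<open>Every admissible topology must contain these sets. That they generate an admissible one
  is the substance: a priori the preimages under \<open>iota\<close> could refine the usual topology
  of the part with positive time.\<close>

definition D_subbasis :: "('p, 'v) dpoint set set"
  where "D_subbasis = {Inl ` W | W. openin (prod_topology T (top_of_set {0<..})) W} \<union>
    {{z \<in> D_over E F N U. iota E F N I X k z \<in> W} | U (I :: nat set) X k W.
      generating_family E F N U I X k \<and> openin (iota_codomain E U I) W}"

abbreviation D_top :: "('p, 'v) dpoint topology"
  where "D_top \<equiv> topology_generated_by D_subbasis"

lemma D_subbasis_Inl: "openin (prod_topology T (top_of_set {0<..})) W \<Longrightarrow> Inl ` W \<in> D_subbasis"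
  unfolding D_subbasis_def by blast

lemma D_subbasis_iota:
  fixes I :: "nat set"
  assumes "generating_family E F N U I X k" "openin (iota_codomain E U I) W"
  shows "{z \<in> D_over E F N U. iota E F N I X k z \<in> W} \<in> D_subbasis"
  unfolding D_subbasis_def using assms by blast

lemma openin_D_over_nat:
  fixes I :: "nat set"
  assumes gf: "generating_family E F N U I X k"
  shows "openin D_top (D_over E F N U)"
proof -
  have "{z \<in> D_over E F N U. iota E F N I X k z \<in> topspace (iota_codomain E U I)} = D_over E F N U"
    using iota_in_codomain[OF gf] by blast
  then show ?thesis
    using topology_generated_by_Basis[OF D_subbasis_iota[OF gf openin_topspace]] by simp
qed

lemma topspace_D_top: "topspace D_top = D_space E F N"
proof
  show "topspace D_top \<subseteq> D_space E F N"
  proof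
    fix z assume "z \<in> topspace D_top"
    then obtain s where s: "s \<in> D_subbasis" "z \<in> s" by auto
    from s(1) consider W where "s = Inl ` W" "openin (prod_topology T (top_of_set {0<..})) W"
      | U where "s \<subseteq> D_over E F N U"
      unfolding D_subbasis_def by blast
    then show "z \<in> D_space E F N"
    proof cases
      case 1
      then show ?thesis using s(2) openin_subset[OF 1(2)] by (auto simp: D_space_def)
    next
      case 2
      then show ?thesis using s(2) by (auto simp: D_over_iff)
    qed
  qed
  show "D_space E F N \<subseteq> topspace D_top"
  proof
    fix z assume z: "z \<in> D_space E F N"
    obtain U and I :: "nat set" and X k where gf: "generating_family E F N U I X k" "fst (beta z) \<in> U"
      using generating_family_exists[OF beta_pts[OF z]] by metis
    have "z \<in> D_over E F N U" using z gf(2) by (simp add: D_over_iff)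
    then show "z \<in> topspace D_top" using openin_subset[OF openin_D_over_nat[OF gf(1)]] by blast
  qed
qed

lemma limit_iota_nat:
  fixes I :: "nat set"
  assumes gf: "generating_family E F N U I X k" and z0: "z0 \<in> D_over E F N U"
    and lim: "limitin D_top \<zeta> z0 \<F>"
  shows "limitin (iota_codomain E U I) (\<lambda>x. iota E F N I X k (\<zeta> x)) (iota E F N I X k z0) \<F>"
  unfolding limitin_def
proof (intro conjI allI impI iota_in_codomain[OF gf z0])
  fix W assume W: "openin (iota_codomain E U I) W \<and> iota E F N I X k z0 \<in> W"
  then have "openin D_top {z \<in> D_over E F N U. iota E F N I X k z \<in> W}"
    using topology_generated_by_Basis[OF D_subbasis_iota[OF gf]] by blast
  then have "eventually (\<lambda>x. \<zeta> x \<in> {z \<in> D_over E F N U. iota E F N I X k z \<in> W}) \<F>"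
    by (rule limitinD[OF lim]) (use W z0 in simp)
  then show "eventually (\<lambda>x. iota E F N I X k (\<zeta> x) \<in> W) \<F>" by eventually_elim simp
qed

lemma limit_beta:
  assumes lim: "limitin D_top \<zeta> z0 \<F>"
  shows "limitin T (\<lambda>x. fst (beta (\<zeta> x))) (fst (beta z0)) \<F>" "((\<lambda>x. snd (beta (\<zeta> x))) \<longlongrightarrow> snd (beta z0)) \<F>"
proof -
  have z0: "z0 \<in> D_space E F N" using limitin_topspace[OF lim] unfolding topspace_D_top .
  obtain U and I :: "nat set" and X k where gf: "generating_family E F N U I X k" "fst (beta z0) \<in> U"
    using generating_family_exists[OF beta_pts[OF z0]] by metis
  have "z0 \<in> D_over E F N U" using z0 gf(2) by (simp add: D_over_iff)
  from limit_iota_nat[OF gf(1) this lim]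
  show "limitin T (\<lambda>x. fst (beta (\<zeta> x))) (fst (beta z0)) \<F>" "((\<lambda>x. snd (beta (\<zeta> x))) \<longlongrightarrow> snd (beta z0)) \<F>"
    unfolding iota_eq limitin_iota_codomain by blast+
qed

lemma eventually_D_over:
  assumes lim: "limitin D_top \<zeta> z0 \<F>" and U: "openin T U" "fst (beta z0) \<in> U"
  shows "eventually (\<lambda>x. \<zeta> x \<in> D_over E F N U) \<F>"
proof -
  have "eventually (\<lambda>x. fst (beta (\<zeta> x)) \<in> U) \<F>" by (rule limitinD[OF limit_beta(1)[OF lim] U])
  moreover have "eventually (\<lambda>x. \<zeta> x \<in> topspace D_top) \<F>"
    by (rule limitinD[OF lim openin_topspace]) (rule limitin_topspace[OF lim])
  ultimately show ?thesis unfolding topspace_D_top by eventually_elim (simp add: D_over_iff)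
qed

text \<open>The subbasis sees families indexed by \<open>nat\<close> only; for an arbitrary index
  type, convergence is obtained from such a family around the base point of \<open>z0\<close> and
  carried over by \<open>kern_limit\<close>.\<close>

lemma limit_iota:
  assumes gf: "generating_family E F N U I X k" and z0: "z0 \<in> D_over E F N U"
    and lim: "limitin D_top \<zeta> z0 \<F>"
  shows "limitin (iota_codomain E U I) (\<lambda>x. iota E F N I X k (\<zeta> x)) (iota E F N I X k z0) \<F>"
proof -
  have z0': "z0 \<in> D_space E F N" "fst (beta z0) \<in> U" using z0 by (auto simp: D_over_iff)
  obtain V and J :: "nat set" and Y k' where gf': "generating_family E F N V J Y k'" "fst (beta z0) \<in> V"
    using generating_family_exists[OF beta_pts[OF z0'(1)]] by metis
  have zV: "z0 \<in> D_over E F N V" using z0' gf'(2) by (simp add: D_over_iff)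
  have b: "limitin T (\<lambda>x. fst (beta (\<zeta> x))) (fst (beta z0)) \<F>" "((\<lambda>x. snd (beta (\<zeta> x))) \<longlongrightarrow> snd (beta z0)) \<F>"
    using limit_beta[OF lim] by auto
  have k: "limitin (Grass_topology (coord_space J)) (\<lambda>x. kern J Y k' (\<zeta> x)) (kern J Y k' z0) \<F>"
    using limit_iota_nat[OF gf'(1) zV lim] unfolding iota_eq limitin_iota_codomain by blast
  have evV: "eventually (\<lambda>x. \<zeta> x \<in> D_over E F N V) \<F>"
    by (rule eventually_D_over[OF lim gf_open[OF gf'(1)] gf'(2)])
  have evU: "eventually (\<lambda>x. \<zeta> x \<in> D_over E F N U) \<F>"
    by (rule eventually_D_over[OF lim gf_open[OF gf] z0'(2)])
  have "limitin (Grass_topology (coord_space I)) (\<lambda>x. kern I X k (\<zeta> x)) (kern I X k z0) \<F>"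
  proof (rule kern_limit[OF gf'(1) gf _ _ b k])
    have "z0 \<in> D_over E F N (V \<inter> U)" using z0' gf'(2) by (simp add: D_over_iff)
    then show "z0 \<in> big_over (V \<inter> U)" using D_over_big_over by blast
    show "eventually (\<lambda>x. \<zeta> x \<in> big_over V) \<F>"
      using evV by eventually_elim (use D_over_big_over in blast)
  qed
  moreover have "eventually (\<lambda>x. fst (beta (\<zeta> x)) \<in> U) \<F>" using evU by eventually_elim (simp add: D_over_iff)
  moreover have "eventually (\<lambda>x. snd (beta (\<zeta> x)) \<ge> 0) \<F>"
    using evU by eventually_elim (use beta_nonneg in \<open>auto simp: D_over_iff\<close>)
  ultimately show ?thesis
    unfolding iota_eq limitin_iota_codomain using b z0' beta_nonneg[OF z0'(1)] by blast
qed

text \<open>One \<open>iota\<close> controls all subbasic sets around \<open>z0\<close>: the sets of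
  the first kind through base point and time, those of another family through
  \<open>kern_limit\<close>.\<close>

lemma limit_D_top:
  assumes gf: "generating_family E F N U I X k" and z0: "z0 \<in> D_over E F N U"
    and ev: "eventually (\<lambda>x. \<zeta> x \<in> D_over E F N U) \<F>"
    and lim: "limitin (iota_codomain E U I) (\<lambda>x. iota E F N I X k (\<zeta> x)) (iota E F N I X k z0) \<F>"
  shows "limitin D_top \<zeta> z0 \<F>"
proof (rule limitin_topology_generated_by)
  have z0': "z0 \<in> D_space E F N" "fst (beta z0) \<in> U" using z0 by (auto simp: D_over_iff)
  show "z0 \<in> \<Union>D_subbasis" using z0'(1) topspace_D_top by simp
  have l: "limitin T (\<lambda>x. fst (beta (\<zeta> x))) (fst (beta z0)) \<F>"
    "((\<lambda>x. snd (beta (\<zeta> x))) \<longlongrightarrow> snd (beta z0)) \<F>"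
    "limitin (Grass_topology (coord_space I)) (\<lambda>x. kern I X k (\<zeta> x)) (kern I X k z0) \<F>"
    using lim unfolding iota_eq limitin_iota_codomain by blast+
  fix s assume s: "s \<in> D_subbasis" "z0 \<in> s"
  from s(1) consider (Inl) W where "s = Inl ` W" "openin (prod_topology T (top_of_set {0<..})) W"
    | (iota) V and J :: "nat set" and Y k' W where "s = {z \<in> D_over E F N V. iota E F N J Y k' z \<in> W}"
      "generating_family E F N V J Y k'" "openin (iota_codomain E V J) W"
    unfolding D_subbasis_def by blast
  then show "eventually (\<lambda>x. \<zeta> x \<in> s) \<F>"
  proof cases
    case Inl
    obtain p t where z: "z0 = Inl (p, t)" "(p, t) \<in> W" using s(2) Inl(1) by auto
    have t: "t > 0" using z openin_subset[OF Inl(2)] by auto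
    have evt: "eventually (\<lambda>x. snd (beta (\<zeta> x)) > 0) \<F>"
      using order_tendstoD(1)[OF l(2), of 0] t z by simp
    have "limitin (prod_topology T (top_of_set {0<..})) (\<lambda>x. beta (\<zeta> x)) (p, t) \<F>"
      using l(1,2) z t evt by (auto simp: limitin_pairwise limitin_subtopology comp_def)
    then have "eventually (\<lambda>x. beta (\<zeta> x) \<in> W) \<F>" by (rule limitinD) (use Inl z in auto)
    with evt show ?thesis
    proof eventually_elim
      case (elim x)
      then show ?case by (cases "\<zeta> x") (auto simp: Inl(1))
    qed
  next
    case iota
    have z0V: "z0 \<in> D_over E F N V" "iota E F N J Y k' z0 \<in> W" using s(2) iota(1) by auto
    have evV: "eventually (\<lambda>x. fst (beta (\<zeta> x)) \<in> V) \<F>"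
      by (rule limitinD[OF l(1) gf_open[OF iota(2)]]) (use z0V in \<open>simp add: D_over_iff\<close>)
    have evn: "eventually (\<lambda>x. snd (beta (\<zeta> x)) \<ge> 0) \<F>"
      using ev by eventually_elim (use beta_nonneg in \<open>auto simp: D_over_iff\<close>)
    have "limitin (Grass_topology (coord_space J)) (\<lambda>x. kern J Y k' (\<zeta> x)) (kern J Y k' z0) \<F>"
    proof (rule kern_limit[OF gf iota(2) _ _ l])
      have "z0 \<in> D_over E F N (U \<inter> V)" using z0' z0V(1) by (simp add: D_over_iff)
      then show "z0 \<in> big_over (U \<inter> V)" using D_over_big_over by blast
      show "eventually (\<lambda>x. \<zeta> x \<in> big_over U) \<F>"
        using ev by eventually_elim (use D_over_big_over in blast)
    qed
    then have "limitin (iota_codomain E V J) (\<lambda>x. iota E F N J Y k' (\<zeta> x)) (iota E F N J Y k' z0) \<F>"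
      unfolding iota_eq limitin_iota_codomain
      using l evV evn z0V(1) beta_nonneg[OF z0'(1)] by (simp add: D_over_iff)
    then have "eventually (\<lambda>x. iota E F N J Y k' (\<zeta> x) \<in> W) \<F>"
      by (rule limitinD[OF _ iota(3) z0V(2)])
    with ev evV show ?thesis by eventually_elim (simp add: iota(1) D_over_iff)
  qed
qed

lemma continuous_iota:
  assumes gf: "generating_family E F N U I X k"
  shows "continuous_map (subtopology D_top (D_over E F N U)) (iota_codomain E U I) (iota E F N I X k)"
  unfolding continuous_map_atin
proof
  fix z0 assume "z0 \<in> topspace (subtopology D_top (D_over E F N U))"
  then have z0: "z0 \<in> topspace (subtopology D_top (D_over E F N U))" "z0 \<in> D_over E F N U" by auto
  have "continuous_map (subtopology D_top (D_over E F N U)) D_top (\<lambda>z. z)"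
    by (rule continuous_map_from_subtopology) simp
  then have "limitin D_top (\<lambda>z. z) z0 (atin (subtopology D_top (D_over E F N U)) z0)"
    by (rule limitin_continuous_map[OF _ z0(1) refl])
  from limit_iota[OF gf z0(2) this]
  show "limitin (iota_codomain E U I) (iota E F N I X k) (iota E F N I X k z0)
      (atin (subtopology D_top (D_over E F N U)) z0)" .
qed

lemma topspace_sub_D_over: "topspace (subtopology D_top (D_over E F N U)) = D_over E F N U"
  unfolding topspace_subtopology topspace_D_top by (auto simp: D_over_iff)

text \<open>The inverse is continuous by \<open>limit_D_top\<close>: convergence of the images under
  this one \<open>iota\<close> forces convergence in the space.\<close>

lemma embedding_iota:
  assumes gf: "generating_family E F N U I X k"
  shows "embedding_map (subtopology D_top (D_over E F N U)) (iota_codomain E U I) (iota E F N I X k)"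
proof -
  let ?D = "D_over E F N U" and ?\<iota> = "iota E F N I X k"
  let ?C = "subtopology (iota_codomain E U I) (?\<iota> ` ?D)"
  let ?g = "inv_into ?D ?\<iota>"
  have sub: "?\<iota> ` ?D \<subseteq> topspace (iota_codomain E U I)" using iota_in_codomain[OF gf] by auto
  have "continuous_map ?C (subtopology D_top ?D) ?g"
    unfolding continuous_map_atin
  proof
    fix y assume y: "y \<in> topspace ?C"
    then obtain z0 where z0: "z0 \<in> ?D" "y = ?\<iota> z0" by auto
    have g0: "?g y = z0" using z0 inj_iota[OF gf] by simp
    have "continuous_map ?C (iota_codomain E U I) (\<lambda>y. y)"
      by (rule continuous_map_from_subtopology) simp
    then have lim: "limitin (iota_codomain E U I) (\<lambda>y. y) y (atin ?C y)"
      by (rule limitin_continuous_map[OF _ y refl])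
    have ev: "eventually (\<lambda>y. y \<in> ?\<iota> ` ?D) (atin ?C y)"
    proof -
      have "topspace ?C \<subseteq> ?\<iota> ` ?D" by auto
      then show ?thesis unfolding eventually_atin using y openin_topspace by blast
    qed
    have evg: "eventually (\<lambda>y. ?g y \<in> ?D) (atin ?C y)"
      using ev by eventually_elim (rule inv_into_into)
    have "eventually (\<lambda>y. y = ?\<iota> (?g y)) (atin ?C y)"
      using ev by eventually_elim (simp add: f_inv_into_f)
    then have "limitin (iota_codomain E U I) (\<lambda>y. ?\<iota> (?g y)) (?\<iota> z0) (atin ?C y)"
      using lim unfolding z0(2) by (rule limitin_transform_eventually)
    from limit_D_top[OF gf z0(1) evg this]
    show "limitin (subtopology D_top ?D) ?g (?g y) (atin ?C y)"
      unfolding g0 limitin_subtopology using z0(1) evg by blast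
  qed
  moreover have "continuous_map (subtopology D_top ?D) ?C ?\<iota>"
    by (rule continuous_map_into_subtopology[OF continuous_iota[OF gf]]) (auto simp: topspace_sub_D_over)
  ultimately have "homeomorphic_maps (subtopology D_top ?D) ?C ?\<iota> ?g"
    unfolding homeomorphic_maps_def
    using inj_iota[OF gf] by (auto simp: topspace_sub_D_over f_inv_into_f)
  then show ?thesis
    unfolding embedding_map_def topspace_sub_D_over by (rule homeomorphic_maps_imp_map)
qed

text \<open>Continuity of \<open>Inl\<close> says that the preimages under \<open>iota\<close> add
  no new open sets at positive time; it rests on the continuity of the kernels in
  \<open>nat_ker_tendsto\<close>. Openness is built into the subbasis.\<close>

lemma homeomorphic_Inl:
  "homeomorphic_map (prod_topology T (top_of_set {0<..})) (subtopology D_top (Inl ` (pts E \<times> {0<..}))) Inl"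
proof -
  let ?P = "prod_topology T (top_of_set {0::real<..})"
  have tP: "topspace ?P = pts E \<times> {0<..}" by simp
  have "continuous_map ?P D_top Inl"
    unfolding continuous_map_atin
  proof
    fix z assume z: "z \<in> topspace ?P"
    then obtain p t where pt: "z = (p, t)" "p \<in> pts E" "t > 0" by auto
    obtain U and I :: "nat set" and X k where gf: "generating_family E F N U I X k" "p \<in> U"
      using generating_family_exists[OF pt(2)] by metis
    have fs: "limitin T fst p (atin ?P z)" "limitin (top_of_set {0<..}) snd t (atin ?P z)"
      using limitin_continuous_map[OF continuous_map_fst z] limitin_continuous_map[OF continuous_map_snd z] pt
      by auto
    have s: "(snd \<longlongrightarrow> t) (atin ?P z)" "eventually (\<lambda>y. snd y > 0) (atin ?P z)"
      using fs(2) by (auto simp: limitin_subtopology)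
    have evU: "eventually (\<lambda>y. fst y \<in> U) (atin ?P z)" by (rule limitinD[OF fs(1) gf_open[OF gf(1)] gf(2)])
    have evp: "eventually (\<lambda>y. fst y \<in> pts E) (atin ?P z)" using evU by eventually_elim (use gf_pts[OF gf(1)] in blast)
    have evn: "eventually (\<lambda>y. snd y \<ge> 0) (atin ?P z)" using s(2) by eventually_elim simp
    show "limitin D_top Inl (Inl z) (atin ?P z)"
    proof (rule limit_D_top[OF gf(1)])
      show "Inl z \<in> D_over E F N U" using pt gf(2) by (auto simp: D_over_iff D_space_def)
      show "eventually (\<lambda>y. Inl y \<in> D_over E F N U) (atin ?P z)"
        using evU evp s(2) by eventually_elim (auto simp: D_over_iff D_space_def)
      have k: "limitin (Grass_topology (coord_space I)) (\<lambda>y. kern I X k (Inl y)) (kern I X k (Inl z)) (atin ?P z)"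
        using nat_ker_tendsto[OF gf pt(3) fs(1) s(1)] pt(1) by (simp add: kern_def case_prod_unfold)
      have b: "beta (Inl y) = y" for y :: "'p \<times> real" by (cases y) simp
      show "limitin (iota_codomain E U I) (\<lambda>y. iota E F N I X k (Inl y)) (iota E F N I X k (Inl z)) (atin ?P z)"
        unfolding iota_eq limitin_iota_codomain b using k fs(1) s(1) evU evn gf(2) pt by simp
    qed
  qed
  moreover have "open_map ?P D_top Inl"
    unfolding open_map_def using topology_generated_by_Basis[OF D_subbasis_Inl] by blast
  ultimately have "embedding_map ?P D_top Inl"
    by (intro injective_open_imp_embedding_map) auto
  then show ?thesis unfolding embedding_map_def tP .
qed

lemma D_top_admissible: "D_admissible E F N D_top"
  unfolding D_admissible_def
proof (intro conjI allI impI topspace_D_top homeomorphic_Inl)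
  have "openin (prod_topology T (top_of_set {0<..})) (pts E \<times> {0::real<..})"
    using openin_topspace[of "prod_topology T (top_of_set {0::real<..})"] by simp
  then show "openin D_top (Inl ` (pts E \<times> {0<..}))"
    by (rule topology_generated_by_Basis[OF D_subbasis_Inl])
qed (auto intro: openin_D_over_nat continuous_iota)

lemma admissible_finer:
  assumes adm: "D_admissible E F N T'" and S: "openin D_top S"
  shows "openin T' S"
proof -
  have "openin T' s" if "s \<in> D_subbasis" for s
  proof -
    from that consider (Inl) W where "s = Inl ` W" "openin (prod_topology T (top_of_set {0<..})) W"
      | (iota) V and J :: "nat set" and Y k' W where "s = {z \<in> D_over E F N V. iota E F N J Y k' z \<in> W}"
        "generating_family E F N V J Y k'" "openin (iota_codomain E V J) W"
      unfolding D_subbasis_def by blast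
    then show ?thesis
    proof cases
      case Inl
      have "open_map (prod_topology T (top_of_set {0<..})) (subtopology T' (Inl ` (pts E \<times> {0<..}))) Inl"
        using adm unfolding D_admissible_def by (blast dest: homeomorphic_imp_open_map)
      then have "openin (subtopology T' (Inl ` (pts E \<times> {0<..}))) s"
        using Inl by (simp add: open_map_def)
      moreover have "openin T' (Inl ` (pts E \<times> {0<..}))" using adm by (simp add: D_admissible_def)
      ultimately show ?thesis by (rule openin_trans_full)
    next
      case iota
      have o: "openin T' (D_over E F N V)"
        and c: "continuous_map (subtopology T' (D_over E F N V)) (iota_codomain E V J) (iota E F N J Y k')"
        using adm iota(2) unfolding D_admissible_def by blast+
      have "topspace (subtopology T' (D_over E F N V)) = D_over E F N V"
        using openin_subset[OF o] by auto
      then have "openin (subtopology T' (D_over E F N V)) s"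
        using openin_continuous_map_preimage[OF c iota(3)] iota(1) by simp
      then show ?thesis using o by (rule openin_trans_full)
    qed
  qed
  then show ?thesis
    using generate_topology_on_coarsest[OF istopology_openin[of T'], of D_subbasis S] S
    by (simp add: openin_topology_generated_by_iff)
qed

text \<open>An admissible topology contained in all admissible ones is their intersection.\<close>

lemma D_topology_eq: "D_topology E F N = D_top"
  unfolding topology_eq openin_D_topology using D_top_admissible admissible_finer by blast


section \<open>Closed image, separation, local compactness and surjectivity\<close>

lemma first_countable_iota_codomain:
  assumes "generating_family E F N U I X k"
  shows "first_countable (iota_codomain E U I)"
proof -
  interpret G: fin_dim_space "coord_space I" "(\<lambda>i. Poly_Mapping.single i 1) ` I"
    by (rule coord_space_fin_dim[OF gf_finite[OF assms]])
  have "first_countable (top_of_set {0::real..})"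
    by (intro metrizable_imp_first_countable metrizable_space_subtopology metrizable_space_euclidean)
  then show ?thesis
    unfolding iota_codomain_def
    using first_countable_subtopology[OF first_countable_T] G.first_countable_Grass
    by (blast intro: first_countable_prod_topology)
qed

lemma Hausdorff_iota_codomain:
  assumes "generating_family E F N U I X k"
  shows "Hausdorff_space (iota_codomain E U I)"
proof -
  interpret G: fin_dim_space "coord_space I" "(\<lambda>i. Poly_Mapping.single i 1) ` I"
    by (rule coord_space_fin_dim[OF gf_finite[OF assms]])
  show ?thesis
    unfolding iota_codomain_def
    by (simp add: Hausdorff_space_prod_topology Hausdorff_space_subtopology Hausdorff_T G.Hausdorff_Grass)
qed

lemma locally_compact_iota_codomain:
  assumes "generating_family E F N U I X k"
  shows "locally_compact_space (iota_codomain E U I)"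
proof -
  interpret G: fin_dim_space "coord_space I" "(\<lambda>i. Poly_Mapping.single i 1) ` I"
    by (rule coord_space_fin_dim[OF gf_finite[OF assms]])
  have "locally_compact_space (subtopology T U)"
    using locally_compact_space_open_subset[OF _ locally_compact_T gf_open[OF assms]] Hausdorff_T by blast
  moreover have "locally_compact_space (top_of_set {0::real..})"
    by (rule locally_compact_space_closed_subset[OF locally_compact_space_euclidean]) auto
  ultimately show ?thesis
    unfolding iota_codomain_def
    by (simp add: locally_compact_space_prod_topology compact_imp_locally_compact_space G.compact_Grass)
qed

text \<open>At time zero this is the sequence from the definition of the zero fibre, whose members
  eventually lie over \<open>U\<close>.\<close>

lemma iota_limit_of_positive:
  assumes gf: "generating_family E F N U I X k" and z: "z \<in> D_over E F N U"
  shows "iota E F N I X k z \<in> iota_codomain E U I closure_of ((\<lambda>(p, t). (p, nat_ker I X k p t, t)) ` (U \<times> {0<..}))"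
    (is "_ \<in> ?C closure_of ?A")
proof -
  have zb: "z \<in> big_over U" using z D_over_big_over by blast
  have top: "iota E F N I X k z \<in> topspace ?C" by (rule iota_in_codomain[OF gf z])
  from zb show ?thesis
  proof (cases rule: big_over_cases)
    case (pos p t)
    then have "iota E F N I X k z \<in> topspace ?C \<inter> ?A" using top by auto
    then show ?thesis by (rule subsetD[OF closure_of_subset_Int])
  next
    case (zero p L)
    then have "L \<in> B_fibre E F N p" using z by (auto simp: D_over_iff D_space_def)
    then obtain pn tn where s: "deg_sequence I X k p (nat_preimage E F N I X k p L) pn tn"
      using B_fibre_iff[OF gf zero(2)] by blast
    then have l: "limitin T pn p sequentially" "tn \<longlonglongrightarrow> 0" "\<And>n. tn n > 0"
      "limitin (Grass_topology (coord_space I)) (\<lambda>n. nat_ker I X k (pn n) (tn n)) (nat_preimage E F N I X k p L) sequentially"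
      by (auto simp: deg_sequence_def)
    have evU: "eventually (\<lambda>n. pn n \<in> U) sequentially" by (rule limitinD[OF l(1) gf_open[OF gf] zero(2)])
    have "limitin ?C (\<lambda>n. (pn n, nat_ker I X k (pn n) (tn n), tn n)) (iota E F N I X k z) sequentially"
      using l evU zero less_imp_le[OF l(3)] by (simp add: limitin_iota_codomain)
    moreover have "eventually (\<lambda>n. (pn n, nat_ker I X k (pn n) (tn n), tn n) \<in> ?A) sequentially"
      using evU by eventually_elim (use l(3) in auto)
    ultimately show ?thesis
      unfolding in_closure_of
    proof (intro conjI top allI impI)
      fix W assume lim: "limitin ?C (\<lambda>n. (pn n, nat_ker I X k (pn n) (tn n), tn n)) (iota E F N I X k z) sequentially"
        and ev: "eventually (\<lambda>n. (pn n, nat_ker I X k (pn n) (tn n), tn n) \<in> ?A) sequentially"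
        and W: "iota E F N I X k z \<in> W \<and> openin ?C W"
      have "eventually (\<lambda>n. (pn n, nat_ker I X k (pn n) (tn n), tn n) \<in> W) sequentially"
        using limitinD[OF lim] W by blast
      with ev have "eventually (\<lambda>n. (pn n, nat_ker I X k (pn n) (tn n), tn n) \<in> ?A \<inter> W) sequentially"
        by eventually_elim blast
      then obtain n where "(pn n, nat_ker I X k (pn n) (tn n), tn n) \<in> ?A \<inter> W"
        using eventually_happens'[OF sequentially_bot] by blast
      then show "\<exists>y. y \<in> ?A \<and> y \<in> W" by blast
    qed
  qed
qed

text \<open>The time of a point of the closure decides: if it is positive, continuity of the kernels
  and uniqueness of limits identify the subspace; if it is zero, the approximating sequence itself
  witnesses membership in the zero fibre.\<close>

lemma closed_image_iota:
  assumes gf: "generating_family E F N U I X k"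
  shows "closedin (iota_codomain E U I) (iota E F N I X k ` D_over E F N U)"
proof -
  let ?C = "iota_codomain E U I"
  let ?A = "(\<lambda>(p, t). (p, nat_ker I X k p t, t)) ` (U \<times> {0<..})"
  interpret G: fin_dim_space "coord_space I" "(\<lambda>i. Poly_Mapping.single i 1) ` I"
    by (rule coord_space_fin_dim[OF gf_finite[OF gf]])
  have sub: "iota E F N I X k ` D_over E F N U \<subseteq> ?C closure_of ?A"
    using iota_limit_of_positive[OF gf] by blast
  have "?C closure_of ?A \<subseteq> iota E F N I X k ` D_over E F N U"
  proof
    fix y assume y: "y \<in> ?C closure_of ?A"
    then have "y \<in> topspace ?C" by (simp add: in_closure_of)
    then obtain p K t where pKt: "y = (p, K, t)" "p \<in> U" "K \<in> Grass (coord_space I)" "t \<ge> 0"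
      unfolding topspace_iota_codomain[OF gf] by auto
    obtain \<sigma> where \<sigma>: "\<And>n::nat. \<sigma> n \<in> ?A" "limitin ?C \<sigma> y sequentially"
      using first_countable_closure_sequence[OF first_countable_iota_codomain[OF gf] y] by blast
    define pn where "pn = (\<lambda>n. fst (\<sigma> n))"
    define tn where "tn = (\<lambda>n. snd (snd (\<sigma> n)))"
    have \<sigma>_eq: "\<sigma> n = (pn n, nat_ker I X k (pn n) (tn n), tn n)" and pos: "tn n > 0" and pU: "pn n \<in> U" for n
      using \<sigma>(1)[of n] by (auto simp: pn_def tn_def)
    have lim: "limitin T pn p sequentially" "tn \<longlonglongrightarrow> t"
      "limitin (Grass_topology (coord_space I)) (\<lambda>n. nat_ker I X k (pn n) (tn n)) K sequentially"
      using \<sigma>(2) unfolding \<sigma>_eq pKt(1) limitin_iota_codomain by blast+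
    have pp: "p \<in> pts E" using pKt(2) gf_pts[OF gf] by blast
    show "y \<in> iota E F N I X k ` D_over E F N U"
    proof (cases "t > 0")
      case True
      have "limitin (Grass_topology (coord_space I)) (\<lambda>n. nat_ker I X k (pn n) (tn n)) (nat_ker I X k p t) sequentially"
        by (rule nat_ker_tendsto[OF gf pKt(2) True lim(1,2)])
      then have "K = nat_ker I X k p t"
        using limitin_Hausdorff_unique[OF lim(3) _ _ G.Hausdorff_Grass] by simp
      then have "y = iota E F N I X k (Inl (p, t))" by (simp add: pKt(1))
      moreover have "Inl (p, t) \<in> D_over E F N U" using True pp pKt(2) by (auto simp: D_over_iff D_space_def)
      ultimately show ?thesis by blast
    next
      case False
      then have t: "t = 0" using pKt(4) by simp
      \<comment> \<open>The only candidate: the image of \<open>K\<close>, whose preimage is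
        \<open>K\<close> again once \<open>K\<close> is known to contain the kernel.\<close>
      define L where "L = nat_map0 E F N I X k p ` K"
      have ker: "v \<in> K" if "v \<in> coord_space I" "nat_map0 E F N I X k p v = gr_zero E F N p" for v
        using kernel_subset_limit[OF gf pKt(2) lim(1) _ lim(3) sequentially_bot that] lim(2) t by simp
      have L: "L \<in> Grass_gr E F N p" "nat_preimage E F N I X k p L = K"
        unfolding L_def using Grass_gr_of_kernel[OF gf pKt(3) ker] by blast+
      have "deg_sequence I X k p (nat_preimage E F N I X k p L) pn tn"
        using lim pos pU gf_pts[OF gf] t by (auto simp: deg_sequence_def L(2))
      then have "L \<in> B_fibre E F N p" using B_fibre_iff[OF gf pKt(2)] L(1) by blast
      then have "Inr (p, L) \<in> D_over E F N U" using pp pKt(2) by (auto simp: D_over_iff D_space_def)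
      moreover have "y = iota E F N I X k (Inr (p, L))" by (simp add: pKt(1) L(2) t)
      ultimately show ?thesis by blast
    qed
  qed
  then have "iota E F N I X k ` D_over E F N U = ?C closure_of ?A" using sub by blast
  then show ?thesis by simp
qed

lemma homeomorphic_D_over:
  assumes gf: "generating_family E F N U I X k"
  shows "subtopology D_top (D_over E F N U) homeomorphic_space
    subtopology (iota_codomain E U I) (iota E F N I X k ` D_over E F N U)"
  using embedding_map_imp_homeomorphic_space[OF embedding_iota[OF gf]] unfolding topspace_sub_D_over .

lemma continuous_beta: "continuous_map D_top (prod_topology T (top_of_set {0..})) beta"
  unfolding continuous_map_atin
proof
  fix z assume z: "z \<in> topspace D_top"
  then have zD: "z \<in> D_space E F N" using topspace_D_top by blast
  have "limitin D_top (\<lambda>z. z) z (atin D_top z)"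
    by (rule limitin_continuous_map[OF _ z refl]) simp
  note l = limit_beta[OF this]
  have "eventually (\<lambda>z. z \<in> topspace D_top) (atin D_top z)"
    unfolding eventually_atin using z openin_topspace by blast
  then have "eventually (\<lambda>z. snd (beta z) \<ge> 0) (atin D_top z)"
    unfolding topspace_D_top by eventually_elim (rule beta_nonneg)
  then show "limitin (prod_topology T (top_of_set {0..})) beta (beta z) (atin D_top z)"
    using l beta_nonneg[OF zD] by (simp add: limitin_pairwise limitin_subtopology comp_def)
qed

text \<open>Points with different images are separated through the continuous \<open>beta\<close>;
  points with the same image lie over one \<open>U\<close>, where \<open>iota\<close> embeds into a
  Hausdorff space.\<close>

lemma Hausdorff_D_top: "Hausdorff_space D_top"
  unfolding Hausdorff_space_def
proof (intro allI impI)
  fix z z' assume z: "z \<in> topspace D_top \<and> z' \<in> topspace D_top \<and> z \<noteq> z'"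
  then have zD: "z \<in> D_space E F N" "z' \<in> D_space E F N" using topspace_D_top by blast+
  show "\<exists>U V. openin D_top U \<and> openin D_top V \<and> z \<in> U \<and> z' \<in> V \<and> disjnt U V"
  proof (cases "beta z = beta z'")
    case True
    obtain U and I :: "nat set" and X k where gf: "generating_family E F N U I X k" "fst (beta z) \<in> U"
      using generating_family_exists[OF beta_pts[OF zD(1)]] by metis
    have "Hausdorff_space (subtopology D_top (D_over E F N U))"
      using homeomorphic_Hausdorff_space[OF homeomorphic_D_over[OF gf(1)]]
        Hausdorff_space_subtopology[OF Hausdorff_iota_codomain[OF gf(1)]] by blast
    moreover have "z \<in> D_over E F N U" "z' \<in> D_over E F N U" using zD gf(2) True by (auto simp: D_over_iff)
    ultimately obtain A B where "openin (subtopology D_top (D_over E F N U)) A"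
      "openin (subtopology D_top (D_over E F N U)) B" "z \<in> A" "z' \<in> B" "disjnt A B"
      using z unfolding Hausdorff_space_def topspace_sub_D_over by metis
    then show ?thesis using openin_trans_full[OF _ openin_D_over_nat[OF gf(1)]] by blast
  next
    case False
    let ?P = "prod_topology T (top_of_set {0::real..})"
    have "Hausdorff_space ?P"
      by (simp add: Hausdorff_space_prod_topology Hausdorff_space_subtopology Hausdorff_T)
    moreover have "beta z \<in> topspace ?P" "beta z' \<in> topspace ?P"
      using z continuous_map_image_subset_topspace[OF continuous_beta] by blast+
    ultimately obtain A B where AB: "openin ?P A" "openin ?P B" "beta z \<in> A" "beta z' \<in> B" "disjnt A B"
      using False unfolding Hausdorff_space_def by metis
    then show ?thesis
      using openin_continuous_map_preimage[OF continuous_beta AB(1)]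
        openin_continuous_map_preimage[OF continuous_beta AB(2)] z
      by (intro exI[of _ "{x \<in> topspace D_top. beta x \<in> A}"] exI[of _ "{x \<in> topspace D_top. beta x \<in> B}"])
        (auto simp: disjnt_def simp del: topology_generated_by_topspace)
  qed
qed

lemma locally_compact_D_top: "locally_compact_space D_top"
  unfolding locally_compact_space_def
proof
  fix z assume "z \<in> topspace D_top"
  then have zD: "z \<in> D_space E F N" using topspace_D_top by blast
  obtain U and I :: "nat set" and X k where gf: "generating_family E F N U I X k" "fst (beta z) \<in> U"
    using generating_family_exists[OF beta_pts[OF zD]] by metis
  have "locally_compact_space (subtopology D_top (D_over E F N U))"
    using homeomorphic_locally_compact_space[OF homeomorphic_D_over[OF gf(1)]]
      locally_compact_space_closed_subset[OF locally_compact_iota_codomain[OF gf(1)] closed_image_iota[OF gf(1)]]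
    by blast
  moreover have "z \<in> D_over E F N U" using zD gf(2) by (simp add: D_over_iff)
  ultimately obtain A K where AK: "openin (subtopology D_top (D_over E F N U)) A"
    "compactin (subtopology D_top (D_over E F N U)) K" "z \<in> A" "A \<subseteq> K"
    unfolding locally_compact_space_def topspace_sub_D_over by metis
  have "openin D_top A" by (rule openin_trans_full[OF AK(1) openin_D_over_nat[OF gf(1)]])
  moreover have "compactin D_top K" using AK(2) by (simp add: compactin_subtopology)
  ultimately show "\<exists>U K. openin D_top U \<and> compactin D_top K \<and> z \<in> U \<and> U \<subseteq> K" using AK(3,4) by blast
qed

text \<open>The zero fibre over \<open>p\<close> is nonempty, because the projection of the closed set \<open>\<iota>(\<beta>\<^sup>-\<^sup>1(U \<times> \<real>\<^sub>+))\<close>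
  along the compact Grassmannian is closed and contains \<open>(0, \<infinity>)\<close>.\<close>

lemma beta_surj: "beta ` D_space E F N = pts E \<times> {0..}"
proof
  show "beta ` D_space E F N \<subseteq> pts E \<times> {0..}"
  proof (rule image_subsetI)
    fix z assume "z \<in> D_space E F N"
    then show "beta z \<in> pts E \<times> {0..}" using beta_pts beta_nonneg by (simp add: mem_Times_iff)
  qed
  show "pts E \<times> {0..} \<subseteq> beta ` D_space E F N"
  proof
    fix y :: "'p \<times> real" assume "y \<in> pts E \<times> {0..}"
    then obtain p t where y: "y = (p, t)" "p \<in> pts E" "t \<ge> 0" by auto
    show "y \<in> beta ` D_space E F N"
    proof (cases "t > 0")
      case True
      then have "Inl (p, t) \<in> D_space E F N" using y by (auto simp: D_space_def)
      then show ?thesis using y(1) by force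
    next
      case False
      then have t: "t = 0" using y(3) by simp
      obtain U and I :: "nat set" and X k where gf: "generating_family E F N U I X k" "p \<in> U"
        using generating_family_exists[OF y(2)] by metis
      interpret G: fin_dim_space "coord_space I" "(\<lambda>i. Poly_Mapping.single i 1) ` I"
        by (rule coord_space_fin_dim[OF gf_finite[OF gf(1)]])
      let ?Q = "prod_topology (Grass_topology (coord_space I)) (top_of_set {0::real..})"
      let ?S = "{w \<in> topspace ?Q. (p, w) \<in> iota E F N I X k ` D_over E F N U}"
      have "continuous_map ?Q (iota_codomain E U I) (\<lambda>w. (p, w))"
        unfolding iota_codomain_def using gf(2) y(2)
        by (intro continuous_map_pairedI) (auto simp: continuous_map_const)
      then have "closedin ?Q ?S" by (rule closedin_continuous_map_preimage) (rule closed_image_iota[OF gf(1)])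
      then have "closedin (top_of_set {0::real..}) (snd ` ?S)"
        using closed_map_snd[OF G.compact_Grass] unfolding closed_map_def by blast
      then have cl: "closed (snd ` ?S)" by (rule closedin_closed_trans) simp
      have "s \<in> snd ` ?S" if s: "s > 0" for s
      proof -
        have "Inl (p, s) \<in> D_over E F N U" using s y(2) gf(2) by (auto simp: D_over_iff D_space_def)
        moreover have "iota E F N I X k (Inl (p, s)) = (p, (nat_ker I X k p s, s))" by simp
        ultimately have "(nat_ker I X k p s, s) \<in> ?S" using s nat_ker_Grass[of I X k p s]
          by (auto intro!: image_eqI[of _ _ "Inl (p, s)"])
        then show ?thesis by (rule image_eqI[rotated]) simp
      qed
      then have "inverse (real (Suc n)) \<in> snd ` ?S" for n by simp
      then have "0 \<in> snd ` ?S" using closed_sequentially[OF cl _ LIMSEQ_inverse_real_of_nat] by blast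
      then obtain z where z: "z \<in> D_over E F N U" "fst (beta z) = p" "snd (beta z) = 0"
        by (auto simp: iota_eq)
      then have "beta z = y" using y(1) t by (simp add: prod_eq_iff)
      then show ?thesis using z(1) by (auto simp: D_over_iff)
    qed
  qed
qed

end

theorem proposition1p12:
  fixes E :: "('p, 'v::real_vector) vbundle"
    and F :: "nat \<Rightarrow> ('p \<Rightarrow> 'v) set"
    and N :: nat
  assumes "smooth_bundle E"
    and "filtration E F N"
  shows "locally_compact_space (D_topology E F N) \<and>
    Hausdorff_space (D_topology E F N) \<and>
    (\<forall>U (I :: 'i set) X k. generating_family E F N U I X k \<longrightarrow>
      embedding_map (subtopology (D_topology E F N) (D_over E F N U))
        (iota_codomain E U I) (iota E F N I X k) \<and>
      closedin (iota_codomain E U I) (iota E F N I X k ` D_over E F N U)) \<and>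
    continuous_map (D_topology E F N) (prod_topology (basetop E) (top_of_set {0..})) beta \<and>
    beta ` topspace (D_topology E F N) = pts E \<times> {0..}"
proof -
  interpret filtered_bundle E F N using assms by unfold_locales
  show ?thesis
    unfolding D_topology_eq topspace_D_top
    using locally_compact_D_top Hausdorff_D_top embedding_iota closed_image_iota continuous_beta beta_surj
    by blast
qed

end
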